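(* Let $x>0$ and let $j$ be a non-negative integer. We have the following special values for $\Theta(s,s,s,x)$, where $\Theta(-j,-j,-j,x)_{L_1}:=\lim_{s\to -j}\Theta(s,s,s,x)$. (1) For $j$ odd, $\Theta(-j,-j,-j,x)_{L_1}=0$. (2) For $j$ even, $$\Theta(-j,-j,-j,x)_{L_1}=-\frac{(j!)^2}{2(2j+1)!}\left(x^{2j+1}+x^{-j-1}\right)\zeta(-3j-1)+\sum_{k=0}^{j}\binom{j}{k}x^{j-k}\zeta(-j-k)\zeta(-2j+k).$$
   Context: For $x>0$ and $(r,s,t)\in\mathbb{C}^3$ with $\Re(r+t)>1$, $\Re(s+t)>1$, $\Re(r+s+t)>2$, the generalized Mordell–Tornheim zeta function is the absolutely convergent series $\Theta(r,s,t,x)=\sum_{n=1}^{\infty}\sum_{m=1}^{\infty}\frac{1}{n^r m^s (n+mx)^t}$. For fixed $x>0$ it continues meromorphically to $(r,s,t)\in\mathbb{C}^3$, with singularities only on the hyperplanes $r+t=1-\ell$, $s+t=1-\ell$ ($\ell\in\{0,1,2,\dots\}$) and $r+s+t=2$; $\Theta$ also denotes this continuation. $\Theta(s,s,s,x)$ is considered as a meromorphic function of the one complex variable $s$ (it is given by the double series for $\Re(s)>2/3$), and the limit defining $\Theta(-j,-j,-j,x)_{L_1}$ is taken in this one-variable sense. $\zeta$ is the Riemann zeta function. *)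

theory Defs
  imports "HOL-Complex_Analysis.Complex_Analysis"
begin

text \<open>
  The meromorphic continuation to the whole plane of a function given on \<open>S\<close>. The predicate
  \<^const>\<open>nicely_meromorphic_on\<close> fixes the value 0 at poles and the limit value at removable
  singularities. Consequently there is at most one such continuation if \<open>S\<close> has a limit
  point, which holds for the half-planes below.
\<close>

definition meromorphic_continuation :: "complex set \<Rightarrow> (complex \<Rightarrow> complex) \<Rightarrow> complex \<Rightarrow> complex" where
  "meromorphic_continuation S f =
     (THE F. F nicely_meromorphic_on UNIV \<and> (\<forall>s\<in>S. F s = f s))"

lemma meromorphic_continuation_unique:
  assumes F: "F nicely_meromorphic_on UNIV" "\<And>s. s \<in> S \<Longrightarrow> F s = f s"
    and lim: "z islimpt S"
  shows "meromorphic_continuation S f = F"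
  unfolding meromorphic_continuation_def
proof (rule the_equality)
  show "F nicely_meromorphic_on UNIV \<and> (\<forall>s\<in>S. F s = f s)"
    using F by blast
next
  fix G assume G: "G nicely_meromorphic_on UNIV \<and> (\<forall>s\<in>S. G s = f s)"
  let ?D = "\<lambda>s. G s - F s"
  have mero: "?D meromorphic_on UNIV"
    using F G by (auto simp: nicely_meromorphic_on_def intro!: meromorphic_intros)
  have iso: "isolated_singularity_at ?D w" for w
    by (rule meromorphic_on_isolated_singularity[OF meromorphic_on_subset[OF mero]]) simp
  have "\<exists>\<^sub>F s in at z. ?D s = 0"
    by (rule frequently_elim1[OF lim[unfolded islimpt_conv_frequently_at]]) (simp add: F(2) G)
  hence freq: "\<exists>\<^sub>F s in at z. remove_sings ?D s = 0"
    by (rule frequently_mp[rotated])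
       (rule eventually_mono[OF eventually_remove_sings_eq_at[OF iso[of z]]], simp)
  have zero: "remove_sings ?D w = 0" for w
    by (rule frequently_eq_meromorphic_imp_constant[OF freq remove_sings_nicely_meromorphic[OF mero]]) auto
  have ev: "\<forall>\<^sub>F s in at w. ?D s = 0" for w
    using eventually_remove_sings_eq_at[OF iso[of w]] unfolding zero
    by (rule eventually_mono) simp
  show "G = F"
  proof
    fix w
    have eq: "\<forall>\<^sub>F s in at w. G s = F s"
      using ev[of w] by simp
    have "is_pole G w \<longleftrightarrow> is_pole F w"
      by (rule is_pole_cong[OF eq refl])
    moreover have "(G \<longlongrightarrow> l) (at w) \<longleftrightarrow> (F \<longlongrightarrow> l) (at w)" for l
      by (rule tendsto_cong[OF eq])
    moreover have "\<not> is_pole F w" if "(F \<longlongrightarrow> l) (at w)" for l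
      using that not_tendsto_and_filterlim_at_infinity[of "at w" F l] by (auto simp: is_pole_def)
    moreover have "is_pole F w \<and> F w = 0 \<or> F \<midarrow>w\<rightarrow> F w"
      and "is_pole G w \<and> G w = 0 \<or> G \<midarrow>w\<rightarrow> G w"
      using F(1) G unfolding nicely_meromorphic_on_def by blast+
    ultimately show "G w = F w"
      using LIM_unique[of F "F w" w "G w"] by auto
  qed
qed

definition zeta :: "complex \<Rightarrow> complex" where
  "zeta = meromorphic_continuation {s. Re s > 1}
            (\<lambda>s. \<Sum>\<^sub>\<infinity>n\<in>{1::nat..}. 1 / of_nat n powr s)"

text \<open>
  The unordered sum \<^const>\<open>infsum\<close> over all pairs is the double series in the domain of
  absolute convergence.
\<close>

definition Theta_series :: "complex \<Rightarrow> complex \<Rightarrow> complex \<Rightarrow> real \<Rightarrow> complex" where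
  "Theta_series r s t x =
     (\<Sum>\<^sub>\<infinity>(n, m)\<in>{1::nat..} \<times> {1::nat..}.
        1 / (of_nat n powr r * of_nat m powr s * of_real (real n + real m * x) powr t))"

text \<open>
  \<open>Theta_diag x s\<close> is \<open>\<Theta>(s,s,s,x)\<close> as a meromorphic function of the single variable \<open>s\<close>. For
  \<open>r = s = t\<close> the convergence conditions \<open>Re(r+t) > 1\<close>, \<open>Re(s+t) > 1\<close>, \<open>Re(r+s+t) > 2\<close>
  together amount to \<open>Re s > 2/3\<close>.
\<close>

definition Theta_diag :: "real \<Rightarrow> complex \<Rightarrow> complex" where
  "Theta_diag x = meromorphic_continuation {s. Re s > 2/3} (\<lambda>s. Theta_series s s s x)"

end

theory Submission
  imports Defs "HOL-Real_Asymp.Real_Asymp"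
begin

text \<open>
  Write \<open>Li\<^sub>s(e\<^sup>-\<^sup>t) = \<Sum> n\<^sup>-\<^sup>s e\<^sup>-\<^sup>n\<^sup>t\<close>. For \<open>Re s > 2/3\<close>, \<open>\<Gamma>(s) \<Theta>(s,s,s,x)\<close> is the Mellin transform at \<open>s\<close>
  of \<open>Li\<^sub>s(e\<^sup>-\<^sup>t) Li\<^sub>s(e\<^sup>-\<^sup>x\<^sup>t)\<close>. As \<open>t\<close> tends to 0,
  \<open>Li\<^sub>s(e\<^sup>-\<^sup>t) = \<Gamma>(1 - s) t\<^sup>s\<^sup>-\<^sup>1 + (\<Sum>k<K. \<zeta>(s - k) (-t)\<^sup>k / k!) + O(t\<^sup>K)\<close>, locally uniformly in
  \<open>Re s < 1\<close>. Cutting the integral at a small \<open>c\<close> and subtracting the product of the two expansions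
  below \<open>c\<close> leaves integrals that are holomorphic in \<open>s\<close>, and the subtracted terms integrate to
  \<open>c\<^sup>q / q\<close> with \<open>q\<close> affine in \<open>s\<close>. Since \<open>1/\<Gamma>\<close> has a simple zero at \<open>-j\<close>, only the terms with
  \<open>q = 0\<close> at \<open>s = -j\<close> contribute to the limit. For odd \<open>j\<close> each of them contains a trivial zero of \<open>\<zeta>\<close>.

  The expansion comes from \<open>R\<^sub>s(t) = Li\<^sub>s(e\<^sup>-\<^sup>t) - \<Gamma>(1 - s) t\<^sup>s\<^sup>-\<^sup>1\<close>, whose derivative is \<open>- R\<^sub>s\<^sub>-\<^sub>1(t)\<close>:
  it suffices to bound \<open>R\<^sub>s(t)\<close> near \<open>t = 0\<close>. For \<open>-1 < Re s < 1\<close>, \<open>R\<^sub>s(t)\<close> is the integral over \<open>w > 0\<close> of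
  \<open>- w\<^sup>s \<phi>'(w + t) / \<Gamma>(s + 1)\<close> with \<open>\<phi>(u) = 1/(e\<^sup>u - 1) - 1/u\<close>. This extends holomorphically to the
  unit disc in \<open>t\<close>, and Cauchy's inequality carries the bound from \<open>s\<close> to \<open>s - 1\<close>.
\<close>

subsection \<open>Integrals depending on a complex parameter\<close>

text \<open>Below c, each expansion has size O(t^(Re s - 1)) and each error O(t^K), so the
  difference of the products is integrable against t^(s-1) when 2 Re s + K > 1. A fixed K therefore
  reaches only a half-plane, and the continuations for growing K have to be glued.

  Three kinds of exponents q occur. Two singular terms give q = 3s - 2, which is nonzero at -j. A
  singular term and a power t^k give q = 2s - 1 + k, zero at -j for k = 2j + 1; this produces
  zeta(-j - (2j+1)) = zeta(-3j-1), and the slope 2 of q is the 2 in the denominator of the formula.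
  Two powers t^k and t^l give q = s + k + l, zero at -j for k + l = j; this is the binomial sum.

  The strip -1 < Re s < 1 is where w^s/(1+w)^2 is integrable over w > 0. Since zeta is specified
  only as a continuation, the Taylor coefficients are recognised through the limit of R_s(t) at t =
  0, and this limit must first be shown to continue the Dirichlet series across Re s = 1.\<close>

lemma has_field_derivative_lebesgue_integral:
  fixes f f' :: "complex \<Rightarrow> 'a \<Rightarrow> complex"
  assumes e: "e > 0"
    and deriv: "\<And>s x. s \<in> ball s0 e \<Longrightarrow> x \<in> space M \<Longrightarrow> ((\<lambda>s. f s x) has_field_derivative f' s x) (at s)"
    and meas: "\<And>s. s \<in> ball s0 e \<Longrightarrow> f s \<in> borel_measurable M"
    and D: "integrable M D" "\<And>s x. s \<in> ball s0 e \<Longrightarrow> x \<in> space M \<Longrightarrow> norm (f s x) \<le> D x"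
  shows "((\<lambda>s. integral\<^sup>L M (f s)) has_field_derivative integral\<^sup>L M (f' s0)) (at s0)"
proof -
  define r where "r = e / 2"
  have r: "r > 0" "r + r = e" using e by (auto simp: r_def)
  have hol: "(\<lambda>s. f s x) holomorphic_on ball s0 e" if "x \<in> space M" for x
    unfolding holomorphic_on_open[OF open_ball] using deriv[OF _ that] by blast
  \<comment> \<open>Domination is assumed for \<open>f\<close> alone. Cauchy's inequality on circles
    inside the larger ball turns it into a bound for the derivative on the ball of half the radius,
    and hence for the difference quotients.\<close>
  have bnd: "norm (f' z x) \<le> D x / r" if z: "z \<in> ball s0 r" and x: "x \<in> space M" for z x
  proof -
    have sub: "ball z r \<subseteq> ball s0 e"
    proof
      fix w assume "w \<in> ball z r"
      thus "w \<in> ball s0 e" using z r dist_triangle[of s0 w z] by auto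
    qed
    define q where "q = (r + dist s0 z) / 2"
    have "norm (f' z x) \<le> D x / q" if q: "0 < q" "q < r" for q
    proof -
      have sub': "cball z q \<subseteq> ball s0 e" using sub q by (auto simp: subset_eq)
      have "norm ((deriv ^^ 1) (\<lambda>s. f s x) z) \<le> fact 1 * D x / q ^ 1"
      proof (rule Cauchy_inequality)
        show "(\<lambda>s. f s x) holomorphic_on ball z q"
          using hol[OF x] sub' by (meson ball_subset_cball holomorphic_on_subset)
        show "continuous_on (cball z q) (\<lambda>s. f s x)"
          using hol[OF x] sub' by (meson holomorphic_on_imp_continuous_on continuous_on_subset)
        show "norm (f y x) \<le> D x" if "norm (z - y) = q" for y
          using D(2)[OF _ x] sub' that by (auto simp: dist_norm subset_eq)
      qed (use q in auto)
      moreover have "deriv (\<lambda>s. f s x) z = f' z x"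
        using deriv[OF _ x, of z] sub r(1) by (intro DERIV_imp_deriv) (auto simp: subset_eq)
      ultimately show ?thesis by simp
    qed
    hence "eventually (\<lambda>q. norm (f' z x) \<le> D x / q) (at_left r)"
      using r(1) by (intro eventually_at_leftI[of 0]) auto
    moreover have "((\<lambda>q. D x / q) \<longlongrightarrow> D x / r) (at_left r)"
      using r(1) by (intro tendsto_intros) auto
    ultimately show ?thesis
      by (intro tendsto_lowerbound[where F = "at_left r"]) auto
  qed
  have Lip: "norm ((f s x - f s0 x) / (s - s0)) \<le> D x / r"
    if "s \<in> ball s0 r" "x \<in> space M" "s \<noteq> s0" for s x
  proof -
    have "norm (f s x - f s0 x) \<le> D x / r * norm (s - s0)"
    proof (rule field_differentiable_bound[where S = "ball s0 r" and f' = "\<lambda>s. f' s x"])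
      show "((\<lambda>a. f a x) has_field_derivative f' z x) (at z within ball s0 r)" if "z \<in> ball s0 r" for z
        using deriv[of z x] that r \<open>x \<in> space M\<close> by (auto intro: DERIV_subset)
    qed (use bnd that r in auto)
    thus ?thesis using that r(1) by (simp add: norm_divide divide_simps)
  qed
  have s0: "s0 \<in> ball s0 e" using e by simp
  have ball_e: "s \<in> ball s0 e" if "s \<in> ball s0 r" for s using that r by auto
  have integ: "integrable M (f s)" if "s \<in> ball s0 e" for s
    using D(2)[OF that] by (intro Bochner_Integration.integrable_bound[OF D(1) meas[OF that]] AE_I2) (smt
        (verit) real_norm_def)
  have "((\<lambda>s. (integral\<^sup>L M (f s) - integral\<^sup>L M (f s0)) / (s - s0)) \<longlongrightarrow> integral\<^sup>L M (f' s0)) (at s0)"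
    unfolding tendsto_at_iff_sequentially o_def
  proof safe
    fix S :: "nat \<Rightarrow> complex"
    assume S: "\<forall>i. S i \<in> UNIV - {s0}" "S \<longlonglongrightarrow> s0"
    have "eventually (\<lambda>i. S i \<in> ball s0 r) sequentially"
      using S(2) r(1) by (auto simp: tendsto_iff dist_commute)
    then obtain N where N: "\<And>i. i \<ge> N \<Longrightarrow> S i \<in> ball s0 r"
      by (auto simp: eventually_sequentially)
    \<comment> \<open>Dominated convergence wants the bound for every index, so a shift drops the
      initial terms that may lie outside the ball.\<close>
    define T where "T i = S (i + N)" for i
    have T: "T i \<in> ball s0 r" "T i \<noteq> s0" for i using N S(1) by (auto simp: T_def)
    have T_lim: "T \<longlonglongrightarrow> s0" unfolding T_def by (rule LIMSEQ_ignore_initial_segment[OF S(2)])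
    have lim: "(\<lambda>i. (f (T i) x - f s0 x) / (T i - s0)) \<longlonglongrightarrow> f' s0 x" if "x \<in> space M" for x
    proof -
      have "((\<lambda>s. (f s x - f s0 x) / (s - s0)) \<longlongrightarrow> f' s0 x) (at s0)"
        using deriv[OF s0 that] by (simp add: has_field_derivative_iff)
      thus ?thesis
        unfolding tendsto_at_iff_sequentially o_def using T T_lim by auto
    qed
    have "(\<lambda>i. \<integral>x. (f (T i) x - f s0 x) / (T i - s0) \<partial>M) \<longlonglongrightarrow> integral\<^sup>L M (f' s0)"
    proof (rule integral_dominated_convergence)
      show mq: "(\<lambda>x. (f (T i) x - f s0 x) / (T i - s0)) \<in> borel_measurable M" for i
        using meas[OF ball_e[OF T(1)]] meas[OF s0] by measurable
      show "f' s0 \<in> borel_measurable M"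
        using mq lim by (rule borel_measurable_LIMSEQ_metric)
      show "integrable M (\<lambda>x. D x / r)" using D(1) by simp
    qed (use lim Lip T in auto)
    moreover have "(\<integral>x. (f (T i) x - f s0 x) / (T i - s0) \<partial>M)
        = (integral\<^sup>L M (f (T i)) - integral\<^sup>L M (f s0)) / (T i - s0)" for i
      using integ[OF ball_e[OF T(1)]] integ[OF s0] by simp
    ultimately have "(\<lambda>i. (integral\<^sup>L M (f (T i)) - integral\<^sup>L M (f s0)) / (T i - s0)) \<longlonglongrightarrow> integral\<^sup>L M (f' s0)"
      using T(2) by simp
    thus "(\<lambda>i. (integral\<^sup>L M (f (S i)) - integral\<^sup>L M (f s0)) / (S i - s0)) \<longlonglongrightarrow> integral\<^sup>L M (f' s0)"
      unfolding T_def by (rule LIMSEQ_offset)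
  qed
  thus ?thesis by (simp add: has_field_derivative_iff)
qed

text \<open>An arbitrary measure covers Lebesgue integrals and, through \<open>count_space\<close>,
  series at once. The dominating function may change from point to point.\<close>

lemma holomorphic_on_lebesgue_integral:
  fixes f :: "complex \<Rightarrow> 'a \<Rightarrow> complex"
  assumes U: "open U"
    and hol: "\<And>x. x \<in> space M \<Longrightarrow> (\<lambda>s. f s x) holomorphic_on U"
    and meas: "\<And>s. s \<in> U \<Longrightarrow> f s \<in> borel_measurable M"
    and D: "\<And>s0. s0 \<in> U \<Longrightarrow> \<exists>e>0. \<exists>D. integrable M D \<and> (\<forall>s\<in>ball s0 e. \<forall>x\<in>space M. norm (f s x) \<le> D x)"
  shows "(\<lambda>s. integral\<^sup>L M (f s)) holomorphic_on U"
  unfolding holomorphic_on_open[OF U]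
proof safe
  fix s0 assume s0: "s0 \<in> U"
  obtain e D where e: "e > 0" and D': "integrable M D"
    "\<forall>s\<in>ball s0 e. \<forall>x\<in>space M. norm (f s x) \<le> D x" using D[OF s0] by blast
  obtain d where d: "d > 0" "ball s0 d \<subseteq> U" using U s0 openE by blast
  have "((\<lambda>s. integral\<^sup>L M (f s)) has_field_derivative
          integral\<^sup>L M (\<lambda>x. deriv (\<lambda>s. f s x) s0)) (at s0)"
    by (rule has_field_derivative_lebesgue_integral
          [where e = "min e d" and D = D and f' = "\<lambda>s x. deriv (\<lambda>s. f s x) s"])
       (use e d D' meas in \<open>auto intro!: holomorphic_derivI[OF hol U]\<close>)
  thus "\<exists>D. ((\<lambda>s. integral\<^sup>L M (f s)) has_field_derivative D) (at s0)" by blast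
qed

text \<open>Complex \<open>powr\<close> is discontinuous across its cut, but on real bases it splits
  into three measurable pieces: the default value 0 at base 0, the real logarithm for positive base,
  and the logarithm with argument pi for negative base.\<close>

lemma borel_measurable_of_real_powr [measurable]:
  assumes [measurable]: "f \<in> borel_measurable M"
  shows "(\<lambda>x. complex_of_real (f x) powr z) \<in> borel_measurable M"
proof -
  have eq: "complex_of_real w powr z =
     (if w = 0 then 0 else if w > 0 then exp (z * of_real (ln w)) else exp (z * (of_real (ln (- w)) + \<i> *
         pi)))" for w
    by (auto simp: powr_def Ln_of_real Ln_of_real' ln_minus mult.commute)
  show ?thesis unfolding eq by measurable
qed

section \<open>Gamma integrals on the half-line and Fubini for Laplace kernels\<close>

abbreviation lborel_on :: "real set \<Rightarrow> real measure" where
  "lborel_on S \<equiv> restrict_space lborel S"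

lemma sigma_finite_lborel_on: "S \<in> sets borel \<Longrightarrow> sigma_finite_measure (lborel_on S)"
  by (rule sigma_finite_measure_restrict_space) (auto simp: lborel.sigma_finite_measure_axioms)

lemma measurable_ident_lborel_on [measurable]: "(\<lambda>x. x) \<in> borel_measurable (lborel_on S)"
  by (rule measurable_restrict_space1) auto

lemma measurable_fst_lborel_on [measurable]: "fst \<in> borel_measurable (lborel_on S \<Otimes>\<^sub>M M)"
  using measurable_compose[OF measurable_fst measurable_ident_lborel_on] by simp

lemma measurable_snd_lborel_on [measurable]: "snd \<in> borel_measurable (M \<Otimes>\<^sub>M lborel_on S)"
  using measurable_compose[OF measurable_snd measurable_ident_lborel_on] by simp

lemma Gamma_integral_scaled:
  assumes z: "Re z > 0" and a: "a > 0"
  shows "integrable (lborel_on {0<..}) (\<lambda>t. complex_of_real t powr (z - 1) * exp (- of_real (a * t)))"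
    and "(\<integral>t. complex_of_real t powr (z - 1) * exp (- of_real (a * t)) \<partial>lborel_on {0<..}) = Gamma z /
        of_real a powr z"
proof -
  have expeq: "exp (- of_real (a * t)) = 1 / complex_of_real (exp (a * t))" for a t :: real
    by (simp add: exp_minus exp_of_real divide_simps flip: of_real_mult)
  let ?f = "\<lambda>t. complex_of_real t powr (z - 1) * exp (- of_real (a * t))"
  have ai: "?f absolutely_integrable_on {0<..}"
    using absolutely_integrable_Gamma_integral[OF z a] by (simp only: expeq times_divide_eq_right
        mult_1_right)
  \<comment> \<open>\<open>absolutely_integrable_on\<close> refers to the completed measure; the
    integrand is Borel, so integrability descends to \<open>lborel\<close>.\<close>
  have int: "set_integrable lborel {0<..} ?f"
    using ai unfolding set_integrable_def by (subst (asm) integrable_completion) auto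
  show "integrable (lborel_on {0<..}) ?f"
    using int by (simp add: integrable_restrict_space set_integrable_def)
  define g where "g t = indicator {0<..} t *\<^sub>R (complex_of_real t powr (z - 1) * exp (- of_real t))" for t
      :: real
  have scale: "g (0 + a * t) = of_real a powr (z - 1) * (indicator {0<..} t *\<^sub>R ?f t)" for t
    using a by (cases "t > 0") (auto simp: g_def powr_times_real zero_less_mult_iff)
  have "integral\<^sup>L lborel g = \<bar>a\<bar> *\<^sub>R (\<integral>t. g (0 + a * t) \<partial>lborel)"
    using a by (intro lborel_integral_real_affine) auto
  also have "\<dots> = of_real a powr z * integral\<^sup>L (lborel_on {0<..}) ?f"
    unfolding scale using a
    by (subst integral_mult_right_zero) (simp add: integral_restrict_space scaleR_conv_of_real powr_diff)
  also have "integral\<^sup>L lborel g = Gamma z"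
  proof -
    have "(\<lambda>t. of_real t powr (z - 1) * exp (- of_real t)) absolutely_integrable_on {0<..}"
      using absolutely_integrable_Gamma_integral'[OF z] expeq[of 1] by simp
    hence "set_integrable lborel {0<..} (\<lambda>t. complex_of_real t powr (z - 1) * exp (- of_real t))"
      unfolding set_integrable_def by (subst (asm) integrable_completion) auto
    from set_borel_integral_eq_integral(2)[OF this]
    have "integral\<^sup>L lborel g = integral {0<..} (\<lambda>t. complex_of_real t powr (z - 1) * exp (- of_real t))"
      by (simp only: g_def [abs_def] set_lebesgue_integral_def)
    also have "\<dots> = Gamma z"
      using Gamma_integral_complex'[OF z] expeq[of 1] by (intro integral_unique) simp
    finally show ?thesis .
  qed
  finally have "Gamma z = of_real a powr z * integral\<^sup>L (lborel_on {0<..}) ?f" .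
  thus "integral\<^sup>L (lborel_on {0<..}) ?f = Gamma z / of_real a powr z"
    using a by simp
qed

lemma norm_of_real_powr: "t > 0 \<Longrightarrow> norm (complex_of_real t powr z) = t powr Re z"
  by (simp add: norm_powr_real_powr)

text \<open>On the positive axis the norm of a Gamma integrand is again a Gamma integrand, with z
  replaced by Re z.\<close>

lemma Gamma_integral_norm:
  assumes z: "Re z > 0" and a: "a > 0"
  shows "(\<integral>t. norm (complex_of_real t powr (z - 1) * exp (- of_real (a * t))) \<partial>lborel_on {0<..})
           = Gamma (Re z) * a powr - Re z"
proof -
  have "complex_of_real (\<integral>t. norm (complex_of_real t powr (z - 1) * exp (- of_real (a * t))) \<partial>lborel_on
      {0<..})
      = (\<integral>t. complex_of_real t powr (of_real (Re z) - 1) * exp (- of_real (a * t)) \<partial>lborel_on {0<..})"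
    unfolding integral_complex_of_real [symmetric]
  proof (rule Bochner_Integration.integral_cong)
    fix t assume "t \<in> space (lborel_on {0<..})"
    hence t: "t > 0" by (simp add: space_restrict_space)
    have "complex_of_real t powr (of_real (Re z) - 1) = of_real (t powr (Re z - 1))"
      using t powr_of_real[of t "Re z - 1"] by simp
    thus "complex_of_real (norm (complex_of_real t powr (z - 1) * exp (- of_real (a * t)))) =
          of_real t powr (of_real (Re z) - 1) * exp (- of_real (a * t))"
      using t by (simp add: norm_mult norm_of_real_powr flip: exp_of_real)
  qed simp
  also have "\<dots> = of_real (Gamma (Re z) * a powr - Re z)"
    using z a by (subst Gamma_integral_scaled)
      (auto simp: Gamma_complex_of_real powr_of_real powr_minus divide_inverse)
  finally show ?thesis by (simp only: of_real_eq_iff)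
qed

text \<open>The w-integral of the norm is a Gamma integral, so absolute convergence of the double
  integral is exactly the last hypothesis. The lemma serves three times: with Lebesgue measure on
  the half-line, with counting measure on the positive integers, and with counting measure on
  pairs.\<close>

lemma Laplace_Fubini:
  fixes M :: "'a measure" and g :: "'a \<Rightarrow> complex" and a :: "'a \<Rightarrow> real"
  assumes M: "sigma_finite_measure M"
    and [measurable]: "g \<in> borel_measurable M" "a \<in> borel_measurable M"
    and a: "\<And>v. v \<in> space M \<Longrightarrow> a v > 0"
    and z: "Re z > 0"
    and int: "integrable M (\<lambda>v. norm (g v) * a v powr - Re z)"
  shows "integrable (lborel_on {0<..}) (\<lambda>w. of_real w powr (z - 1) * (\<integral>v. g v * exp (- of_real (a v * w))
      \<partial>M))"
    and "(\<integral>w. of_real w powr (z - 1) * (\<integral>v. g v * exp (- of_real (a v * w)) \<partial>M) \<partial>lborel_on {0<..})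
          = Gamma z * (\<integral>v. g v / of_real (a v) powr z \<partial>M)"
proof -
  let ?P = "lborel_on {0<..}"
  interpret M: sigma_finite_measure M by (rule M)
  interpret P: sigma_finite_measure ?P by (rule sigma_finite_lborel_on) simp
  interpret MP: pair_sigma_finite M ?P ..
  define f where "f v w = g v * (complex_of_real w powr (z - 1) * exp (- of_real (a v * w)))" for v w
  have f_int: "integrable ?P (f v)" if "v \<in> space M" for v
    unfolding f_def using Gamma_integral_scaled(1)[OF z a[OF that]] by (rule integrable_mult_right)
  have prod: "integrable (M \<Otimes>\<^sub>M ?P) (case_prod f)"
  proof (rule MP.Fubini_integrable)
    show "case_prod f \<in> borel_measurable (M \<Otimes>\<^sub>M ?P)"
      unfolding f_def case_prod_beta by measurable
    have "(\<integral>w. norm (f v w) \<partial>?P) = Gamma (Re z) * (norm (g v) * a v powr - Re z)" if "v \<in> space M" for v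
      using Gamma_integral_norm[OF z a[OF that]] by (simp add: f_def norm_mult)
    hence "integrable M (\<lambda>v. \<integral>w. norm (f v w) \<partial>?P) \<longleftrightarrow> integrable M (\<lambda>v. Gamma (Re z) * (norm (g v) * a v
        powr - Re z))"
      by (intro Bochner_Integration.integrable_cong) auto
    thus "integrable M (\<lambda>v. \<integral>w. norm (case_prod f (v, w)) \<partial>?P)" using int by simp
    show "AE v in M. integrable ?P (\<lambda>w. case_prod f (v, w))" using f_int by auto
  qed
  have inner: "(\<integral>v. f v w \<partial>M) = of_real w powr (z - 1) * (\<integral>v. g v * exp (- of_real (a v * w)) \<partial>M)" for w
    unfolding f_def by (subst integral_mult_right_zero [symmetric]) (simp add: mult_ac)
  have outer: "(\<integral>w. f v w \<partial>?P) = Gamma z * (g v / of_real (a v) powr z)" if "v \<in> space M" for v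
    unfolding f_def using Gamma_integral_scaled(2)[OF z a[OF that]] by simp
  show "integrable ?P (\<lambda>w. of_real w powr (z - 1) * (\<integral>v. g v * exp (- of_real (a v * w)) \<partial>M))"
    using MP.integrable_snd[OF prod] unfolding inner .
  have "(\<integral>w. of_real w powr (z - 1) * (\<integral>v. g v * exp (- of_real (a v * w)) \<partial>M) \<partial>?P) = (\<integral>v. (\<integral>w. f v w \<partial>?P)
      \<partial>M)"
    using MP.Fubini_integral[OF prod] unfolding inner .
  also have "\<dots> = (\<integral>v. Gamma z * (g v / of_real (a v) powr z) \<partial>M)"
    using outer by (intro Bochner_Integration.integral_cong) auto
  also have "\<dots> = Gamma z * (\<integral>v. g v / of_real (a v) powr z \<partial>M)"
    by (rule integral_mult_right_zero)
  finally show "(\<integral>w. of_real w powr (z - 1) * (\<integral>v. g v * exp (- of_real (a v * w)) \<partial>M) \<partial>?P)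
      = Gamma z * (\<integral>v. g v / of_real (a v) powr z \<partial>M)" .
qed

lemma norm_lebesgue_integral_le:
  fixes f :: "'a \<Rightarrow> complex" and g :: "'a \<Rightarrow> real"
  assumes "integrable M g" "\<And>x. x \<in> space M \<Longrightarrow> norm (f x) \<le> g x"
  shows "norm (integral\<^sup>L M f) \<le> integral\<^sup>L M g"
proof (rule order_trans[OF integral_norm_bound integral_mono'])
  show "0 \<le> g x" if "x \<in> space M" for x using assms(2)[OF that] norm_ge_zero[of "f x"] by linarith
qed (use assms in auto)

lemma bij_betw_Suc_nat: "bij_betw Suc UNIV {1..}"
  by (auto simp: bij_betw_def image_iff Suc_le_eq gr0_conv_Suc)

lemma integrable_powr_exp_nat:
  assumes a: "a > 0"
  shows "integrable (count_space {1::nat..}) (\<lambda>n. real n powr B * exp (- (a * real n)))"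
proof -
  have "(\<lambda>x. x powr B * exp (- (a * x))) \<in> O(\<lambda>x::real. inverse (x ^ 2))"
    using a by real_asymp
  hence "(\<lambda>n::nat. real n powr B * exp (- (a * real n))) \<in> O(\<lambda>n. inverse (real n ^ 2))"
    by (rule landau_o.big.compose[OF _ filterlim_real_sequentially])
  hence "summable (\<lambda>n::nat. real n powr B * exp (- (a * real n)))"
    by (rule summable_comparison_test_bigo[rotated])
       (simp add: inverse_power_summable norm_inverse norm_power)
  hence "summable (\<lambda>n::nat. norm (real n powr B * exp (- (a * real n))))"
    by simp
  hence "summable (\<lambda>n::nat. norm (real (Suc n) powr B * exp (- (a * real (Suc n)))))"
    by (subst summable_Suc_iff)
  hence "integrable (count_space UNIV) (\<lambda>n::nat. real (Suc n) powr B * exp (- (a * real (Suc n))))"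
    by (subst integrable_count_space_nat_iff)
  thus ?thesis using integrable_bij_count_space[OF bij_betw_Suc_nat] by blast
qed

subsection \<open>The polylogarithm near the origin\<close>

text \<open>Written as an integral over counting measure, so that the lemmas on parameter integrals
  and Fubini apply to the series.\<close>

definition polylog :: "complex \<Rightarrow> complex \<Rightarrow> complex" where
  "polylog s \<tau> = (\<integral>n. of_nat n powr - s * exp (- (of_nat n * \<tau>)) \<partial>count_space {1::nat..})"

lemma norm_polylog_term_le:
  assumes "Re s \<ge> - B" "Re \<tau> \<ge> a" "n \<ge> (1::nat)"
  shows "norm (of_nat n powr - s * exp (- (of_nat n * \<tau>))) \<le> real n powr B * exp (- (a * real n))"
proof -
  have "norm (complex_of_real (real n) powr - s) = real n powr - Re s"
    using assms by (subst norm_of_real_powr) auto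
  thus ?thesis using assms
    by (auto simp: norm_mult mult.commute[of a] intro!: mult_mono powr_mono)
qed

lemma integrable_polylog:
  assumes "Re \<tau> > 0"
  shows "integrable (count_space {1::nat..}) (\<lambda>n. of_nat n powr - s * exp (- (of_nat n * \<tau>)))"
  using norm_polylog_term_le[of "- Re s" s "Re \<tau>" \<tau>]
  by (intro Bochner_Integration.integrable_bound[OF integrable_powr_exp_nat[OF assms, of "- Re s"]] AE_I2)
     auto

lemma norm_polylog_le:
  assumes "Re s \<ge> - B" "Re \<tau> \<ge> a" "a > 0"
  shows "norm (polylog s \<tau>) \<le> (\<integral>n. real n powr B * exp (- (a * real n)) \<partial>count_space {1::nat..})"
  unfolding polylog_def
  by (rule norm_lebesgue_integral_le) (use assms integrable_polylog integrable_powr_exp_nat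
      norm_polylog_term_le in auto)

lemma has_field_derivative_polylog:
  assumes "Re \<tau> > 0"
  shows "(polylog s has_field_derivative - polylog (s - 1) \<tau>) (at \<tau>)"
proof -
  define N where "N = count_space {1::nat..}"
  \<comment> \<open>The radius Re \<tau> / 2 keeps a uniform exponential decay in n on the whole
    ball.\<close>
  have Re: "Re z \<ge> Re \<tau> / 2" if "z \<in> ball \<tau> (Re \<tau> / 2)" for z
    using that abs_Re_le_cmod[of "\<tau> - z"] by (simp add: dist_norm)
  have "((\<lambda>\<tau>. \<integral>n. of_nat n powr - s * exp (- (of_nat n * \<tau>)) \<partial>N) has_field_derivative
         (\<integral>n. - (of_nat n powr - (s - 1) * exp (- (of_nat n * \<tau>))) \<partial>N)) (at \<tau>)"
  proof (rule has_field_derivative_lebesgue_integral[where e = "Re \<tau> / 2"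
           and D = "\<lambda>n. real n powr (- Re s) * exp (- (Re \<tau> / 2 * real n))"])
    fix z :: complex and n assume "n \<in> space N"
    hence n: "n \<ge> 1" by (simp add: N_def)
    have "of_nat n powr (- (s - 1)) = of_nat n powr - s * (of_nat n :: complex)"
      using n powr_add[of "of_nat n :: complex" "- s" 1] by simp
    thus "((\<lambda>\<tau>. of_nat n powr - s * exp (- (of_nat n * \<tau>))) has_field_derivative
           - (of_nat n powr - (s - 1) * exp (- (of_nat n * z)))) (at z)"
      by (auto intro!: derivative_eq_intros)
  next
    fix z :: complex and n assume "z \<in> ball \<tau> (Re \<tau> / 2)" "n \<in> space N"
    thus "norm (of_nat n powr - s * exp (- (of_nat n * z))) \<le> real n powr (- Re s) * exp (- (Re \<tau> / 2 *
        real n))"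
      using Re by (intro norm_polylog_term_le) (auto simp: N_def)
  next
    show "integrable N (\<lambda>n. real n powr (- Re s) * exp (- (Re \<tau> / 2 * real n)))"
      unfolding N_def using assms by (intro integrable_powr_exp_nat) auto
  qed (use assms in \<open>auto simp: N_def\<close>)
  thus ?thesis by (simp add: polylog_def [abs_def] N_def)
qed

lemma holomorphic_polylog_param:
  assumes "Re \<tau> > 0"
  shows "(\<lambda>s. polylog s \<tau>) holomorphic_on UNIV"
  unfolding polylog_def
proof (rule holomorphic_on_lebesgue_integral)
  fix s0 :: complex
  have "norm (of_nat n powr - s * exp (- (of_nat n * \<tau>))) \<le> real n powr (1 - Re s0) * exp (- (Re \<tau> * real n))"
    if "s \<in> ball s0 1" "n \<ge> 1" for s and n :: nat
    using that abs_Re_le_cmod[of "s0 - s"] by (intro norm_polylog_term_le) (auto simp: dist_norm)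
  thus "\<exists>e>0. \<exists>D. integrable (count_space {1..}) D \<and>
    (\<forall>s\<in>ball s0 e. \<forall>n\<in>space (count_space {1..}). norm (of_nat n powr - s * exp (- (of_nat n * \<tau>))) \<le> D n)"
    using assms by (intro exI[of _ 1] conjI exI[of _ "\<lambda>n. real n powr (1 - Re s0) * exp (- (Re \<tau> * real n))"]
       integrable_powr_exp_nat) auto
qed (auto intro!: holomorphic_intros)

definition polylog_sing :: "complex \<Rightarrow> complex \<Rightarrow> complex" where
  "polylog_sing s \<tau> = Gamma (1 - s) * \<tau> powr (s - 1)"

definition polylog_reg :: "complex \<Rightarrow> complex \<Rightarrow> complex" where
  "polylog_reg s \<tau> = polylog s \<tau> - polylog_sing s \<tau>"

lemma Re_pos_imp_notin_nonpos_Reals: "Re \<tau> > 0 \<Longrightarrow> \<tau> \<notin> \<real>\<^sub>\<le>\<^sub>0"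
  by (auto simp: complex_nonpos_Reals_iff)

lemma Re_pos_imp_notin_nonpos_Ints: "Re \<tau> > 0 \<Longrightarrow> \<tau> \<notin> \<int>\<^sub>\<le>\<^sub>0"
  by (auto elim!: nonpos_Ints_cases)

text \<open>By Gamma(2-s) = (1-s) Gamma(1-s) the singular part satisfies the same differential
  relation as the polylogarithm, so their difference inherits it.\<close>

lemma has_field_derivative_polylog_sing:
  assumes "Re \<tau> > 0" "Re s < 1"
  shows "(polylog_sing s has_field_derivative - polylog_sing (s - 1) \<tau>) (at \<tau>)"
proof -
  have "Gamma (1 - s + 1) = (1 - s) * Gamma (1 - s)"
    using assms by (intro Gamma_plus1 Re_pos_imp_notin_nonpos_Ints) auto
  hence eq: "Gamma (1 - (s - 1)) = (1 - s) * Gamma (1 - s)" by (simp add: algebra_simps)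
  have "Gamma (1 - s) * ((s - 1) * \<tau> powr (s - 1 - 1)) = - (Gamma (1 - (s - 1)) * \<tau> powr (s - 1 - 1))"
    unfolding eq by (simp add: algebra_simps)
  moreover have "((\<lambda>\<tau>. Gamma (1 - s) * \<tau> powr (s - 1)) has_field_derivative
      Gamma (1 - s) * ((s - 1) * \<tau> powr (s - 1 - 1))) (at \<tau>)"
    using Re_pos_imp_notin_nonpos_Reals[OF assms(1)] by (auto intro!: derivative_eq_intros)
  ultimately show ?thesis unfolding polylog_sing_def [abs_def] by simp
qed

lemma has_field_derivative_polylog_reg:
  assumes "Re \<tau> > 0" "Re s < 1"
  shows "(polylog_reg s has_field_derivative - polylog_reg (s - 1) \<tau>) (at \<tau>)"
  unfolding polylog_reg_def [abs_def]
  using DERIV_diff[OF has_field_derivative_polylog[OF assms(1)] has_field_derivative_polylog_sing[OF assms]]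
  by (simp add: algebra_simps)

lemma holomorphic_polylog_reg:
  assumes "Re s < 1"
  shows "polylog_reg s holomorphic_on {\<tau>. Re \<tau> > 0}"
  using has_field_derivative_polylog_reg[OF _ assms]
  by (subst holomorphic_on_open) (auto intro: open_halfspace_Re_gt)

section \<open>The function phi and bounds for its derivative\<close>

definition phi :: "complex \<Rightarrow> complex" where
  "phi z = (let g = (\<lambda>z. inverse (if z = 0 then 1 else (exp z - 1) / z))
            in if z = 0 then deriv g 0 else (g z - g 0) / z)"

lemma phi_eq: "z \<noteq> 0 \<Longrightarrow> phi z = 1 / (exp z - 1) - 1 / z"
  by (auto simp: phi_def Let_def divide_simps)

lemma exp_eq_1_strip:
  assumes "\<bar>Im z\<bar> < 2 * pi" "exp z = 1"
  shows "z = 0"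
proof -
  from assms(2) obtain n :: int where n: "Re z = 0" "Im z = of_int (2 * n) * pi"
    by (auto simp: exp_eq_1)
  have "\<bar>real_of_int n\<bar> < 1"
    using assms(1) n(2) by (simp add: abs_mult)
  hence "n = 0" by linarith
  thus ?thesis using n by (simp add: complex_eq_iff)
qed

lemma open_Im_strip: "open {z. \<bar>Im z\<bar> < c}"
  by (intro open_Collect_less continuous_intros)

text \<open>The definition of \<open>phi\<close> is shaped for two uses of
  \<open>pole_lemma_open\<close>. The first fills (exp z - 1)/z with the value 1 at 0; its inverse
  z/(exp z - 1) is holomorphic in the strip, where exp z = 1 only at 0. The second takes the
  difference quotient of that inverse at 0, which is 1/(exp z - 1) - 1/z.\<close>

lemma holomorphic_phi: "phi holomorphic_on {z. \<bar>Im z\<bar> < 2 * pi}"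
proof -
  let ?S = "{z. \<bar>Im z\<bar> < 2 * pi}"
  have "deriv exp (0::complex) = 1"
    by (rule DERIV_imp_deriv) (auto intro!: derivative_eq_intros)
  with pole_lemma_open[OF holomorphic_on_exp open_Im_strip[of "2 * pi"], of 0]
  have "(\<lambda>z. if z = 0 then 1 else (exp z - 1) / z :: complex) holomorphic_on ?S"
    by (simp only: exp_zero diff_zero)
  hence "(\<lambda>z. inverse (if z = 0 then 1 else (exp z - 1) / z :: complex)) holomorphic_on ?S"
    using exp_eq_1_strip by (intro holomorphic_intros) auto
  from pole_lemma_open[OF this open_Im_strip, of 0] show ?thesis
    by (simp only: phi_def [abs_def] Let_def diff_zero)
qed

text \<open>In other words, \<open>phi\<close> + 1/2 is odd; this symmetry is the source of the
  trivial zeros of zeta.\<close>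

lemma phi_minus:
  assumes "\<bar>Im z\<bar> < 2 * pi" "z \<noteq> 0"
  shows "phi (- z) = - 1 - phi z"
proof -
  have "exp z \<noteq> 1" using exp_eq_1_strip[OF assms(1)] assms(2) by auto
  thus ?thesis using assms(2) by (simp add: phi_eq exp_minus divide_simps) (simp add: algebra_simps)
qed

lemma polylog_0:
  assumes "Re \<tau> > 0"
  shows "polylog 0 \<tau> = 1 / (exp \<tau> - 1)"
proof -
  have n: "norm (exp (- \<tau>)) < 1" using assms by simp
  have sm: "summable (\<lambda>k. norm (exp (- \<tau>) ^ Suc k))"
    using n by (auto simp: norm_power norm_mult intro!: summable_mult summable_geometric)
  have "polylog 0 \<tau> = (\<integral>n. exp (- \<tau>) ^ n \<partial>count_space {1..})"
    unfolding polylog_def by (intro Bochner_Integration.integral_cong) (auto simp flip: exp_of_nat_mult)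
  also have "\<dots> = (\<integral>n. exp (- \<tau>) ^ Suc n \<partial>count_space UNIV)"
    by (rule integral_bij_count_space[OF bij_betw_Suc_nat, symmetric])
  also have "\<dots> = (\<Sum>n. exp (- \<tau>) ^ Suc n)"
    using sm by (intro integral_count_space_nat) (subst integrable_count_space_nat_iff)
  also have "\<dots> = exp (- \<tau>) * (1 / (1 - exp (- \<tau>)))"
    using geometric_sums[OF n] by (intro sums_unique[symmetric]) (auto dest: sums_mult)
  also have "\<dots> = 1 / (exp \<tau> - 1)"
  proof -
    have "exp \<tau> \<noteq> 1" using assms norm_exp_eq_Re[of \<tau>] by fastforce
    thus ?thesis by (simp add: exp_minus divide_simps)
  qed
  finally show ?thesis .
qed

lemma polylog_reg_0: "Re \<tau> > 0 \<Longrightarrow> polylog_reg 0 \<tau> = phi \<tau>"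
  by (subst phi_eq) (auto simp: polylog_reg_def polylog_sing_def polylog_0 powr_minus divide_inverse)

lemma deriv_phi_eq: "Re u > 0 \<Longrightarrow> \<bar>Im u\<bar> < 2 * pi \<Longrightarrow> deriv phi u = - polylog_reg (- 1) u"
proof -
  assume u: "Re u > 0"
  have "(phi has_field_derivative - polylog_reg (0 - 1) u) (at u)"
    by (rule has_field_derivative_transform_within_open[OF has_field_derivative_polylog_reg[OF u, of 0],
        of "{u. Re u > 0}"])
       (use u polylog_reg_0 open_halfspace_Re_gt in auto)
  thus ?thesis by (simp add: DERIV_imp_deriv)
qed

lemma deriv_phi_far:
  assumes "Re u > 0"
  shows "deriv phi u = 1 / u ^ 2 - exp u / (exp u - 1) ^ 2"
proof -
  have "exp u \<noteq> 1" using assms norm_exp_eq_Re[of u] by fastforce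
  moreover have "u \<noteq> 0" using assms by auto
  ultimately have "((\<lambda>z. 1 / (exp z - 1) - 1 / z) has_field_derivative
      1 / u ^ 2 - exp u / (exp u - 1) ^ 2) (at u)"
    by (auto intro!: derivative_eq_intros simp: power2_eq_square)
  hence "(phi has_field_derivative 1 / u ^ 2 - exp u / (exp u - 1) ^ 2) (at u)"
  proof (rule has_field_derivative_transform_within_open)
    show "open {u. Re u > 0}" by (rule open_halfspace_Re_gt)
    show "1 / (exp z - 1) - 1 / z = phi z" if "z \<in> {u. Re u > 0}" for z
      using that by (intro phi_eq[symmetric]) auto
  qed (use assms in auto)
  thus ?thesis by (rule DERIV_imp_deriv)
qed

lemma holomorphic_deriv_phi: "deriv phi holomorphic_on {z. \<bar>Im z\<bar> < 2 * pi}"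
  by (intro holomorphic_deriv holomorphic_phi open_Im_strip)

text \<open>The constant is 9 = 1 + 8. The term 1/u^2 gives 1; for the other, Re u \<ge> 2 makes
  norm (exp u - 1) at least half of exp (Re u), so the quotient is at most 4 / exp (Re u), and exp a
  \<ge> a^2/2 gives 8.\<close>

lemma norm_deriv_phi_far:
  assumes u: "Re u \<ge> 2"
  shows "norm (deriv phi u) \<le> 9 / (Re u)\<^sup>2"
proof -
  define a where "a = Re u"
  have a: "a \<ge> 2" using u by (simp add: a_def)
  have e: "exp a \<ge> 2" "exp a \<ge> a\<^sup>2 / 2"
    using exp_lower_Taylor_quadratic[of a] a zero_le_power2[of a] by linarith+
  have "norm (exp u - 1) \<ge> exp a - 1"
    using norm_triangle_ineq2[of "exp u" 1] by (simp add: a_def norm_exp_eq_Re)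
  hence n1: "norm (exp u - 1) \<ge> exp a / 2" using e(1) by linarith
  have "norm (exp u / (exp u - 1) ^ 2) = exp a / norm (exp u - 1) ^ 2"
    by (simp add: norm_divide norm_power a_def norm_exp_eq_Re)
  also have "\<dots> \<le> exp a / (exp a / 2) ^ 2"
    using n1 e by (intro divide_left_mono power_mono mult_pos_pos) auto
  also have "\<dots> = 4 / exp a" by (simp add: power2_eq_square)
  also have "\<dots> \<le> 4 / (a\<^sup>2 / 2)" using e a by (intro divide_left_mono) auto
  finally have 1: "norm (exp u / (exp u - 1) ^ 2) \<le> 8 / a\<^sup>2" by simp
  have "norm u \<ge> a" using complex_Re_le_cmod[of u] by (simp add: a_def)
  hence 2: "norm (1 / u ^ 2) \<le> 1 / a\<^sup>2"
    using a by (auto simp: norm_divide norm_power intro!: divide_left_mono power_mono mult_pos_pos)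
  have "norm (deriv phi u) \<le> norm (1 / u ^ 2) + norm (exp u / (exp u - 1) ^ 2)"
    using u by (subst deriv_phi_far) (auto intro: norm_triangle_ineq4)
  also have "\<dots> \<le> 9 / a\<^sup>2" using 1 2 a by (simp add: field_simps)
  finally show ?thesis by (simp add: a_def)
qed

lemma deriv_phi_bound:
  obtains C where "C > 0" "\<And>w \<tau>. w \<ge> 0 \<Longrightarrow> \<tau> \<in> ball 0 1 \<Longrightarrow> norm (deriv phi (of_real w + \<tau>)) \<le> C / (1 + w)\<^sup>2"
proof -
  \<comment> \<open>The rectangle contains w + \<tau> for all 0 \<le> w \<le> 3 and norm \<tau> < 1,
    and it avoids the poles because 1 < 2 pi. For w > 3 the real part exceeds w - 1 \<ge> (1 + w)/2
    \<ge> 2, where the decay estimate takes over; the constants are 4^2 B and 4 * 9.\<close>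
  let ?K = "cbox (Complex (-1) (-1)) (Complex 4 1)"
  have "?K \<subseteq> {z. \<bar>Im z\<bar> < 2 * pi}"
    using pi_gt3 by (auto simp: in_cbox_complex_iff)
  hence "compact (deriv phi ` ?K)"
    using holomorphic_on_imp_continuous_on[OF holomorphic_deriv_phi]
    by (intro compact_continuous_image) (auto intro: continuous_on_subset)
  from compact_imp_bounded[OF this]
  obtain B where B: "\<And>z. z \<in> ?K \<Longrightarrow> norm (deriv phi z) \<le> B" and B0: "B > 0"
    by (auto simp: bounded_pos)
  have "norm (deriv phi (of_real w + \<tau>)) \<le> (16 * B + 36) / (1 + w)\<^sup>2" if w: "w \<ge> 0" and \<tau>: "\<tau> \<in> ball 0 1"
      for w \<tau>
  proof (cases "w \<le> 3")
    case True
    have "\<bar>Re \<tau>\<bar> < 1" "\<bar>Im \<tau>\<bar> < 1"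
      using \<tau> abs_Re_le_cmod[of \<tau>] abs_Im_le_cmod[of \<tau>] by auto
    hence "norm (deriv phi (of_real w + \<tau>)) \<le> B"
      using w True by (intro B) (auto simp: in_cbox_complex_iff)
    moreover have "B * (1 + w)\<^sup>2 \<le> B * 4\<^sup>2"
      using w True B0 by (intro mult_left_mono power_mono) auto
    hence "B * (1 + w)\<^sup>2 \<le> 16 * B + 36" by simp
    hence "B \<le> (16 * B + 36) / (1 + w)\<^sup>2"
      using w by (subst pos_le_divide_eq) auto
    ultimately show ?thesis by linarith
  next
    case False
    have "Re \<tau> > -1" using \<tau> abs_Re_le_cmod[of \<tau>] by auto
    hence R: "Re (of_real w + \<tau>) \<ge> (1 + w) / 2" using False by simp
    have "norm (deriv phi (of_real w + \<tau>)) \<le> 9 / (Re (of_real w + \<tau>))\<^sup>2"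
      using R False by (intro norm_deriv_phi_far) auto
    also have "\<dots> \<le> 9 / ((1 + w) / 2)\<^sup>2"
      using R w by (intro divide_left_mono power_mono mult_pos_pos) auto
    also have "\<dots> = 36 / (1 + w)\<^sup>2" by (simp add: power2_eq_square)
    also have "\<dots> \<le> (16 * B + 36) / (1 + w)\<^sup>2" using B0 by (intro divide_right_mono) auto
    finally show ?thesis .
  qed
  thus ?thesis using that[of "16 * B + 36"] B0 by simp
qed

text \<open>Write 1/(w+t)^2 as the integral of v exp(-v(w+t)) over v > 0 and exchange the integrals.
  The w-integral gives Gamma(s+1), which needs Re s > -1; the remaining v-integral gives Gamma(1-s)
  t^(s-1), which needs Re s < 1.\<close>

lemma polylog_sing_integral:
  assumes s: "-1 < Re s" "Re s < 1" and t: "t > 0"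
  shows "integrable (lborel_on {0<..}) (\<lambda>w. of_real w powr s * (1 / of_real (w + t) ^ 2))"
    and "(\<integral>w. of_real w powr s * (1 / of_real (w + t) ^ 2) \<partial>lborel_on {0<..}) = Gamma (s + 1) *
        polylog_sing s (of_real t)"
proof -
  let ?P = "lborel_on {0<..}"
  define g where "g v = complex_of_real v * exp (- of_real (v * t))" for v :: real
  have [measurable]: "g \<in> borel_measurable ?P" unfolding g_def by measurable
  have g_int: "integrable ?P (\<lambda>v. norm (g v) * v powr - Re (s + 1))"
  proof -
    have "integrable ?P (\<lambda>v. norm (complex_of_real v powr (1 - s - 1) * exp (- of_real (t * v))))"
      using s t by (intro integrable_norm Gamma_integral_scaled) auto
    also have "?this \<longleftrightarrow> ?thesis"
    proof (rule Bochner_Integration.integrable_cong[OF refl])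
      fix v assume "v \<in> space ?P"
      hence v: "v > 0" by (simp add: space_restrict_space)
      have "v powr - Re s = v * v powr - Re (s + 1)"
        using v powr_add[of v 1 "- Re (s + 1)"] by simp
      thus "norm (complex_of_real v powr (1 - s - 1) * exp (- of_real (t * v))) = norm (g v) * v powr - Re
          (s + 1)"
        using v by (simp add: g_def norm_mult norm_of_real_powr mult_ac)
    qed
    finally show ?thesis .
  qed
  have inner: "(\<integral>v. g v * exp (- of_real (v * w)) \<partial>?P) = 1 / of_real (w + t) ^ 2" if "w \<in> space ?P" for w
  proof -
    have w: "w > 0" using that by (simp add: space_restrict_space)
    have "(\<integral>v. g v * exp (- of_real (v * w)) \<partial>?P) =
          (\<integral>v. complex_of_real v powr (2 - 1) * exp (- of_real ((w + t) * v)) \<partial>?P)"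
      by (intro Bochner_Integration.integral_cong)
         (auto simp: g_def space_restrict_space exp_add [symmetric] algebra_simps)
    also have "\<dots> = Gamma 2 / of_real (w + t) powr 2"
      using w t by (intro Gamma_integral_scaled) auto
    also have "Gamma (2 :: complex) = 1" using Gamma_fact[of 1, where ?'a = complex] by simp
    finally show ?thesis using w t by (simp add: powr_nat' del: of_real_add)
  qed
  have outer: "g v / of_real v powr (s + 1) = of_real v powr (1 - s - 1) * exp (- of_real (t * v))" if "v
      \<in> space ?P" for v
    using that by (auto simp: g_def powr_add powr_minus space_restrict_space divide_simps mult_ac)
  have eq: "of_real w powr (s + 1 - 1) * (\<integral>v. g v * exp (- of_real (v * w)) \<partial>?P) = of_real w powr s * (1 /
      of_real (w + t) ^ 2)"
    if "w \<in> space ?P" for w using inner[OF that] by simp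
  note LF = Laplace_Fubini[OF sigma_finite_lborel_on, of "{0<..}" g "\<lambda>v. v" "s + 1"]
  have 1: "integrable ?P (\<lambda>w. of_real w powr (s + 1 - 1) * (\<integral>v. g v * exp (- of_real (v * w)) \<partial>?P))"
    by (rule LF) (use s g_int in \<open>auto simp: space_restrict_space\<close>)
  show "integrable ?P (\<lambda>w. of_real w powr s * (1 / of_real (w + t) ^ 2))"
    using 1 eq by (subst Bochner_Integration.integrable_cong[OF refl eq[symmetric]]) auto
  have "(\<integral>w. of_real w powr s * (1 / of_real (w + t) ^ 2) \<partial>?P)
      = (\<integral>w. of_real w powr (s + 1 - 1) * (\<integral>v. g v * exp (- of_real (v * w)) \<partial>?P) \<partial>?P)"
    using eq by (intro Bochner_Integration.integral_cong) auto
  also have "\<dots> = Gamma (s + 1) * (\<integral>v. g v / of_real v powr (s + 1) \<partial>?P)"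
    by (rule LF) (use s g_int in \<open>auto simp: space_restrict_space\<close>)
  also have "(\<integral>v. g v / of_real v powr (s + 1) \<partial>?P) = (\<integral>v. of_real v powr (1 - s - 1) * exp (- of_real (t
      * v)) \<partial>?P)"
    using outer by (intro Bochner_Integration.integral_cong) auto
  also have "\<dots> = Gamma (1 - s) / of_real t powr (1 - s)"
    using s t by (intro Gamma_integral_scaled) auto
  also have "\<dots> = polylog_sing s (of_real t)"
    using t powr_minus[of "of_real t :: complex" "1 - s"] by (simp add: polylog_sing_def divide_inverse)
  finally show "(\<integral>w. of_real w powr s * (1 / of_real (w + t) ^ 2) \<partial>?P) = Gamma (s + 1) * polylog_sing s
      (of_real t)" .
qed

text \<open>The same exchange with a sum over n in place of the integral over v:
  \<open>polylog (-1)\<close> at w + t is the sum of n exp(-n t) exp(-n w).\<close>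

lemma polylog_integral:
  assumes s: "-1 < Re s" and t: "t > 0"
  shows "integrable (lborel_on {0<..}) (\<lambda>w. of_real w powr s * polylog (-1) (of_real (w + t)))"
    and "(\<integral>w. of_real w powr s * polylog (-1) (of_real (w + t)) \<partial>lborel_on {0<..}) = Gamma (s + 1) *
        polylog s (of_real t)"
proof -
  let ?P = "lborel_on {0<..}" and ?N = "count_space {1::nat..}"
  define g where "g n = complex_of_nat n * exp (- of_real (real n * t))" for n :: nat
  have outer: "g n / of_real (real n) powr (s + 1) = of_nat n powr - s * exp (- (of_nat n * of_real t))"
      if "n \<in> space ?N" for n
    using that by (auto simp: g_def powr_add powr_minus divide_simps)
  have g_int: "integrable ?N (\<lambda>n. norm (g n) * real n powr - Re (s + 1))"
  proof -
    have "norm (g n) * real n powr - Re (s + 1) = norm (of_nat n powr - s * exp (- (of_nat n * of_real t)))"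
      if "n \<in> space ?N" for n
      unfolding outer[OF that, symmetric] using that norm_of_real_powr[of "real n" "s + 1"]
      by (simp add: norm_divide divide_powr_uminus powr_minus_divide norm_mult del: of_real_of_nat_eq)
    moreover have "integrable ?N (\<lambda>n. norm (of_nat n powr - s * exp (- (of_nat n * complex_of_real t))))"
      using t by (intro integrable_norm integrable_polylog) auto
    ultimately show ?thesis by (subst Bochner_Integration.integrable_cong[OF refl]) auto
  qed
  have eq: "of_real w powr (s + 1 - 1) * (\<integral>n. g n * exp (- of_real (real n * w)) \<partial>?N) = of_real w powr s *
      polylog (-1) (of_real (w + t))" for w
  proof -
    have "(\<integral>n. g n * exp (- of_real (real n * w)) \<partial>?N) = polylog (-1) (of_real (w + t))"
      unfolding polylog_def
      by (intro Bochner_Integration.integral_cong) (auto simp: g_def exp_add [symmetric] algebra_simps)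
    thus ?thesis by simp
  qed
  have N: "sigma_finite_measure ?N" by (rule sigma_finite_measure_count_space_countable) auto
  note LF = Laplace_Fubini[OF N, of g real "s + 1"]
  show "integrable ?P (\<lambda>w. of_real w powr s * polylog (-1) (of_real (w + t)))"
    unfolding eq[symmetric] by (rule LF) (use s g_int in auto)
  have "(\<integral>w. of_real w powr s * polylog (-1) (of_real (w + t)) \<partial>?P) = Gamma (s + 1) * (\<integral>n. g n / of_real
      (real n) powr (s + 1) \<partial>?N)"
    unfolding eq[symmetric] by (rule LF) (use s g_int in auto)
  also have "(\<integral>n. g n / of_real (real n) powr (s + 1) \<partial>?N) = polylog s (of_real t)"
    unfolding polylog_def using outer by (intro Bochner_Integration.integral_cong) auto
  finally show "(\<integral>w. of_real w powr s * polylog (-1) (of_real (w + t)) \<partial>?P) = Gamma (s + 1) * polylog s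
      (of_real t)" .
qed

text \<open>This is the norm of the integrand of \<open>polylog_sing_integral\<close> at t = 1 with
  a real exponent.\<close>

lemma integrable_powr_over_square:
  assumes "-1 < \<sigma>" "\<sigma> < 1"
  shows "integrable (lborel_on {0<..}) (\<lambda>w. w powr \<sigma> / (1 + w)\<^sup>2)"
proof -
  have "integrable (lborel_on {0<..}) (\<lambda>w. norm (complex_of_real w powr of_real \<sigma> * (1 / of_real (w + 1) ^
      2)))"
    using assms by (intro integrable_norm polylog_sing_integral) auto
  also have "?this \<longleftrightarrow> ?thesis"
    by (intro Bochner_Integration.integrable_cong)
       (auto simp: space_restrict_space norm_mult norm_divide norm_power norm_of_real_powr add.commute
             simp del: of_real_add)
  finally show ?thesis .
qed

section \<open>Extension of the regular part to the unit disc\<close>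

definition polylog_ext :: "complex \<Rightarrow> complex \<Rightarrow> complex" where
  "polylog_ext s \<tau> = - rGamma (s + 1) * (\<integral>w. of_real w powr s * deriv phi (of_real w + \<tau>) \<partial>lborel_on {0<..})"

lemma ball_add_Im_strip:
  assumes "\<tau> \<in> ball 0 1"
  shows "\<bar>Im (of_real w + \<tau>)\<bar> < 2 * pi"
  using assms abs_Im_le_cmod[of \<tau>] pi_gt3 by auto

lemma polylog_ext_integrand_bound:
  obtains C where "C > 0" "\<And>s w \<tau>. w > 0 \<Longrightarrow> \<tau> \<in> ball 0 1 \<Longrightarrow>
    norm (of_real w powr s * deriv phi (of_real w + \<tau>)) \<le> C * (w powr Re s / (1 + w)\<^sup>2)"
proof -
  obtain C where C: "C > 0" "\<And>w \<tau>. w \<ge> 0 \<Longrightarrow> \<tau> \<in> ball 0 1 \<Longrightarrow> norm (deriv phi (of_real w + \<tau>)) \<le> C / (1 + w)\<^sup>2"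
    using deriv_phi_bound by blast
  show ?thesis
  proof (rule that[OF C(1)])
    fix s w \<tau> assume w: "w > (0::real)" and \<tau>: "\<tau> \<in> ball (0::complex) 1"
    have "w powr Re s * norm (deriv phi (of_real w + \<tau>)) \<le> w powr Re s * (C / (1 + w)\<^sup>2)"
      using w \<tau> by (intro mult_left_mono C(2)) auto
    thus "norm (of_real w powr s * deriv phi (of_real w + \<tau>)) \<le> C * (w powr Re s / (1 + w)\<^sup>2)"
      using w by (simp add: norm_mult norm_of_real_powr mult_ac)
  qed
qed

lemma borel_measurable_deriv_phi:
  assumes "\<tau> \<in> ball 0 1"
  shows "(\<lambda>w. deriv phi (of_real w + \<tau>)) \<in> borel_measurable (lborel_on {0<..})"
proof -
  have "continuous_on UNIV (\<lambda>w. deriv phi (of_real w + \<tau>))"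
    by (rule continuous_on_compose2[OF holomorphic_on_imp_continuous_on[OF holomorphic_deriv_phi]])
       (use ball_add_Im_strip[OF assms] in \<open>auto intro!: continuous_intros\<close>)
  hence "(\<lambda>w. deriv phi (of_real w + \<tau>)) \<in> borel_measurable borel"
    by (rule borel_measurable_continuous_onI)
  thus ?thesis by (intro measurable_restrict_space1) auto
qed

lemma holomorphic_polylog_ext:
  assumes s: "-1 < Re s" "Re s < 1"
  shows "polylog_ext s holomorphic_on ball 0 1"
proof -
  obtain C where C: "C > 0" "\<And>s w \<tau>. w > 0 \<Longrightarrow> \<tau> \<in> ball 0 1 \<Longrightarrow>
    norm (of_real w powr s * deriv phi (of_real w + \<tau>)) \<le> C * (w powr Re s / (1 + w)\<^sup>2)"
    using polylog_ext_integrand_bound by blast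
  have "(\<lambda>\<tau>. \<integral>w. of_real w powr s * deriv phi (of_real w + \<tau>) \<partial>lborel_on {0<..}) holomorphic_on ball 0 1"
  proof (rule holomorphic_on_lebesgue_integral)
    fix w :: real
    have "(\<lambda>\<tau>. of_real w + \<tau>) ` ball 0 1 \<subseteq> {z. \<bar>Im z\<bar> < 2 * pi}"
      using ball_add_Im_strip by blast
    hence "(deriv phi \<circ> (\<lambda>\<tau>. of_real w + \<tau>)) holomorphic_on ball 0 1"
      by (intro holomorphic_on_compose_gen[OF _ holomorphic_deriv_phi] holomorphic_intros)
    thus "(\<lambda>\<tau>. of_real w powr s * deriv phi (of_real w + \<tau>)) holomorphic_on ball 0 1"
      by (intro holomorphic_intros) (auto simp: o_def)
  next
    fix \<tau> :: complex assume "\<tau> \<in> ball 0 1"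
    thus "(\<lambda>w. of_real w powr s * deriv phi (of_real w + \<tau>)) \<in> borel_measurable (lborel_on {0<..})"
      using borel_measurable_deriv_phi[of \<tau>] by measurable
  next
    fix \<tau>0 :: complex assume "\<tau>0 \<in> ball 0 1"
    then obtain d where d: "d > 0" "ball \<tau>0 d \<subseteq> ball 0 1" using open_ball openE by blast
    show "\<exists>e>0. \<exists>D. integrable (lborel_on {0<..}) D \<and>
       (\<forall>\<tau>\<in>ball \<tau>0 e. \<forall>w\<in>space (lborel_on {0<..}). norm (of_real w powr s * deriv phi (of_real w + \<tau>)) \<le> D w)"
      by (intro exI[of _ d] conjI exI[of _ "\<lambda>w. C * (w powr Re s / (1 + w)\<^sup>2)"] ballI C(2)
            integrable_mult_right integrable_powr_over_square s d) (use d in \<open>auto simp: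
                space_restrict_space\<close>)
  qed auto
  thus ?thesis unfolding polylog_ext_def [abs_def] by (intro holomorphic_intros)
qed

text \<open>For u > 0 the derivative of \<open>phi\<close> is 1/u^2 minus
  \<open>polylog (-1)\<close> at u. On the shifted axis both pieces are integrable separately
  against w^s, and their integrals carry the common factor Gamma(s+1) that \<open>rGamma\<close>
  cancels.\<close>

lemma polylog_ext_of_real:
  assumes s: "-1 < Re s" "Re s < 1" and t: "t > 0"
  shows "polylog_ext s (of_real t) = polylog_reg s (of_real t)"
proof -
  let ?P = "lborel_on {0<..}"
  have Ga: "rGamma (s + 1) * Gamma (s + 1) = 1"
    using s by (subst rGamma_inverse_Gamma) (auto simp: Gamma_eq_zero_iff Re_pos_imp_notin_nonpos_Ints)
  have "of_real w powr s * deriv phi (of_real w + of_real t)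
      = of_real w powr s * (1 / of_real (w + t) ^ 2) - of_real w powr s * polylog (-1) (of_real (w + t))"
    if "w \<in> space ?P" for w
  proof -
    have w: "w > 0" using that by (simp add: space_restrict_space)
    have "deriv phi (of_real (w + t)) = - polylog_reg (-1) (of_real (w + t))"
      using w t by (intro deriv_phi_eq) auto
    also have "\<dots> = polylog_sing (-1) (of_real (w + t)) - polylog (-1) (of_real (w + t))"
      by (simp add: polylog_reg_def)
    also have "polylog_sing (-1) (of_real (w + t)) = 1 / of_real (w + t) ^ 2"
      using w t Gamma_fact[of 1, where ?'a = complex]
      by (simp add: polylog_sing_def powr_minus_divide powr_nat' del: of_real_add)
    finally show ?thesis by (simp only: of_real_add right_diff_distrib)
  qed
  hence "(\<integral>w. of_real w powr s * deriv phi (of_real w + of_real t) \<partial>?P)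
      = (\<integral>w. of_real w powr s * (1 / of_real (w + t) ^ 2) - of_real w powr s * polylog (-1) (of_real (w +
          t)) \<partial>?P)"
    by (intro Bochner_Integration.integral_cong) auto
  also have "\<dots> = Gamma (s + 1) * polylog_sing s (of_real t) - Gamma (s + 1) * polylog s (of_real t)"
    using polylog_sing_integral[OF s t] polylog_integral[OF s(1) t] by (subst
        Bochner_Integration.integral_diff) auto
  also have "\<dots> = - Gamma (s + 1) * polylog_reg s (of_real t)" by (simp add: polylog_reg_def algebra_simps)
  finally show ?thesis using Ga by (simp add: polylog_ext_def flip: mult.assoc)
qed

lemma islimpt_of_real_interval:
  assumes "a < c" "c < b"
  shows "complex_of_real c islimpt of_real ` {a<..<b}"
proof -
  have "c islimpt {a<..<b}" using assms by (simp add: islimpt_greaterThanLessThan1 interior_limit_point)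
  thus ?thesis by (rule islimpt_isCont_image) (auto intro!: continuous_intros simp: eventually_at_topological)
qed

text \<open>The identity theorem on the right half of the disc, starting from agreement on the real
  interval (0,1).\<close>

lemma polylog_ext_eq_polylog_reg:
  assumes s: "-1 < Re s" "Re s < 1" and \<tau>: "\<tau> \<in> ball 0 1" "Re \<tau> > 0"
  shows "polylog_ext s \<tau> = polylog_reg s \<tau>"
proof -
  let ?S = "ball 0 1 \<inter> {\<tau>. Re \<tau> > 0}"
  have "polylog_ext s \<tau> - polylog_reg s \<tau> = 0"
  proof (rule analytic_continuation[where f = "\<lambda>\<tau>. polylog_ext s \<tau> - polylog_reg s \<tau>" and S = ?S
           and U = "of_real ` {0<..<1}" and \<xi> = "of_real (1/2)"])
    show "(\<lambda>\<tau>. polylog_ext s \<tau> - polylog_reg s \<tau>) holomorphic_on ?S"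
      using holomorphic_polylog_ext[OF s] holomorphic_polylog_reg[OF s(2)]
      by (intro holomorphic_on_diff) (auto intro: holomorphic_on_subset)
    show "connected ?S"
      by (intro convex_connected convex_Int convex_ball convex_halfspace_Re_gt)
    show "complex_of_real (1/2) islimpt of_real ` {0<..<1}"
      by (rule islimpt_of_real_interval) auto
  qed (use \<tau> s polylog_ext_of_real in \<open>auto intro!: open_halfspace_Re_gt\<close>)
  thus ?thesis by simp
qed

text \<open>The neighbourhood of s0 is chosen before the radius r, while the bound C may depend on
  r. Lowering s by Cauchy's inequality costs a little radius, and having a bound for every r < 1
  makes the property stable under that loss.\<close>

definition polylog_reg_bounded :: "complex \<Rightarrow> bool" where
  "polylog_reg_bounded s0 \<longleftrightarrow> (\<exists>e>0. \<forall>r. 0 < r \<and> r < 1 \<longrightarrow> (\<exists>C. \<forall>s\<in>ball s0 e. \<exists>h. h holomorphic_on ball 0 1 \<and>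
      (\<forall>\<tau>\<in>ball 0 r. norm (h \<tau>) \<le> C) \<and> (\<forall>\<tau>\<in>ball 0 1. Re \<tau> > 0 \<longrightarrow> h \<tau> = polylog_reg s \<tau>)))"

text \<open>The larger endpoint exponent dominates for w \<ge> 1 and the smaller one for w < 1, so
  their sum is a single dominating function for a whole range of exponents.\<close>

lemma powr_le_powr_add:
  assumes "w > (0::real)" "a \<le> \<sigma>" "\<sigma> \<le> b"
  shows "w powr \<sigma> \<le> w powr a + w powr b"
proof (cases "w \<ge> 1")
  case True
  hence "w powr \<sigma> \<le> w powr b" using assms by (intro powr_mono) auto
  thus ?thesis by (simp add: add_increasing)
next
  case False
  hence "w powr \<sigma> \<le> w powr a" using assms by (intro powr_mono') auto
  thus ?thesis by (simp add: add_increasing2)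
qed

lemma polylog_reg_bounded_base:
  assumes s0: "-1 < Re s0" "Re s0 < 1"
  shows "polylog_reg_bounded s0"
proof -
  let ?P = "lborel_on {0<..}"
  obtain C where C: "C > 0" "\<And>s w \<tau>. w > 0 \<Longrightarrow> \<tau> \<in> ball 0 1 \<Longrightarrow>
    norm (of_real w powr s * deriv phi (of_real w + \<tau>)) \<le> C * (w powr Re s / (1 + w)\<^sup>2)"
    using polylog_ext_integrand_bound by blast
  \<comment> \<open>Half the distance to the edges of the strip, so that the extreme exponents a and
    b still lie strictly between -1 and 1.\<close>
  define e where "e = min (1 - Re s0) (Re s0 + 1) / 2"
  define a b where "a = Re s0 - e" and "b = Re s0 + e"
  have e: "e > 0" "-1 < a" "a < 1" "-1 < b" "b < 1"
    using s0 by (auto simp: e_def a_def b_def min_def field_simps)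
  have ab: "a \<le> Re s" "Re s \<le> b" if "s \<in> ball s0 e" for s
    using that abs_Re_le_cmod[of "s0 - s"] by (auto simp: dist_norm a_def b_def)
  have "compact ((\<lambda>s::complex. rGamma (s + 1)) ` cball s0 e)"
    by (intro compact_continuous_image holomorphic_on_imp_continuous_on holomorphic_intros) auto
  from compact_imp_bounded[OF this]
  obtain B where B: "B > 0" "\<And>s. s \<in> cball s0 e \<Longrightarrow> norm (rGamma (s + 1)) \<le> B"
    by (auto simp: bounded_pos)
  define D where "D w = C * (w powr a / (1 + w)\<^sup>2 + w powr b / (1 + w)\<^sup>2)" for w
  have D_int: "integrable ?P D" unfolding D_def
    by (intro integrable_mult_right Bochner_Integration.integrable_add integrable_powr_over_square e)
  have bound: "norm (polylog_ext s \<tau>) \<le> B * integral\<^sup>L ?P D" if s: "s \<in> ball s0 e" and \<tau>: "\<tau> \<in> ball 0 1"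
      for s \<tau>
  proof -
    have "norm (\<integral>w. of_real w powr s * deriv phi (of_real w + \<tau>) \<partial>?P) \<le> integral\<^sup>L ?P D"
    proof (rule norm_lebesgue_integral_le[OF D_int])
      fix w assume "w \<in> space ?P"
      hence w: "w > 0" by (simp add: space_restrict_space)
      have "norm (of_real w powr s * deriv phi (of_real w + \<tau>)) \<le> C * (w powr Re s / (1 + w)\<^sup>2)"
        by (rule C(2)[OF w \<tau>])
      also have "\<dots> \<le> C * ((w powr a + w powr b) / (1 + w)\<^sup>2)"
        using C(1) w powr_le_powr_add[OF w ab[OF s]] by (intro mult_left_mono divide_right_mono) auto
      also have "\<dots> = D w" by (simp add: D_def add_divide_distrib)
      finally show "norm (of_real w powr s * deriv phi (of_real w + \<tau>)) \<le> D w" .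
    qed
    moreover have "norm (rGamma (s + 1)) \<le> B" using s by (intro B(2)) auto
    ultimately show ?thesis unfolding polylog_ext_def using B(1)
      by (simp add: norm_mult mult_mono)
  qed
  show ?thesis unfolding polylog_reg_bounded_def
  proof (rule exI[of _ e], intro conjI allI impI e)
    fix r assume r: "0 < r \<and> r < (1::real)"
    have "\<exists>h. h holomorphic_on ball 0 1 \<and> (\<forall>\<tau>\<in>ball 0 r. norm (h \<tau>) \<le> B * integral\<^sup>L ?P D) \<and>
         (\<forall>\<tau>\<in>ball 0 1. Re \<tau> > 0 \<longrightarrow> h \<tau> = polylog_reg s \<tau>)" if s: "s \<in> ball s0 e" for s
    proof -
      have s': "-1 < Re s" "Re s < 1" using ab[OF s] e by auto
      show ?thesis
      proof (intro exI[of _ "polylog_ext s"] conjI ballI impI)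
        show "norm (polylog_ext s \<tau>) \<le> B * integral\<^sup>L ?P D" if "\<tau> \<in> ball 0 r" for \<tau>
          using that r by (intro bound[OF s]) auto
      qed (use holomorphic_polylog_ext[OF s'] polylog_ext_eq_polylog_reg[OF s'] in auto)
    qed
    thus "\<exists>C. \<forall>s\<in>ball s0 e. \<exists>h. h holomorphic_on ball 0 1 \<and> (\<forall>\<tau>\<in>ball 0 r. norm (h \<tau>) \<le> C) \<and>
         (\<forall>\<tau>\<in>ball 0 1. Re \<tau> > 0 \<longrightarrow> h \<tau> = polylog_reg s \<tau>)" by blast
  qed
qed

text \<open>If h extends \<open>polylog_reg\<close> at s + 1, then minus its derivative extends
  \<open>polylog_reg\<close> at s, and Cauchy's inequality bounds it on a smaller disc.\<close>

lemma polylog_reg_bounded_minus_1: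
  assumes reg: "polylog_reg_bounded s0" and s0: "Re s0 < 1"
  shows "polylog_reg_bounded (s0 - 1)"
proof -
  obtain e where e: "e > 0" and h: "\<And>r. 0 < r \<Longrightarrow> r < 1 \<Longrightarrow> \<exists>C. \<forall>s\<in>ball s0 e. \<exists>h. h holomorphic_on ball 0 1 \<and>
      (\<forall>\<tau>\<in>ball 0 r. norm (h \<tau>) \<le> C) \<and> (\<forall>\<tau>\<in>ball 0 1. Re \<tau> > 0 \<longrightarrow> h \<tau> = polylog_reg s \<tau>)"
    using reg unfolding polylog_reg_bounded_def by blast
  \<comment> \<open>The second entry keeps Re (s + 1) < 1, where the derivative formula is
    available.\<close>
  define d where "d = min e (1 - Re s0)"
  have d: "d > 0" "d \<le> e" using e s0 by (auto simp: d_def)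
  show ?thesis unfolding polylog_reg_bounded_def
  proof (rule exI[of _ d], intro conjI d allI impI)
    fix r :: real assume "0 < r \<and> r < 1"
    hence r: "0 < r" "r < 1" by auto
    \<comment> \<open>Discs of radius q about points of the r-disc then stay in the disc of radius
      (1 + r)/2 < 1.\<close>
    define q where "q = (1 - r) / 2"
    have "2 * q = 1 - r" by (simp add: q_def)
    hence q: "q > 0" "0 < r + q" "r + q < 1" using r by (simp_all add: algebra_simps)
    obtain C where C: "\<forall>s\<in>ball s0 e. \<exists>h. h holomorphic_on ball 0 1 \<and>
      (\<forall>\<tau>\<in>ball 0 (r + q). norm (h \<tau>) \<le> C) \<and> (\<forall>\<tau>\<in>ball 0 1. Re \<tau> > 0 \<longrightarrow> h \<tau> = polylog_reg s \<tau>)"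
      using h[OF q(2,3)] by blast
    show "\<exists>C. \<forall>s\<in>ball (s0 - 1) d. \<exists>h. h holomorphic_on ball 0 1 \<and>
      (\<forall>\<tau>\<in>ball 0 r. norm (h \<tau>) \<le> C) \<and> (\<forall>\<tau>\<in>ball 0 1. Re \<tau> > 0 \<longrightarrow> h \<tau> = polylog_reg s \<tau>)"
    proof (intro exI[of _ "C / q"] ballI)
      fix s assume s: "s \<in> ball (s0 - 1) d"
      have s1: "s + 1 \<in> ball s0 d" using s by (simp add: dist_norm algebra_simps)
      have Re: "Re (s + 1) < 1"
      proof -
        have "norm (s0 - (s + 1)) < 1 - Re s0" using s1 by (simp only: mem_ball dist_norm d_def
            min_less_iff_conj)
        thus ?thesis using abs_Re_le_cmod[of "s0 - (s + 1)"] by (simp only: minus_complex.sel)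
      qed
      have "s + 1 \<in> ball s0 e" using s1 d(2) subset_ball by blast
      from bspec[OF C this] obtain h where h: "h holomorphic_on ball 0 1"
        "\<And>\<tau>. \<tau> \<in> ball 0 (r + q) \<Longrightarrow> norm (h \<tau>) \<le> C"
        "\<And>\<tau>. \<tau> \<in> ball 0 1 \<Longrightarrow> Re \<tau> > 0 \<Longrightarrow> h \<tau> = polylog_reg (s + 1) \<tau>"
        by blast
      show "\<exists>h. h holomorphic_on ball 0 1 \<and> (\<forall>\<tau>\<in>ball 0 r. norm (h \<tau>) \<le> C / q) \<and>
        (\<forall>\<tau>\<in>ball 0 1. Re \<tau> > 0 \<longrightarrow> h \<tau> = polylog_reg s \<tau>)"
      proof (intro exI[of _ "\<lambda>\<tau>. - deriv h \<tau>"] conjI ballI impI)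
        show "(\<lambda>\<tau>. - deriv h \<tau>) holomorphic_on ball 0 1"
          using h(1) by (intro holomorphic_intros) auto
      next
        fix \<tau> :: complex assume \<tau>: "\<tau> \<in> ball 0 r"
        have sub: "x \<in> ball 0 (r + q)" if "x \<in> cball \<tau> q" for x
        proof -
          have "norm x \<le> norm \<tau> + norm (x - \<tau>)" by norm
          thus ?thesis using that \<tau> by (simp add: dist_norm norm_minus_commute)
        qed
        have sub1: "cball \<tau> q \<subseteq> ball 0 1" using sub q by fastforce
        have "norm ((deriv ^^ 1) h \<tau>) \<le> fact 1 * C / q ^ 1"
        proof (rule Cauchy_inequality)
          show "h holomorphic_on ball \<tau> q"
            using h(1) sub1 by (meson ball_subset_cball holomorphic_on_subset)
          show "continuous_on (cball \<tau> q) h"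
            using h(1) sub1 by (meson holomorphic_on_imp_continuous_on continuous_on_subset)
          show "norm (h x) \<le> C" if "norm (\<tau> - x) = q" for x
            using that by (intro h(2) sub) (simp add: dist_norm)
        qed (use q in auto)
        thus "norm (- deriv h \<tau>) \<le> C / q" by simp
      next
        fix \<tau> :: complex assume \<tau>: "\<tau> \<in> ball 0 1" "Re \<tau> > 0"
        have "(h has_field_derivative - polylog_reg (s + 1 - 1) \<tau>) (at \<tau>)"
        proof (rule has_field_derivative_transform_within_open[OF has_field_derivative_polylog_reg[OF \<tau>(2)
            Re]])
          show "open (ball 0 1 \<inter> {\<tau>. Re \<tau> > 0})" by (intro open_Int open_ball open_halfspace_Re_gt)
        qed (use \<tau> h(3) in auto)
        thus "- deriv h \<tau> = polylog_reg s \<tau>" by (simp add: DERIV_imp_deriv)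
      qed
    qed
  qed
qed

lemma polylog_reg_boundedI:
  assumes "Re s0 < 1"
  shows "polylog_reg_bounded s0"
proof -
  \<comment> \<open>Each induction step widens the strip to the left by one unit.\<close>
  have "polylog_reg_bounded s0" if "Re s0 < 1" "Re s0 > - real n - 1" for n s0
    using that
  proof (induction n arbitrary: s0)
    case 0
    thus ?case by (intro polylog_reg_bounded_base) auto
  next
    case (Suc n)
    show ?case
    proof (cases "Re s0 > -1")
      case True
      thus ?thesis using Suc.prems by (intro polylog_reg_bounded_base)
    next
      case False
      have "polylog_reg_bounded (s0 + 1)" using Suc.prems False by (intro Suc.IH) auto
      hence "polylog_reg_bounded (s0 + 1 - 1)"
        using Suc.prems False by (intro polylog_reg_bounded_minus_1) auto
      thus ?thesis by simp
    qed
  qed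
  moreover obtain n :: nat where "real n > - Re s0 - 1" using reals_Archimedean2 by blast
  hence "Re s0 > - real n - 1" by linarith
  ultimately show ?thesis using assms by blast
qed

lemma polylog_reg_bound:
  assumes "Re s0 < 1"
  obtains e C where "e > 0" "C \<ge> 0"
    "\<And>s \<tau>. s \<in> ball s0 e \<Longrightarrow> Re \<tau> > 0 \<Longrightarrow> norm \<tau> \<le> 1 / 2 \<Longrightarrow> norm (polylog_reg s \<tau>) \<le> C"
proof -
  obtain e where e: "e > 0" and *: "\<forall>r. 0 < r \<and> r < 1 \<longrightarrow> (\<exists>C. \<forall>s\<in>ball s0 e. \<exists>h. h holomorphic_on ball 0 1 \<and>
      (\<forall>\<tau>\<in>ball 0 r. norm (h \<tau>) \<le> C) \<and> (\<forall>\<tau>\<in>ball 0 1. Re \<tau> > 0 \<longrightarrow> h \<tau> = polylog_reg s \<tau>))"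
    using polylog_reg_boundedI[OF assms] unfolding polylog_reg_bounded_def by blast
  \<comment> \<open>A radius strictly between 1/2 and 1, so that the open disc contains all \<tau>
    with norm at most 1/2.\<close>
  from *[rule_format, of "3/4"]
  obtain C where C: "\<forall>s\<in>ball s0 e. \<exists>h. h holomorphic_on ball 0 1 \<and>
      (\<forall>\<tau>\<in>ball 0 (3/4). norm (h \<tau>) \<le> C) \<and> (\<forall>\<tau>\<in>ball 0 1. Re \<tau> > 0 \<longrightarrow> h \<tau> = polylog_reg s \<tau>)"
    by auto
  have "norm (polylog_reg s \<tau>) \<le> max C 0" if "s \<in> ball s0 e" "Re \<tau> > 0" "norm \<tau> \<le> 1 / 2" for s \<tau>
  proof -
    obtain h where h: "\<forall>\<tau>\<in>ball 0 (3/4). norm (h \<tau>) \<le> C" "\<forall>\<tau>\<in>ball 0 1. Re \<tau> > 0 \<longrightarrow> h \<tau> = polylog_reg s \<tau>"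
      using C \<open>s \<in> ball s0 e\<close> by blast
    have "norm (h \<tau>) \<le> C" using that by (intro h(1)[rule_format]) auto
    moreover have "h \<tau> = polylog_reg s \<tau>" using that by (intro h(2)[rule_format]) auto
    ultimately show ?thesis by simp
  qed
  with e show ?thesis using that[of e "max C 0"] by auto
qed

subsection \<open>Continuation of the zeta function\<close>

text \<open>The factor \<open>s - 1\<close> removes the pole of \<open>\<Gamma>(1 - s)\<close> at 1, so that the limit as \<open>\<tau>\<close> tends to 0 is
  \<open>(s - 1) \<zeta>(s)\<close> on both sides of the line \<open>Re s = 1\<close>.\<close>

definition polylog_scaled :: "complex \<Rightarrow> complex \<Rightarrow> complex" where
  "polylog_scaled s \<tau> = (s - 1) * polylog s \<tau> + Gamma (2 - s) * \<tau> powr (s - 1)"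

lemma polylog_scaled_eq_polylog_reg:
  assumes "Re s < 1"
  shows "polylog_scaled s \<tau> = (s - 1) * polylog_reg s \<tau>"
proof -
  have "Gamma (1 - s + 1) = (1 - s) * Gamma (1 - s)"
    using assms by (intro Gamma_plus1 Re_pos_imp_notin_nonpos_Ints) auto
  moreover have "1 - s + 1 = 2 - s" by simp
  ultimately have eq: "Gamma (2 - s) = (1 - s) * Gamma (1 - s)" by metis
  show ?thesis unfolding polylog_scaled_def polylog_reg_def polylog_sing_def eq by (simp add: algebra_simps)
qed

lemma holomorphic_polylog_scaled_param:
  assumes "Re \<tau> > 0"
  shows "(\<lambda>s. polylog_scaled s \<tau>) holomorphic_on {s. Re s < 2}"
  unfolding polylog_scaled_def using holomorphic_on_subset[OF holomorphic_polylog_param[OF assms]]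
      Re_pos_imp_notin_nonpos_Ints assms
  by (intro holomorphic_intros) auto

lemma has_field_derivative_polylog_scaled:
  assumes "Re \<tau> > 0"
  shows "(polylog_scaled s has_field_derivative - ((s - 1) * polylog_reg (s - 1) \<tau>)) (at \<tau>)"
proof -
  have "((\<lambda>\<tau>. (s - 1) * polylog s \<tau> + Gamma (2 - s) * \<tau> powr (s - 1)) has_field_derivative
      (s - 1) * - polylog (s - 1) \<tau> + Gamma (2 - s) * ((s - 1) * \<tau> powr (s - 1 - 1))) (at \<tau>)"
    using Re_pos_imp_notin_nonpos_Reals[OF assms]
    by (intro DERIV_add DERIV_cmult has_field_derivative_polylog[OF assms] has_field_derivative_powr)
  moreover have "1 - (s - 1) = 2 - s" by simp
  hence "(s - 1) * - polylog (s - 1) \<tau> + Gamma (2 - s) * ((s - 1) * \<tau> powr (s - 1 - 1)) = - ((s - 1) *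
      polylog_reg (s - 1) \<tau>)"
    unfolding polylog_reg_def polylog_sing_def by (simp only:) (simp add: algebra_simps)
  ultimately show ?thesis by (simp only: polylog_scaled_def [abs_def])
qed

text \<open>The \<tau>-derivative is a multiple of \<open>polylog_reg (s - 1)\<close>, which is
  bounded as soon as Re (s - 1) < 1. This extra unit is what carries the argument across the line Re
  s = 1.\<close>

lemma polylog_scaled_Lipschitz:
  assumes "Re s0 < 2"
  obtains e L where "e > 0" "L \<ge> 0" "\<And>s t t'. s \<in> ball s0 e \<Longrightarrow> t \<in> {0<..1/2} \<Longrightarrow> t' \<in> {0<..1/2} \<Longrightarrow>
    norm (polylog_scaled s (of_real t) - polylog_scaled s (of_real t')) \<le> L * \<bar>t - t'\<bar>"
proof -
  obtain e C where e: "e > 0" "C \<ge> 0"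
    "\<And>s \<tau>. s \<in> ball (s0 - 1) e \<Longrightarrow> Re \<tau> > 0 \<Longrightarrow> norm \<tau> \<le> 1 / 2 \<Longrightarrow> norm (polylog_reg s \<tau>) \<le> C"
    using polylog_reg_bound[of "s0 - 1"] assms by auto
  have mem: "complex_of_real v \<in> {\<tau>. Re \<tau> > 0} \<inter> cball 0 (1/2)" if "v \<in> {0<..1/2}" for v
    using that by (simp add: abs_of_pos)
  \<comment> \<open>The first factor bounds norm (s - 1) on the ball about s0, and C bounds
    \<open>polylog_reg (s - 1)\<close>.\<close>
  define L where "L = (norm s0 + e + 1) * C"
  have "norm (polylog_scaled s (of_real t) - polylog_scaled s (of_real t')) \<le> L * norm (complex_of_real t
      - of_real t')"
    if s: "s \<in> ball s0 e" and t: "t \<in> {0<..1/2}" "t' \<in> {0<..1/2}" for s t t'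
  proof -
    let ?S = "{\<tau>. Re \<tau> > 0} \<inter> cball 0 (1/2)"
    let ?f' = "\<lambda>\<tau>. - ((s - 1) * polylog_reg (s - 1) \<tau>)"
    have cvx: "convex ?S" by (intro convex_Int convex_halfspace_Re_gt convex_cball)
    have der: "(polylog_scaled s has_field_derivative ?f' \<tau>) (at \<tau> within ?S)" if "\<tau> \<in> ?S" for \<tau>
    proof -
      have "Re \<tau> > 0" using that by blast
      thus ?thesis by (rule has_field_derivative_at_within[OF has_field_derivative_polylog_scaled])
    qed
    have bnd: "norm (?f' \<tau>) \<le> L" if "\<tau> \<in> ?S" for \<tau>
    proof -
      have "norm (s - 1) \<le> norm s + 1" using norm_triangle_ineq4[of s 1] by simp
      moreover have "norm s \<le> norm s0 + norm (s - s0)" by (rule norm_triangle_sub)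
      moreover have "norm (s - s0) < e" using s by (simp add: dist_norm norm_minus_commute)
      ultimately have 1: "norm (s - 1) \<le> norm s0 + e + 1" by linarith
      have 2: "norm (polylog_reg (s - 1) \<tau>) \<le> C"
      proof (rule e(3))
        show "s - 1 \<in> ball (s0 - 1) e" using s by (simp add: dist_norm)
        show "Re \<tau> > 0" "norm \<tau> \<le> 1 / 2" using that by simp_all
      qed
      show ?thesis
        unfolding L_def norm_minus_cancel norm_mult using 1 2 e(1,2) by (intro mult_mono) auto
    qed
    show ?thesis by (rule field_differentiable_bound[OF cvx der bnd mem[OF t(1)] mem[OF t(2)]])
  qed
  moreover have "norm (complex_of_real t - of_real t') = \<bar>t - t'\<bar>" for t t'
    by (simp flip: of_real_diff)
  ultimately show ?thesis using that[of e L] e(1,2) by (simp add: L_def)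
qed

text \<open>The limit runs along a fixed sequence in (0,1/2], the range of the Lipschitz estimate,
  so that holomorphy follows from a locally uniform limit of a sequence.\<close>

definition zeta_scaled :: "complex \<Rightarrow> complex" where
  "zeta_scaled s = lim (\<lambda>n. polylog_scaled s (of_real (1 / (2 * real (Suc n)))))"

text \<open>The Lipschitz estimate makes the defining sequence Cauchy; letting t' tend to 0 in it
  gives the error L t, uniformly in s.\<close>

lemma zeta_scaled_bound:
  assumes "Re s0 < 2"
  obtains e L where "e > 0" "L \<ge> 0" "\<And>s t. s \<in> ball s0 e \<Longrightarrow> t \<in> {0<..1/2} \<Longrightarrow>
    norm (polylog_scaled s (of_real t) - zeta_scaled s) \<le> L * t"
proof -
  obtain e L where e: "e > 0" "L \<ge> 0" and lip: "\<And>s t t'. s \<in> ball s0 e \<Longrightarrow> t \<in> {0<..1/2} \<Longrightarrow> t' \<in> {0<..1/2} \<Longrightarrow>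
    norm (polylog_scaled s (of_real t) - polylog_scaled s (of_real t')) \<le> L * \<bar>t - t'\<bar>"
    using polylog_scaled_Lipschitz[OF assms] by blast
  define u where "u n = 1 / (2 * real (Suc n))" for n
  have u: "u n \<in> {0<..1/2}" for n by (auto simp: u_def field_simps)
  have u0: "u \<longlonglongrightarrow> 0" unfolding u_def by real_asymp
  have "norm (polylog_scaled s (of_real t) - zeta_scaled s) \<le> L * t" if s: "s \<in> ball s0 e" and t: "t \<in>
      {0<..1/2}" for s t
  proof -
    have "Cauchy (\<lambda>n. polylog_scaled s (of_real (u n)))"
    proof (rule metric_CauchyI)
      fix d :: real assume d: "d > 0"
      have "Cauchy u" using u0 by (rule LIMSEQ_imp_Cauchy)
      \<comment> \<open>Dividing by L + 1 covers the case L = 0.\<close>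
      then obtain N where N: "\<And>m n. m \<ge> N \<Longrightarrow> n \<ge> N \<Longrightarrow> dist (u m) (u n) < d / (L + 1)"
        using metric_CauchyD[of u "d / (L + 1)"] d e(2) by auto
      have "dist (polylog_scaled s (of_real (u m))) (polylog_scaled s (of_real (u n))) < d" if "m \<ge> N" "n
          \<ge> N" for m n
      proof -
        have "dist (polylog_scaled s (of_real (u m))) (polylog_scaled s (of_real (u n))) \<le> L * dist (u m)
            (u n)"
          using lip[OF s u u] by (simp add: dist_norm)
        also have "\<dots> \<le> (L + 1) * dist (u m) (u n)" by (intro mult_right_mono) auto
        also have "\<dots> < d" using N[OF that] e(2) by (simp add: pos_less_divide_eq mult.commute)
        finally show ?thesis .
      qed
      thus "\<exists>N. \<forall>m\<ge>N. \<forall>n\<ge>N. dist (polylog_scaled s (of_real (u m))) (polylog_scaled s (of_real (u n))) <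
          d" by blast
    qed
    hence "(\<lambda>n. polylog_scaled s (of_real (u n))) \<longlonglongrightarrow> zeta_scaled s"
      unfolding zeta_scaled_def u_def by (simp add: Cauchy_convergent_iff convergent_LIMSEQ_iff)
    hence "(\<lambda>n. norm (polylog_scaled s (of_real t) - polylog_scaled s (of_real (u n)))) \<longlonglongrightarrow> norm
        (polylog_scaled s (of_real t) - zeta_scaled s)"
      by (intro tendsto_intros)
    moreover have "(\<lambda>n. L * \<bar>t - u n\<bar>) \<longlonglongrightarrow> L * \<bar>t - 0\<bar>" by (intro tendsto_intros u0)
    ultimately have "norm (polylog_scaled s (of_real t) - zeta_scaled s) \<le> L * \<bar>t - 0\<bar>"
      using lip[OF s t u] by (intro LIMSEQ_le[where Y = "\<lambda>n. L * \<bar>t - u n\<bar>"]) auto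
    thus ?thesis using t by simp
  qed
  thus ?thesis using that[of e L] e by blast
qed

lemma polylog_scaled_tendsto_zeta_scaled:
  assumes "Re s < 2"
  shows "((\<lambda>t. polylog_scaled s (of_real t)) \<longlongrightarrow> zeta_scaled s) (at_right 0)"
proof -
  obtain e L where e: "e > 0" "L \<ge> 0" and b: "\<And>s' t. s' \<in> ball s e \<Longrightarrow> t \<in> {0<..1/2} \<Longrightarrow>
    norm (polylog_scaled s' (of_real t) - zeta_scaled s') \<le> L * t" using zeta_scaled_bound[OF assms] by blast
  have "((\<lambda>t. polylog_scaled s (of_real t) - zeta_scaled s) \<longlongrightarrow> 0) (at_right 0)"
  proof (rule Lim_null_comparison)
    show "\<forall>\<^sub>F t in at_right 0. norm (polylog_scaled s (of_real t) - zeta_scaled s) \<le> L * t"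
      using e b[of s] by (intro eventually_at_rightI[of 0 "1/2"]) auto
    show "((\<lambda>t. L * t) \<longlongrightarrow> 0) (at_right 0)" by (auto intro!: tendsto_eq_intros)
  qed
  thus ?thesis by (simp add: LIM_zero_iff)
qed

lemma holomorphic_zeta_scaled: "zeta_scaled holomorphic_on {s. Re s < 2}"
proof (rule holomorphic_uniform_sequence)
  show "open {s. Re s < 2}" by (rule open_halfspace_Re_lt)
  let ?f = "\<lambda>n s. polylog_scaled s (of_real (1 / (2 * real (Suc n))))"
  show "?f n holomorphic_on {s. Re s < 2}" for n by (intro holomorphic_polylog_scaled_param) auto
  fix s0 assume s0: "s0 \<in> {s. Re s < 2}"
  obtain e L where e: "e > 0" "L \<ge> 0" and b: "\<And>s t. s \<in> ball s0 e \<Longrightarrow> t \<in> {0<..1/2} \<Longrightarrow>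
    norm (polylog_scaled s (of_real t) - zeta_scaled s) \<le> L * t" using zeta_scaled_bound s0 by blast
  obtain d where d: "d > 0" "cball s0 d \<subseteq> {s. Re s < 2}"
    using open_contains_cball[of "{s. Re s < 2}"] open_halfspace_Re_lt[of 2] s0 by blast
  define d' where "d' = min d (e / 2)"
  have "uniform_limit (cball s0 d') ?f zeta_scaled sequentially"
  proof (rule uniform_limitI)
    fix \<epsilon> :: real assume \<epsilon>: "\<epsilon> > 0"
    have "(\<lambda>n. L * (1 / (2 * real (Suc n)))) \<longlonglongrightarrow> 0" by real_asymp
    hence "\<forall>\<^sub>F n in sequentially. L * (1 / (2 * real (Suc n))) < \<epsilon>"
      using \<epsilon> by (rule order_tendstoD)
    thus "\<forall>\<^sub>F n in sequentially. \<forall>s\<in>cball s0 d'. dist (?f n s) (zeta_scaled s) < \<epsilon>"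
    proof eventually_elim
      case (elim n)
      show ?case
      proof
        fix s assume "s \<in> cball s0 d'"
        hence "s \<in> ball s0 e" using e by (auto simp: d'_def)
        moreover have "1 / (2 * real (Suc n)) \<in> {0<..1/2}" by (auto simp: field_simps)
        ultimately have "norm (?f n s - zeta_scaled s) \<le> L * (1 / (2 * real (Suc n)))" by (rule b)
        thus "dist (?f n s) (zeta_scaled s) < \<epsilon>" using elim by (simp only: dist_norm)
      qed
    qed
  qed
  thus "\<exists>d>0. cball s0 d \<subseteq> {s. Re s < 2} \<and> uniform_limit (cball s0 d) ?f zeta_scaled sequentially"
    using d e by (intro exI[of _ d']) (auto simp: d'_def)
qed

lemma infsum_eq_lebesgue_integral:
  fixes f :: "'a \<Rightarrow> complex"
  assumes "integrable (count_space A) f"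
  shows "infsum f A = integral\<^sup>L (count_space A) f"
  using infsetsum_infsum[of f A] assms by (simp add: Infinite_Set_Sum.abs_summable_on_def infsetsum_def)

lemma integrable_powr_nat:
  assumes "\<sigma> > 1"
  shows "integrable (count_space {1::nat..}) (\<lambda>n. real n powr - \<sigma>)"
proof -
  have "summable (\<lambda>n::nat. real n powr - \<sigma>)" using assms by (subst summable_real_powr_iff) auto
  hence "summable (\<lambda>n::nat. norm (real n powr - \<sigma>))" by simp
  hence "summable (\<lambda>n::nat. norm (real (Suc n) powr - \<sigma>))" by (subst summable_Suc_iff)
  hence "integrable (count_space UNIV) (\<lambda>n::nat. real (Suc n) powr - \<sigma>)"
    by (subst integrable_count_space_nat_iff)
  thus ?thesis using integrable_bij_count_space[OF bij_betw_Suc_nat] by blast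
qed

definition zeta_series :: "complex \<Rightarrow> complex" where
  "zeta_series s = (\<Sum>\<^sub>\<infinity>n\<in>{1::nat..}. 1 / of_nat n powr s)"

lemma norm_zeta_term: "n \<ge> 1 \<Longrightarrow> norm (1 / of_nat n powr s) = real n powr - Re s"
  using norm_of_real_powr[of "real n" s] by (simp add: norm_divide powr_minus_divide)

lemma zeta_series_eq:
  assumes "Re s > 1"
  shows "zeta_series s = (\<integral>n. 1 / of_nat n powr s \<partial>count_space {1::nat..})"
  unfolding zeta_series_def
proof (rule infsum_eq_lebesgue_integral)
  show "integrable (count_space {1::nat..}) (\<lambda>n. 1 / of_nat n powr s :: complex)"
    using norm_zeta_term by (intro Bochner_Integration.integrable_bound[OF integrable_powr_nat[OF assms]]
        AE_I2) auto
qed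

lemma holomorphic_zeta_series: "zeta_series holomorphic_on {s. Re s > 1}"
proof -
  have "(\<lambda>s. \<integral>n. 1 / of_nat n powr s \<partial>count_space {1::nat..}) holomorphic_on {s. Re s > 1}"
  proof (rule holomorphic_on_lebesgue_integral)
    show "open {s. Re s > 1}" by (rule open_halfspace_Re_gt)
    fix s0 assume "s0 \<in> {s. Re s > 1}"
    hence s0: "Re s0 > 1" by simp
    define e where "e = (Re s0 - 1) / 2"
    have "norm (1 / of_nat n powr s :: complex) \<le> real n powr - (1 + e)" if "s \<in> ball s0 e" "n \<ge> 1" for s
        and n :: nat
    proof -
      have "Re s \<ge> 1 + e"
        using that abs_Re_le_cmod[of "s0 - s"] by (simp add: dist_norm e_def field_simps)
      thus ?thesis using norm_zeta_term[OF that(2), of s] that(2) by (auto intro!: powr_mono)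
    qed
    moreover have "integrable (count_space {1::nat..}) (\<lambda>n. real n powr - (1 + e))"
      using s0 by (intro integrable_powr_nat) (auto simp: e_def)
    ultimately show "\<exists>e>0. \<exists>D. integrable (count_space {1::nat..}) D \<and>
       (\<forall>s\<in>ball s0 e. \<forall>n\<in>space (count_space {1..}). norm (1 / of_nat n powr s :: complex) \<le> D n)"
      using s0 by (intro exI[of _ e] exI[of _ "\<lambda>n. real n powr - (1 + e)"] conjI) (auto simp: e_def)
  qed (auto intro!: holomorphic_intros)
  also have "?this \<longleftrightarrow> ?thesis" by (intro holomorphic_cong) (auto simp: zeta_series_eq)
  finally show ?thesis .
qed

text \<open>The exponential factors have norm at most 1, so the zeta series itself
  dominates.\<close>

lemma polylog_tendsto_zeta_series:
  assumes s: "Re s > 1"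
  shows "(\<lambda>k. polylog s (of_real (1 / (2 * real (Suc k))))) \<longlonglongrightarrow> zeta_series s"
  unfolding zeta_series_eq[OF s] polylog_def
proof (rule integral_dominated_convergence[where w = "\<lambda>n. real n powr - Re s"])
  show "integrable (count_space {1::nat..}) (\<lambda>n. real n powr - Re s)" by (rule integrable_powr_nat[OF s])
  show "AE n in count_space {1..}. (\<lambda>k. of_nat n powr - s * exp (- (of_nat n * of_real (1 / (2 * real (Suc
      k))))))
          \<longlonglongrightarrow> 1 / of_nat n powr s"
  proof (intro AE_I2)
    fix n :: nat
    have "(\<lambda>k. 1 / (2 * real (Suc k))) \<longlonglongrightarrow> 0" by real_asymp
    hence "(\<lambda>k. of_nat n powr - s * exp (- (of_nat n * complex_of_real (1 / (2 * real (Suc k))))))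
      \<longlonglongrightarrow> of_nat n powr - s * exp (- (of_nat n * of_real 0))"
      by (intro tendsto_intros)
    thus "(\<lambda>k. of_nat n powr - s * exp (- (of_nat n * complex_of_real (1 / (2 * real (Suc k))))))
          \<longlonglongrightarrow> 1 / of_nat n powr s" by (simp add: powr_minus_divide)
  qed
  show "AE n in count_space {1..}. norm (of_nat n powr - s * exp (- (of_nat n * complex_of_real (1 / (2 *
      real (Suc k)))))) \<le> real n powr - Re s" for k
    using norm_polylog_term_le[of "- Re s" s 0 "of_real (1 / (2 * real (Suc k)))"]
    by (intro AE_I2) auto
qed auto

text \<open>For Re s > 1 the term in \<tau>^(s-1) tends to 0 with \<tau>. On this overlap strip the
  two halves of the continuation meet.\<close>

lemma zeta_scaled_eq_zeta_series:
  assumes s: "1 < Re s" "Re s < 2"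
  shows "zeta_scaled s = (s - 1) * zeta_series s"
proof -
  let ?u = "\<lambda>k. complex_of_real (1 / (2 * real (Suc k)))"
  have "(\<lambda>k. 1 / (2 * real (Suc k))) \<longlonglongrightarrow> 0" by real_asymp
  hence "(\<lambda>k. (1 / (2 * real (Suc k))) powr (Re s - 1)) \<longlonglongrightarrow> 0 powr (Re s - 1)"
    using s by (intro tendsto_powr') (auto simp: eventually_sequentially)
  hence "(\<lambda>k. norm (?u k powr (s - 1))) \<longlonglongrightarrow> 0"
    by (subst norm_of_real_powr) auto
  hence 1: "(\<lambda>k. ?u k powr (s - 1)) \<longlonglongrightarrow> 0" by (rule tendsto_norm_zero_cancel)
  have "(\<lambda>k. polylog_scaled s (?u k)) \<longlonglongrightarrow> (s - 1) * zeta_series s + Gamma (2 - s) * 0"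
    unfolding polylog_scaled_def by (intro tendsto_intros polylog_tendsto_zeta_series s 1)
  thus ?thesis unfolding zeta_scaled_def by (simp add: limI)
qed

lemma meromorphic_on_open_cong:
  assumes "open U" "\<And>z. z \<in> U \<Longrightarrow> f z = g z"
  shows "f meromorphic_on U \<longleftrightarrow> g meromorphic_on U"
proof (rule meromorphic_on_cong[OF _ refl])
  fix z assume "z \<in> U"
  from eventually_at_in_open'[OF assms(1) this] show "\<forall>\<^sub>F w in at z. f w = g w"
    by (rule eventually_mono) (rule assms(2))
qed

text \<open>Only meromorphic, not yet normalised: at s = 1 division by zero yields 0. The two
  branches agree for 1 < Re s < 2.\<close>

definition zeta0 :: "complex \<Rightarrow> complex" where
  "zeta0 s = (if Re s > 1 then zeta_series s else zeta_scaled s / (s - 1))"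

lemma meromorphic_zeta0: "zeta0 meromorphic_on UNIV"
proof -
  have "zeta_series analytic_on {s. Re s > 1}"
    using holomorphic_zeta_series by (simp add: analytic_on_open open_halfspace_Re_gt)
  hence "zeta_series meromorphic_on {s. Re s > 1}" by (rule analytic_on_imp_meromorphic_on)
  hence 1: "zeta0 meromorphic_on {s. Re s > 1}"
    by (subst meromorphic_on_open_cong[OF open_halfspace_Re_gt, of _ _ zeta_series]) (auto simp: zeta0_def)
  have "zeta_scaled meromorphic_on {s. Re s < 2}"
    by (intro analytic_on_imp_meromorphic_on) (simp add: analytic_on_open open_halfspace_Re_lt
        holomorphic_zeta_scaled)
  hence "(\<lambda>s. zeta_scaled s / (s - 1)) meromorphic_on {s. Re s < 2}" by (intro meromorphic_intros)
  moreover have "zeta0 s = zeta_scaled s / (s - 1)" if "Re s < 2" for s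
    using that zeta_scaled_eq_zeta_series[of s] by (auto simp: zeta0_def)
  ultimately have 2: "zeta0 meromorphic_on {s. Re s < 2}"
    by (subst meromorphic_on_open_cong[OF open_halfspace_Re_lt, of _ _ "\<lambda>s. zeta_scaled s / (s - 1)"]) auto
  have "UNIV = {s. Re s > 1} \<union> {s. Re s < 2}" by auto
  thus ?thesis using 1 2 by (metis meromorphic_on_Un)
qed

text \<open>\<open>remove_sings\<close> picks the nicely meromorphic representative that
  \<open>meromorphic_continuation\<close> demands.\<close>

lemma zeta_eq_remove_sings: "zeta = remove_sings zeta0"
  unfolding zeta_def
proof (rule meromorphic_continuation_unique)
  show "remove_sings zeta0 nicely_meromorphic_on UNIV"
    by (rule remove_sings_nicely_meromorphic[OF meromorphic_zeta0])
  show "remove_sings zeta0 s = (\<Sum>\<^sub>\<infinity>n\<in>{1::nat..}. 1 / of_nat n powr s)" if "s \<in> {s. Re s > 1}" for s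
  proof -
    have "zeta0 holomorphic_on {s. Re s > 1}"
      using holomorphic_zeta_series
      by (subst holomorphic_cong[OF refl, of _ _ zeta_series]) (auto simp: zeta0_def)
    hence "zeta0 analytic_on {s. Re s > 1}" by (simp add: analytic_on_open open_halfspace_Re_gt)
    hence "remove_sings zeta0 s = zeta0 s"
      using that by (intro remove_sings_at_analytic) (auto intro: analytic_on_subset)
    thus ?thesis using that by (simp add: zeta0_def zeta_series_def)
  qed
  show "2 islimpt {s. Re s > 1}"
    by (rule interior_limit_point) (simp add: interior_open open_halfspace_Re_gt)
qed

lemma zeta_eq:
  assumes "Re s < 1"
  shows "zeta s = zeta_scaled s / (s - 1)"
proof -
  have "(\<lambda>s. zeta_scaled s / (s - 1)) holomorphic_on {s. Re s < 1}"
    by (intro holomorphic_intros holomorphic_on_subset[OF holomorphic_zeta_scaled]) auto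
  hence "zeta0 holomorphic_on {s. Re s < 1}"
    by (subst holomorphic_cong[OF refl, of _ _ "\<lambda>s. zeta_scaled s / (s - 1)"]) (auto simp: zeta0_def)
  hence "zeta0 analytic_on {s. Re s < 1}" by (simp add: analytic_on_open open_halfspace_Re_lt)
  hence "remove_sings zeta0 s = zeta0 s"
    using assms by (intro remove_sings_at_analytic) (auto intro: analytic_on_subset)
  thus ?thesis using assms by (simp add: zeta_eq_remove_sings zeta0_def)
qed

lemma holomorphic_zeta: "zeta holomorphic_on {s. Re s < 1}"
proof -
  have "(\<lambda>s. zeta_scaled s / (s - 1)) holomorphic_on {s. Re s < 1}"
    by (intro holomorphic_intros holomorphic_on_subset[OF holomorphic_zeta_scaled]) auto
  also have "?this \<longleftrightarrow> ?thesis" by (intro holomorphic_cong) (auto simp: zeta_eq)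
  finally show ?thesis .
qed

text \<open>This link identifies zeta with the constant term of the expansion at the origin.\<close>

lemma polylog_reg_tendsto_zeta:
  assumes "Re s < 1"
  shows "((\<lambda>t. polylog_reg s (of_real t)) \<longlongrightarrow> zeta s) (at_right 0)"
proof -
  have "s \<noteq> 1" using assms by auto
  have "((\<lambda>t. polylog_scaled s (of_real t) / (s - 1)) \<longlongrightarrow> zeta_scaled s / (s - 1)) (at_right 0)"
    using assms \<open>s \<noteq> 1\<close> by (intro tendsto_intros polylog_scaled_tendsto_zeta_scaled) auto
  thus ?thesis using \<open>s \<noteq> 1\<close> by (simp add: polylog_scaled_eq_polylog_reg[OF assms] zeta_eq[OF assms])
qed

subsection \<open>Expansion of the polylogarithm\<close>

definition zeta_Taylor :: "nat \<Rightarrow> complex \<Rightarrow> complex \<Rightarrow> complex" where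
  "zeta_Taylor K s \<tau> = (\<Sum>k<K. zeta (s - of_nat k) * (- \<tau>) ^ k / fact k)"

lemma has_field_derivative_zeta_Taylor:
  "(zeta_Taylor (Suc K) s has_field_derivative - zeta_Taylor K (s - 1) \<tau>) (at \<tau>)"
proof -
  \<comment> \<open>The case distinction guards the truncated subtraction k - 1 at k = 0, where the
    derivative is 0.\<close>
  have *: "((\<lambda>\<tau>. (- \<tau>) ^ k / fact k) has_field_derivative (if k = 0 then 0 else - ((- \<tau>) ^ (k - 1) / fact
      (k - 1)))) (at \<tau>)"
    for k and \<tau> :: complex
  proof (cases k)
    case (Suc n)
    have "((\<lambda>\<tau>. (- \<tau>) ^ Suc n / fact (Suc n)) has_field_derivative of_nat (Suc n) * (- \<tau>) ^ n * (- 1) /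
        fact (Suc n)) (at \<tau>)"
      using DERIV_power[OF DERIV_minus[OF DERIV_ident], of "Suc n" \<tau> UNIV]
      by (intro DERIV_cdivide) (simp add: mult_ac)
    also have "of_nat (Suc n) * (- \<tau>) ^ n * (- 1) / fact (Suc n) = - ((- \<tau>) ^ n / fact n)"
      by (simp add: fact_Suc del: of_nat_Suc)
    finally show ?thesis using Suc by simp
  qed simp
  have "((\<lambda>\<tau>. \<Sum>k<Suc K. zeta (s - of_nat k) * ((- \<tau>) ^ k / fact k)) has_field_derivative
     (\<Sum>k<Suc K. zeta (s - of_nat k) * (if k = 0 then 0 else - ((- \<tau>) ^ (k - 1) / fact (k - 1))))) (at \<tau>)"
    by (intro DERIV_sum DERIV_cmult *)
  also have "(\<Sum>k<Suc K. zeta (s - of_nat k) * (if k = 0 then 0 else - ((- \<tau>) ^ (k - 1) / fact (k - 1)))) =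
      - zeta_Taylor K (s - 1) \<tau>"
    unfolding zeta_Taylor_def sum.lessThan_Suc_shift by (simp add: sum_negf algebra_simps)
  finally show ?thesis by (simp add: zeta_Taylor_def [abs_def])
qed

text \<open>Induction on K with s0 arbitrary. The remainder of order K + 1 at s has as derivative
  minus the remainder of order K at s - 1, and it tends to 0 at the origin because the constant
  terms match. A mean value bound on [u,t] with u tending to 0 gains one power of t and keeps the
  constant C.\<close>

lemma polylog_reg_Taylor:
  assumes "Re s0 < 1"
  shows "\<exists>e>0. \<exists>C\<ge>0. \<forall>s\<in>ball s0 e. Re s < 1 \<and> (\<forall>t\<in>{0<..1/2}. norm (polylog_reg s (of_real t) - zeta_Taylor
      K s (of_real t)) \<le> C * t ^ K)"
  using assms
proof (induction K arbitrary: s0)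
  case 0
  obtain e C where e: "e > 0" "C \<ge> 0"
    "\<And>s \<tau>. s \<in> ball s0 e \<Longrightarrow> Re \<tau> > 0 \<Longrightarrow> norm \<tau> \<le> 1 / 2 \<Longrightarrow> norm (polylog_reg s \<tau>) \<le> C"
    using polylog_reg_bound[OF 0] by blast
  obtain d where d: "d > 0" "ball s0 d \<subseteq> {s. Re s < 1}"
    using open_halfspace_Re_lt[of 1] 0 openE[of "{s. Re s < 1}" s0] by blast
  show ?case
    by (rule exI[of _ "min e d"], rule conjI, use e d in simp, rule exI[of _ C])
       (use e d in \<open>auto simp: zeta_Taylor_def\<close>)
next
  case (Suc K)
  obtain e C where e: "e > 0" "C \<ge> 0" and b: "\<And>s t. s \<in> ball (s0 - 1) e \<Longrightarrow> t \<in> {0<..1/2} \<Longrightarrow>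
      norm (polylog_reg s (of_real t) - zeta_Taylor K s (of_real t)) \<le> C * t ^ K"
    using Suc.IH[of "s0 - 1"] Suc.prems by auto
  obtain d where d: "d > 0" "ball s0 d \<subseteq> {s. Re s < 1}"
    using open_halfspace_Re_lt[of 1] Suc.prems openE[of "{s. Re s < 1}" s0] by blast
  have "norm (polylog_reg s (of_real t) - zeta_Taylor (Suc K) s (of_real t)) \<le> C * t ^ Suc K"
    if s: "s \<in> ball s0 (min e d)" and t: "t \<in> {0<..1/2}" for s t
  proof -
    have Re: "Re s < 1" using s d by auto
    let ?f = "\<lambda>\<tau>. polylog_reg s \<tau> - zeta_Taylor (Suc K) s \<tau>"
    have lip: "norm (?f (of_real t) - ?f (of_real u)) \<le> C * t ^ K * (t - u)" if u: "0 < u" "u < t" for u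
    proof -
      let ?S = "closed_segment (complex_of_real u) (of_real t)"
      let ?f' = "\<lambda>\<tau>. - polylog_reg (s - 1) \<tau> - - zeta_Taylor K (s - 1) \<tau>"
      have seg: "\<exists>v. z = of_real v \<and> u \<le> v \<and> v \<le> t" if "z \<in> ?S" for z
      proof -
        obtain v where v: "z = of_real v" "v \<in> closed_segment u t"
          using \<open>z \<in> ?S\<close> unfolding closed_segment_of_real by blast
        moreover have "closed_segment u t = {u..t}" using u by (simp add: closed_segment_eq_real_ivl)
        ultimately show ?thesis by auto
      qed
      have der: "(?f has_field_derivative ?f' z) (at z within ?S)" if z: "z \<in> ?S" for z
      proof -
        obtain v where v: "z = of_real v" "u \<le> v" using seg[OF z] by blast
        have "0 < v" using v(2) u(1) by linarith
        hence "Re z > 0" unfolding v(1) Re_complex_of_real .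
        thus ?thesis
          by (rule has_field_derivative_at_within[OF DERIV_diff[OF has_field_derivative_polylog_reg[OF _
              Re] has_field_derivative_zeta_Taylor]])
      qed
      have bnd: "norm (?f' z) \<le> C * t ^ K" if z: "z \<in> ?S" for z
      proof -
        obtain v where v: "z = of_real v" "u \<le> v" "v \<le> t" using seg[OF z] by blast
        have "s - 1 \<in> ball (s0 - 1) e" using s by (simp add: dist_norm)
        moreover have "v \<in> {0<..1/2}" using v(2,3) u t unfolding greaterThanAtMost_iff by linarith
        ultimately have "norm (polylog_reg (s - 1) (of_real v) - zeta_Taylor K (s - 1) (of_real v)) \<le> C *
            v ^ K"
          by (rule b)
        also have "\<dots> \<le> C * t ^ K" using v u e by (intro mult_left_mono power_mono) auto
        finally show ?thesis using v(1) by (simp add: norm_minus_commute)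
      qed
      have "norm (?f (of_real t) - ?f (of_real u)) \<le> C * t ^ K * norm (complex_of_real t - of_real u)"
        by (rule field_differentiable_bound[OF convex_closed_segment der bnd]) auto
      also have "norm (complex_of_real t - of_real u) = t - u" using u by (simp flip: of_real_diff)
      finally show ?thesis .
    qed
    have "((\<lambda>u. ?f (complex_of_real u)) \<longlongrightarrow> zeta s - zeta_Taylor (Suc K) s (of_real 0)) (at_right 0)"
    proof (intro tendsto_diff polylog_reg_tendsto_zeta Re)
      have "isCont (zeta_Taylor (Suc K) s) (of_real 0)" using has_field_derivative_zeta_Taylor
          DERIV_isCont by blast
      thus "((\<lambda>u. zeta_Taylor (Suc K) s (of_real u)) \<longlongrightarrow> zeta_Taylor (Suc K) s (of_real 0)) (at_right 0)"
        by (rule isCont_tendsto_compose) (intro tendsto_intros)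
    qed
    moreover have "zeta_Taylor (Suc K) s (of_real 0) = zeta s"
      unfolding zeta_Taylor_def sum.lessThan_Suc_shift by simp
    ultimately have "((\<lambda>u. ?f (complex_of_real u)) \<longlongrightarrow> 0) (at_right 0)" by simp
    hence "((\<lambda>u. norm (?f (of_real t) - ?f (complex_of_real u))) \<longlongrightarrow> norm (?f (of_real t) - 0)) (at_right 0)"
      by (intro tendsto_intros)
    moreover have "((\<lambda>u. C * t ^ K * (t - u)) \<longlongrightarrow> C * t ^ K * (t - 0)) (at_right 0)"
      by (intro tendsto_intros)
    moreover have "\<forall>\<^sub>F u in at_right 0. norm (?f (of_real t) - ?f (complex_of_real u)) \<le> C * t ^ K * (t - u)"
      using lip t by (intro eventually_at_rightI[of 0 t]) auto
    ultimately have "norm (?f (of_real t) - 0) \<le> C * t ^ K * (t - 0)"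
      by (intro tendsto_le[OF trivial_limit_at_right_real])
    thus ?thesis by (simp add: mult_ac)
  qed
  thus ?case
    by (intro exI[of _ "min e d"] conjI exI[of _ C] ballI) (use e d in auto)
qed

subsection \<open>Trivial zeros of the zeta function\<close>

lemma polylog_reg_minus_of_nat:
  assumes "Re \<tau> > 0" "\<bar>Im \<tau>\<bar> < 2 * pi"
  shows "(deriv ^^ k) phi \<tau> = (- 1) ^ k * polylog_reg (- of_nat k) \<tau>"
  using assms
proof (induction k arbitrary: \<tau>)
  case 0
  thus ?case by (simp add: polylog_reg_0)
next
  case (Suc k)
  let ?S = "{\<tau>. Re \<tau> > 0} \<inter> {\<tau>. \<bar>Im \<tau>\<bar> < 2 * pi}"
  have "Re (- of_nat k) < 1" by simp
  from DERIV_cmult[OF has_field_derivative_polylog_reg[OF Suc.prems(1) this], of "(-1) ^ k"]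
  have "((deriv ^^ k) phi has_field_derivative (- 1) ^ k * - polylog_reg (- of_nat k - 1) \<tau>) (at \<tau>)"
  proof (rule has_field_derivative_transform_within_open)
    show "open ?S" by (intro open_Int open_halfspace_Re_gt open_Im_strip)
    show "\<tau> \<in> ?S" using Suc.prems by blast
    show "(- 1) ^ k * polylog_reg (- of_nat k) z = (deriv ^^ k) phi z" if "z \<in> ?S" for z
      using that Suc.IH[of z] by simp
  qed
  hence "deriv ((deriv ^^ k) phi) \<tau> = (- 1) ^ k * - polylog_reg (- of_nat k - 1) \<tau>" by (rule DERIV_imp_deriv)
  moreover have "- of_nat k - 1 = - complex_of_nat (Suc k)" by simp
  ultimately show ?case by simp
qed

text \<open>\<open>phi\<close> generates the values of zeta at non-positive integers: its Taylor
  series at 0 has the terms zeta(-k) (-z)^k / k!. Both sides are limits of the same function as t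
  decreases to 0.\<close>

lemma zeta_minus_of_nat: "zeta (- of_nat k) = (- 1) ^ k * (deriv ^^ k) phi 0"
proof -
  let ?S = "{\<tau>. \<bar>Im \<tau>\<bar> < 2 * pi}"
  have "(deriv ^^ k) phi holomorphic_on ?S"
    by (intro holomorphic_higher_deriv holomorphic_phi open_Im_strip)
  hence "continuous_on ?S ((deriv ^^ k) phi)" by (rule holomorphic_on_imp_continuous_on)
  hence "isCont ((deriv ^^ k) phi) (of_real 0)"
    using open_Im_strip by (subst (asm) continuous_on_eq_continuous_at) auto
  hence "((\<lambda>t. (deriv ^^ k) phi (of_real t)) \<longlongrightarrow> (deriv ^^ k) phi (of_real 0)) (at_right 0)"
    by (rule isCont_tendsto_compose) (intro tendsto_intros)
  hence 1: "((\<lambda>t. (- 1) ^ k * (deriv ^^ k) phi (of_real t)) \<longlongrightarrow> (- 1) ^ k * (deriv ^^ k) phi 0) (at_right 0)"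
    by (intro tendsto_mult_left) simp
  have "((\<lambda>t. polylog_reg (- of_nat k) (of_real t)) \<longlongrightarrow> zeta (- of_nat k)) (at_right 0)"
    by (rule polylog_reg_tendsto_zeta) simp
  also have "?this \<longleftrightarrow> ((\<lambda>t. (- 1) ^ k * (deriv ^^ k) phi (of_real t)) \<longlongrightarrow> zeta (- of_nat k)) (at_right 0)"
  proof (rule tendsto_cong, rule eventually_at_rightI[of 0 1])
    fix t :: real assume "t \<in> {0<..<1}"
    hence "(deriv ^^ k) phi (of_real t) = (- 1) ^ k * polylog_reg (- of_nat k) (of_real t)"
      by (intro polylog_reg_minus_of_nat) auto
    thus "polylog_reg (- of_nat k) (of_real t) = (- 1) ^ k * (deriv ^^ k) phi (of_real t)"
      by (simp flip: power_mult_distrib mult.assoc)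
  qed simp
  finally show ?thesis using 1 tendsto_unique trivial_limit_at_right_real by blast
qed

lemma phi_minus':
  assumes "\<bar>Im z\<bar> < 2 * pi"
  shows "phi (- z) = - 1 - phi z"
\<comment> \<open>At 0 the value of \<open>phi\<close> is a filled-in derivative, so the identity is
  obtained there by continuity.\<close>
proof (cases "z = 0")
  case True
  let ?S = "{\<tau>. \<bar>Im \<tau>\<bar> < 2 * pi}"
  have "continuous_on ?S phi" using holomorphic_phi by (rule holomorphic_on_imp_continuous_on)
  hence c: "isCont phi 0"
    using open_Im_strip by (subst (asm) continuous_on_eq_continuous_at) auto
  have "((\<lambda>z. phi z + phi (- z)) \<longlongrightarrow> phi 0 + phi (- 0)) (at 0)"
    by (intro tendsto_add isCont_tendsto_compose[OF c] isContD[OF c])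
       (use c in \<open>auto intro!: tendsto_eq_intros isCont_tendsto_compose[OF c]\<close>)
  moreover have "\<forall>\<^sub>F z in at 0. phi z + phi (- z) = - 1"
  proof -
    have "\<forall>\<^sub>F z in at (0::complex). z \<in> ?S - {0}"
      using eventually_at_in_open[OF open_Im_strip, of 0 "2 * pi"] by simp
    thus ?thesis by (rule eventually_mono) (simp add: phi_minus)
  qed
  hence "((\<lambda>z. phi z + phi (- z)) \<longlongrightarrow> - 1) (at 0)" by (rule tendsto_eventually)
  ultimately have "phi 0 + phi (- 0) = - 1" using LIM_unique by blast
  thus ?thesis using True by (simp add: eq_diff_eq)
next
  case False
  thus ?thesis using phi_minus assms by blast
qed

text \<open>Take k-th derivatives at 0 in phi(-z) = -1 - phi(z). For even k the left side gives d
  and, the constant vanishing because k > 0, the right side gives -d.\<close>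

lemma zeta_trivial_zero:
  assumes "even k" "k > 0"
  shows "zeta (- of_nat k) = 0"
proof -
  let ?S = "{\<tau>. \<bar>Im \<tau>\<bar> < 2 * pi}"
  have "(deriv ^^ k) (\<lambda>z. phi ((- 1) * z)) 0 = (- 1) ^ k * (deriv ^^ k) phi ((- 1) * 0)"
    by (rule higher_deriv_compose_linear[OF holomorphic_phi open_Im_strip open_Im_strip]) auto
  also have "(deriv ^^ k) (\<lambda>z. phi ((- 1) * z)) 0 = (deriv ^^ k) (\<lambda>z. - 1 - phi z) 0"
  proof (rule higher_deriv_transform_within_open[where S = ?S])
    have "(phi \<circ> (\<lambda>z. (- 1) * z)) holomorphic_on ?S"
      by (rule holomorphic_on_compose_gen[OF _ holomorphic_phi]) (auto intro!: holomorphic_intros)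
    thus "(\<lambda>z. phi ((- 1) * z)) holomorphic_on ?S" by (simp add: o_def)
    show "(\<lambda>z. - 1 - phi z) holomorphic_on ?S" by (intro holomorphic_intros holomorphic_phi)
  qed (use phi_minus' open_Im_strip in auto)
  also have "\<dots> = - (deriv ^^ k) phi 0"
    using higher_deriv_diff[OF holomorphic_on_const holomorphic_phi open_Im_strip, of 0 k "-1"] assms by simp
  finally have "(deriv ^^ k) phi 0 = 0" using assms by simp
  thus ?thesis by (simp add: zeta_minus_of_nat)
qed

subsection \<open>The double series as a Mellin transform\<close>

lemma count_space_product:
  fixes f :: "'a \<Rightarrow> 'c :: {real_normed_field, banach, second_countable_topology}" and g :: "'b \<Rightarrow> 'c"
  assumes cnt: "countable A" "countable B"
    and f: "integrable (count_space A) f" and g: "integrable (count_space B) g"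
  shows "integrable (count_space (A \<times> B)) (\<lambda>(a, b). f a * g b)"
    and "(\<integral>(a, b). f a * g b \<partial>count_space (A \<times> B)) = integral\<^sup>L (count_space A) f * integral\<^sup>L
        (count_space B) g"
proof -
  interpret A: sigma_finite_measure "count_space A" by (rule sigma_finite_measure_count_space_countable[OF
      cnt(1)])
  interpret B: sigma_finite_measure "count_space B" by (rule sigma_finite_measure_count_space_countable[OF
      cnt(2)])
  interpret AB: pair_sigma_finite "count_space A" "count_space B" ..
  note eq = pair_measure_countable[OF cnt]
  have int: "integrable (count_space A \<Otimes>\<^sub>M count_space B) (\<lambda>(a, b). f a * g b)"
  proof (rule AB.Fubini_integrable)
    show "(\<lambda>(a, b). f a * g b) \<in> borel_measurable (count_space A \<Otimes>\<^sub>M count_space B)"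
      unfolding eq by simp
    have "integrable (count_space A) (\<lambda>a. norm (f a) * (\<integral>b. norm (g b) \<partial>count_space B))"
      by (intro integrable_mult_left integrable_norm f)
    thus "integrable (count_space A) (\<lambda>a. \<integral>b. norm (case (a, b) of (a, b) \<Rightarrow> f a * g b) \<partial>count_space B)"
      by (simp add: norm_mult)
  qed (use g in auto)
  thus "integrable (count_space (A \<times> B)) (\<lambda>(a, b). f a * g b)" unfolding eq .
  have "(\<integral>(a, b). f a * g b \<partial>count_space (A \<times> B)) = (\<integral>a. (\<integral>b. f a * g b \<partial>count_space B) \<partial>count_space A)"
    using AB.integral_fst[OF int] unfolding eq by simp
  thus "(\<integral>(a, b). f a * g b \<partial>count_space (A \<times> B)) = integral\<^sup>L (count_space A) f * integral\<^sup>L (count_space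
      B) g"
    by simp
qed

abbreviation nat_pairs :: "(nat \<times> nat) measure" where
  "nat_pairs \<equiv> count_space ({1..} \<times> {1..})"

abbreviation Theta_base :: "real \<Rightarrow> nat \<times> nat \<Rightarrow> real" where
  "Theta_base x \<equiv> (\<lambda>(n, m). real n + real m * x)"

definition Theta_num :: "complex \<Rightarrow> nat \<times> nat \<Rightarrow> complex" where
  "Theta_num s = (\<lambda>(n, m). of_nat n powr - s * of_nat m powr - s)"

lemma norm_of_nat_powr: "n \<ge> 1 \<Longrightarrow> norm (complex_of_nat n powr z) = real n powr Re z"
  using norm_of_real_powr[of "real n" z] by simp

text \<open>By the arithmetic-geometric mean inequality \<open>n + m x \<ge> (n m x)\<^bsup>1/2\<^esup>\<close>, which is sharp enough to
  reach the whole half-plane \<open>Re s > 2/3\<close>.\<close>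

lemma Theta_norm_bound:
  assumes x: "x > 0" and s: "Re s \<ge> \<sigma>" "\<sigma> > 0" and p: "p \<in> space nat_pairs"
  shows "norm (Theta_num s p) * Theta_base x p powr - Re s
     \<le> (case p of (n, m) \<Rightarrow> x powr (- \<sigma> / 2) * real n powr - (3 * \<sigma> / 2) * real m powr - (3 * \<sigma> / 2))"
proof -
  obtain n m where nm: "p = (n, m)" "n \<ge> 1" "m \<ge> 1" using p by auto
  have mx: "real m * x > 0" using nm x by auto
  \<comment> \<open>A base of at least 1 is what allows lowering the exponent from Re s to \<sigma>
    in the third factor.\<close>
  have base: "real n + real m * x \<ge> 1" using nm mx by linarith
  have "norm (Theta_num s p) * Theta_base x p powr - Re s = real n powr - Re s * real m powr - Re s *
      (real n + real m * x) powr - Re s"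
    using nm by (simp add: Theta_num_def norm_mult norm_of_nat_powr)
  also have "\<dots> \<le> real n powr - \<sigma> * real m powr - \<sigma> * (real n + real m * x) powr - \<sigma>"
    using s nm base by (intro mult_mono powr_mono) auto
  also have "(real n + real m * x) powr - \<sigma> \<le> sqrt (real n * (real m * x)) powr - \<sigma>"
  proof (rule powr_mono2')
    have "sqrt (real n * (real m * x)) \<le> (real n + real m * x) / 2"
      using mx by (intro arith_geo_mean_sqrt) auto
    also have "\<dots> \<le> real n + real m * x"
    proof -
      have "y / 2 \<le> y" if "y \<ge> 1" for y :: real using that by simp
      thus ?thesis using base by blast
    qed
    finally show "sqrt (real n * (real m * x)) \<le> real n + real m * x" .
    show "sqrt (real n * (real m * x)) > 0" using mx nm by simp
  qed (use s in simp)
  also have "sqrt (real n * (real m * x)) powr - \<sigma> = real n powr (- \<sigma> / 2) * (real m powr (- \<sigma> / 2) * x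
      powr (- \<sigma> / 2))"
    using nm x by (simp add: powr_half_sqrt [symmetric] powr_powr powr_mult)
  also have "real n powr - \<sigma> * real m powr - \<sigma> * (real n powr (- \<sigma> / 2) * (real m powr (- \<sigma> / 2) * x powr
      (- \<sigma> / 2)))
     = x powr (- \<sigma> / 2) * (real n powr - \<sigma> * real n powr (- \<sigma> / 2)) * (real m powr - \<sigma> * real m powr (- \<sigma>
         / 2))"
    by (simp only: mult_ac)
  also have "\<dots> = x powr (- \<sigma> / 2) * real n powr - (3 * \<sigma> / 2) * real m powr - (3 * \<sigma> / 2)"
  proof -
    have "- \<sigma> + - \<sigma> / 2 = - (3 * \<sigma> / 2)" by simp
    thus ?thesis unfolding powr_add [symmetric] by (simp only:)
  qed
  finally show ?thesis using nm by (simp add: mult_left_mono)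
qed

lemma integrable_Theta_bound:
  assumes "\<sigma> > 2 / 3"
  shows "integrable nat_pairs (\<lambda>(n, m). C * real n powr - (3 * \<sigma> / 2) * real m powr - (3 * \<sigma> / 2))"
proof -
  have "integrable nat_pairs (\<lambda>(n, m). real n powr - (3 * \<sigma> / 2) * real m powr - (3 * \<sigma> / 2))"
    using assms by (intro count_space_product integrable_powr_nat) auto
  from integrable_mult_right[OF this, of C] show ?thesis
    by (simp add: case_prod_unfold mult.assoc)
qed

lemma integrable_Theta_norm:
  assumes x: "x > 0" and s: "Re s > 2 / 3"
  shows "integrable nat_pairs (\<lambda>p. norm (Theta_num s p) * Theta_base x p powr - Re s)"
proof (rule Bochner_Integration.integrable_bound[OF integrable_Theta_bound[OF s, of "x powr (- Re s / 2)"]])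
  show "AE p in nat_pairs. norm (norm (Theta_num s p) * Theta_base x p powr - Re s)
      \<le> norm (case p of (n, m) \<Rightarrow> x powr (- Re s / 2) * real n powr - (3 * Re s / 2) * real m powr - (3 *
          Re s / 2))"
  proof (rule AE_I2)
    fix p assume p: "p \<in> space nat_pairs"
    have "Re s > 0" using s by simp
    from Theta_norm_bound[OF x order_refl this p]
    show "norm (norm (Theta_num s p) * Theta_base x p powr - Re s)
      \<le> norm (case p of (n, m) \<Rightarrow> x powr (- Re s / 2) * real n powr - (3 * Re s / 2) * real m powr - (3 *
          Re s / 2))"
      by (auto simp: case_prod_unfold)
  qed
qed simp

lemma Theta_base_pos: "x > 0 \<Longrightarrow> p \<in> space nat_pairs \<Longrightarrow> Theta_base x p > 0"
  by (auto intro!: add_pos_pos)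

lemma norm_Theta_term:
  assumes "x > 0" "p \<in> space nat_pairs"
  shows "norm (Theta_num s p / of_real (Theta_base x p) powr s) = norm (Theta_num s p) * Theta_base x p
      powr - Re s"
  using Theta_base_pos[OF assms] by (simp add: norm_divide norm_of_real_powr powr_minus_divide)

lemma Theta_series_eq:
  assumes x: "x > 0" and s: "Re s > 2 / 3"
  shows "Theta_series s s s x = (\<integral>p. Theta_num s p / of_real (Theta_base x p) powr s \<partial>nat_pairs)"
proof -
  have "Theta_series s s s x = (\<Sum>\<^sub>\<infinity>p\<in>{1..} \<times> {1..}. Theta_num s p / of_real (Theta_base x p) powr s)"
    unfolding Theta_series_def
    by (intro infsum_cong)
       (auto simp: Theta_num_def powr_minus divide_inverse mult_ac simp del: of_real_add of_real_mult)
  also have "\<dots> = (\<integral>p. Theta_num s p / of_real (Theta_base x p) powr s \<partial>nat_pairs)"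
  proof (rule infsum_eq_lebesgue_integral)
    show "integrable nat_pairs (\<lambda>p. Theta_num s p / of_real (Theta_base x p) powr s)"
    proof (rule Bochner_Integration.integrable_bound[OF integrable_Theta_norm[OF x s]])
      show "AE p in nat_pairs. norm (Theta_num s p / of_real (Theta_base x p) powr s) \<le> norm (norm
          (Theta_num s p) * Theta_base x p powr - Re s)"
        using norm_Theta_term[OF x] by (intro AE_I2) (simp add: abs_mult)
    qed simp
  qed
  finally show ?thesis .
qed

lemma holomorphic_Theta_series:
  assumes x: "x > 0"
  shows "(\<lambda>s. Theta_series s s s x) holomorphic_on {s. Re s > 2 / 3}"
proof -
  have "(\<lambda>s. \<integral>p. Theta_num s p / of_real (Theta_base x p) powr s \<partial>nat_pairs) holomorphic_on {s. Re s > 2 / 3}"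
  proof (rule holomorphic_on_lebesgue_integral)
    show "open {s. Re s > 2 / 3}" by (rule open_halfspace_Re_gt)
    show "(\<lambda>s. Theta_num s p / of_real (Theta_base x p) powr s) holomorphic_on {s. Re s > 2 / 3}" if "p \<in>
        space nat_pairs" for p
      using Theta_base_pos[OF x that] unfolding Theta_num_def case_prod_unfold
      by (intro holomorphic_intros) auto
    fix s0 assume "s0 \<in> {s. Re s > 2 / 3}"
    hence s0: "Re s0 > 2 / 3" by simp
    define \<sigma> where "\<sigma> = (Re s0 + 2 / 3) / 2"
    have \<sigma>: "\<sigma> > 2 / 3" "\<sigma> > 0" "Re s0 - \<sigma> > 0" using s0 by (simp_all add: \<sigma>_def)
    have "norm (Theta_num s p / of_real (Theta_base x p) powr s)
       \<le> (case p of (n, m) \<Rightarrow> x powr (- \<sigma> / 2) * real n powr - (3 * \<sigma> / 2) * real m powr - (3 * \<sigma> / 2))"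
      if "s \<in> ball s0 (Re s0 - \<sigma>)" "p \<in> space nat_pairs" for s p
    proof -
      have "Re (s0 - s) < Re s0 - \<sigma>"
        using that(1) complex_Re_le_cmod[of "s0 - s"] by (simp only: mem_ball dist_norm)
      hence "Re s \<ge> \<sigma>" by simp
      thus ?thesis unfolding norm_Theta_term[OF x that(2)] by (rule Theta_norm_bound[OF x _ \<sigma>(2) that(2)])
    qed
    thus "\<exists>e>0. \<exists>D. integrable nat_pairs D \<and> (\<forall>s\<in>ball s0 e. \<forall>p\<in>space nat_pairs. norm (Theta_num s p /
        of_real (Theta_base x p) powr s) \<le> D p)"
      using \<sigma>(3) integrable_Theta_bound[OF \<sigma>(1)] by blast
  qed simp
  also have "?this \<longleftrightarrow> ?thesis" by (intro holomorphic_cong) (use Theta_series_eq[OF x] in auto)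
  finally show ?thesis .
qed

definition Mellin_integrand :: "real \<Rightarrow> complex \<Rightarrow> real \<Rightarrow> complex" where
  "Mellin_integrand x s t = of_real t powr (s - 1) * (polylog s (of_real t) * polylog s (of_real (x * t)))"

text \<open>\<open>Laplace_Fubini\<close> over pairs: exp(-(n + m x) w) factors, so the sum over
  pairs becomes a product of two polylogarithms.\<close>

lemma Theta_Mellin:
  assumes x: "x > 0" and s: "Re s > 2 / 3"
  shows "integrable (lborel_on {0<..}) (Mellin_integrand x s)"
    and "integral\<^sup>L (lborel_on {0<..}) (Mellin_integrand x s) = Gamma s * Theta_series s s s x"
proof -
  let ?P = "lborel_on {0<..}"
  have N: "sigma_finite_measure nat_pairs" by (rule sigma_finite_measure_count_space_countable) auto
  have Re: "Re s > 0" using s by simp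
  have prod: "(\<integral>p. Theta_num s p * exp (- of_real (Theta_base x p * w)) \<partial>nat_pairs) = polylog s (of_real
      w) * polylog s (of_real (x * w))"
    if "w \<in> space ?P" for w
  proof -
    have w: "w > 0" using that by (simp add: space_restrict_space)
    have "(\<integral>p. Theta_num s p * exp (- of_real (Theta_base x p * w)) \<partial>nat_pairs) =
      (\<integral>(n, m). (of_nat n powr - s * exp (- (of_nat n * of_real w))) * (of_nat m powr - s * exp (- (of_nat
          m * of_real (x * w)))) \<partial>nat_pairs)"
      by (intro Bochner_Integration.integral_cong)
         (auto simp: Theta_num_def exp_add [symmetric] algebra_simps)
    also have "\<dots> = polylog s (of_real w) * polylog s (of_real (x * w))"
      unfolding polylog_def using w x by (intro count_space_product integrable_polylog) auto
    finally show ?thesis .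
  qed
  have eq: "of_real w powr (s - 1) * (\<integral>p. Theta_num s p * exp (- of_real (Theta_base x p * w)) \<partial>nat_pairs)
      = Mellin_integrand x s w"
    if "w \<in> space ?P" for w unfolding Mellin_integrand_def prod[OF that] ..
  note LF = Laplace_Fubini[OF N _ _ Theta_base_pos[OF x] Re integrable_Theta_norm[OF x s]]
  show "integrable ?P (Mellin_integrand x s)"
    using LF(1) by (subst Bochner_Integration.integrable_cong[OF refl eq[symmetric]]) auto
  have "integral\<^sup>L ?P (Mellin_integrand x s) = (\<integral>w. of_real w powr (s - 1) * (\<integral>p. Theta_num s p * exp (-
      of_real (Theta_base x p * w)) \<partial>nat_pairs) \<partial>?P)"
    by (rule Bochner_Integration.integral_cong[OF refl eq[symmetric]])
  also have "\<dots> = Gamma s * (\<integral>p. Theta_num s p / of_real (Theta_base x p) powr s \<partial>nat_pairs)"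
    by (rule LF(2)) auto
  also have "\<dots> = Gamma s * Theta_series s s s x" by (simp add: Theta_series_eq[OF x s])
  finally show "integral\<^sup>L ?P (Mellin_integrand x s) = Gamma s * Theta_series s s s x" .
qed

subsection \<open>Splitting the Mellin integral\<close>

lemma borel_measurable_lborel_on:
  fixes f :: "real \<Rightarrow> 'b :: topological_space"
  assumes "continuous_on S f"
  shows "f \<in> borel_measurable (lborel_on S)"
proof -
  have "f \<in> borel_measurable (restrict_space borel S)"
    by (rule borel_measurable_continuous_on_restrict[OF assms])
  thus ?thesis by (subst measurable_cong_sets[OF sets_restrict_space_cong refl, of lborel borel]) auto
qed

lemma integrable_lborel_on_subset:
  fixes f :: "real \<Rightarrow> 'b :: {banach, second_countable_topology}"
  assumes "integrable (lborel_on A) f" "A \<in> sets borel" "B \<in> sets borel" "B \<subseteq> A"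
  shows "integrable (lborel_on B) f"
proof -
  have "set_integrable lborel A f"
    using assms by (simp add: set_integrable_def integrable_restrict_space)
  hence "set_integrable lborel B f" by (rule set_integrable_subset) (use assms in auto)
  thus ?thesis using assms by (simp add: set_integrable_def integrable_restrict_space)
qed

lemma lebesgue_integral_lborel_on_split:
  fixes f :: "real \<Rightarrow> complex"
  assumes f: "integrable (lborel_on {0<..}) f" and c: "c > 0"
  shows "integral\<^sup>L (lborel_on {0<..}) f = integral\<^sup>L (lborel_on {0<..c}) f + integral\<^sup>L (lborel_on {c<..}) f"
proof -
  have "integrable (lborel_on {0<..c}) f" "integrable (lborel_on {c<..}) f"
    using c by (auto intro!: integrable_lborel_on_subset[OF f])
  hence "set_integrable lborel {0<..c} f" "set_integrable lborel {c<..} f"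
    by (simp_all add: set_integrable_def integrable_restrict_space)
  moreover have "{0<..c} \<inter> {c<..} = {}" "{0<..c} \<union> {c<..} = {0<..}" using c by auto
  ultimately have "(LINT t:{0<..}|lborel. f t) = (LINT t:{0<..c}|lborel. f t) + (LINT t:{c<..}|lborel. f t)"
    using set_integral_Un[of "{0<..c}" "{c<..}" lborel f] by simp
  thus ?thesis by (simp add: set_lebesgue_integral_def integral_restrict_space)
qed

lemma continuous_on_polylog_of_real:
  assumes "x > 0" "S \<subseteq> {0<..}"
  shows "continuous_on S (\<lambda>t. polylog s (of_real (x * t)))"
proof (rule continuous_on_compose2[of "{\<tau>. Re \<tau> > 0}" "polylog s"])
  have "polylog s holomorphic_on {\<tau>. Re \<tau> > 0}"
    using has_field_derivative_polylog by (subst holomorphic_on_open) (auto intro: open_halfspace_Re_gt)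
  thus "continuous_on {\<tau>. Re \<tau> > 0} (polylog s)" by (rule holomorphic_on_imp_continuous_on)
qed (use assms in \<open>auto intro!: continuous_intros\<close>)

lemma borel_measurable_polylog:
  assumes "x > 0" "S \<subseteq> {0<..}"
  shows "(\<lambda>t. polylog s (of_real (x * t))) \<in> borel_measurable (lborel_on S)"
  by (intro borel_measurable_lborel_on continuous_on_polylog_of_real assms)

lemma borel_measurable_Mellin_integrand:
  assumes "x > 0" "S \<subseteq> {0<..}"
  shows "Mellin_integrand x s \<in> borel_measurable (lborel_on S)"
proof -
  have [measurable]: "(\<lambda>t. polylog s (of_real (1 * t))) \<in> borel_measurable (lborel_on S)"
    by (rule borel_measurable_polylog[OF zero_less_one assms(2)])
  have [measurable]: "(\<lambda>t. polylog s (of_real (x * t))) \<in> borel_measurable (lborel_on S)"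
    by (rule borel_measurable_polylog[OF assms])
  have "(\<lambda>t. of_real t powr (s - 1) * (polylog s (of_real (1 * t)) * polylog s (of_real (x * t)))) \<in>
      borel_measurable (lborel_on S)"
    by measurable
  thus ?thesis by (simp add: Mellin_integrand_def [abs_def])
qed

lemma holomorphic_Mellin_integrand: "x > 0 \<Longrightarrow> t > 0 \<Longrightarrow> (\<lambda>s. Mellin_integrand x s t) holomorphic_on A"
  unfolding Mellin_integrand_def
  by (intro holomorphic_intros holomorphic_on_subset[OF holomorphic_polylog_param subset_UNIV]) auto

text \<open>Split t n into two halves: t n / 2 \<ge> c n / 2 keeps the series convergent, and t n /
  2 \<ge> t / 2 provides the decay in t.\<close>

lemma norm_polylog_exp_decay:
  assumes "Re s \<ge> - B" "t \<ge> c" "c > 0"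
  shows "norm (polylog s (of_real t)) \<le> (\<integral>n. real n powr B * exp (- (c / 2 * real n)) \<partial>count_space
      {1::nat..}) * exp (- (t / 2))"
proof -
  have int: "integrable (count_space {1::nat..}) (\<lambda>n. real n powr B * exp (- (c / 2 * real n)) * exp (- (t
      / 2)))"
    using assms by (intro integrable_mult_left integrable_powr_exp_nat) auto
  have "norm (polylog s (of_real t)) \<le> (\<integral>n. real n powr B * exp (- (c / 2 * real n)) * exp (- (t / 2))
      \<partial>count_space {1::nat..})"
    unfolding polylog_def
  proof (rule norm_lebesgue_integral_le[OF int])
    fix n assume "n \<in> space (count_space {1::nat..})"
    hence n: "n \<ge> 1" by simp
    have "norm (of_nat n powr - s * exp (- (of_nat n * complex_of_real t))) \<le> real n powr B * exp (- (t *
        real n))"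
      using n assms by (intro norm_polylog_term_le) auto
    also have "exp (- (t * real n)) \<le> exp (- (c / 2 * real n) + - (t / 2))"
    proof -
      have "c * real n \<le> t * real n" using assms by (intro mult_right_mono) auto
      moreover have "t * 1 \<le> t * real n" using n assms by (intro mult_left_mono) auto
      ultimately show ?thesis by simp
    qed
    finally show "norm (of_nat n powr - s * exp (- (of_nat n * complex_of_real t))) \<le> real n powr B * exp
        (- (c / 2 * real n)) * exp (- (t / 2))"
      by (simp add: mult_left_mono mult.assoc flip: exp_add)
  qed
  also have "\<dots> = (\<integral>n. real n powr B * exp (- (c / 2 * real n)) \<partial>count_space {1::nat..}) * exp (- (t / 2))"
    by (rule integral_mult_left_zero)
  finally show ?thesis .
qed

lemma integrable_powr_exp:
  assumes "b > -1" "a > 0"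
  shows "integrable (lborel_on {0<..}) (\<lambda>t. t powr b * exp (- (a * t)))"
proof -
  have "integrable (lborel_on {0<..}) (\<lambda>t. norm (complex_of_real t powr (of_real (b + 1) - 1) * exp (-
      of_real (a * t))))"
    using assms by (intro integrable_norm Gamma_integral_scaled) auto
  also have "?this \<longleftrightarrow> ?thesis"
    by (intro Bochner_Integration.integrable_cong)
       (auto simp: space_restrict_space norm_mult norm_of_real_powr norm_exp_eq_Re)
  finally show ?thesis .
qed

definition Mellin_tail :: "real \<Rightarrow> real \<Rightarrow> complex \<Rightarrow> complex" where
  "Mellin_tail x c s = integral\<^sup>L (lborel_on {c<..}) (Mellin_integrand x s)"

lemma holomorphic_Mellin_tail:
  assumes x: "x > 0" and c: "c > 0"
  shows "Mellin_tail x c holomorphic_on UNIV"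
  unfolding Mellin_tail_def [abs_def]
proof (rule holomorphic_on_lebesgue_integral)
  show "(\<lambda>s. Mellin_integrand x s t) holomorphic_on UNIV" if "t \<in> space (lborel_on {c<..})" for t
    using that x c by (intro holomorphic_Mellin_integrand) (auto simp: space_restrict_space)
  show "Mellin_integrand x s \<in> borel_measurable (lborel_on {c<..})" for s
    using x c by (intro borel_measurable_Mellin_integrand) auto
  fix s0 :: complex
  \<comment> \<open>Large enough that -B \<le> Re s \<le> B on the unit ball about s0.\<close>
  define B where "B = \<bar>Re s0\<bar> + 1"
  define M where "M = (\<integral>n. real n powr B * exp (- (c / 2 * real n)) \<partial>count_space {1::nat..})"
  define M' where "M' = (\<integral>n. real n powr B * exp (- (x * c * real n)) \<partial>count_space {1::nat..})"
  \<comment> \<open>One polylogarithm supplies the exponential decay and the other is merely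
    bounded. The factor \<open>t powr 0\<close>, equal to 1 for t > 0, fits the first summand to
    \<open>integrable_powr_exp\<close>.\<close>
  define D where "D t = (c powr (- B - 1) * (t powr 0 * exp (- (1/2 * t))) + t powr B * exp (- (1/2 * t)))
      * (M * M')" for t
  have "integrable (lborel_on {0<..}) D"
    unfolding D_def
    by (intro integrable_mult_left Bochner_Integration.integrable_add integrable_mult_right
        integrable_powr_exp)
       (auto simp: B_def)
  hence D: "integrable (lborel_on {c<..}) D"
    by (rule integrable_lborel_on_subset) (use c in auto)
  have M: "M \<ge> 0" "M' \<ge> 0" unfolding M_def M'_def by (intro Bochner_Integration.integral_nonneg; simp)+
  have "norm (Mellin_integrand x s t) \<le> D t" if s: "s \<in> ball s0 1" and t: "t \<in> space (lborel_on {c<..})"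
      for s t
  proof -
    have t': "t > c" "t > 0" using t c by (auto simp: space_restrict_space)
    have "\<bar>Re s0 - Re s\<bar> < 1" using s abs_Re_le_cmod[of "s0 - s"] by (simp add: dist_norm)
    hence Re: "Re s \<ge> - B" "Re s \<le> B" unfolding B_def by linarith+
    have "t powr (Re s - 1) \<le> t powr (- B - 1) + t powr B" using Re t' by (intro powr_le_powr_add) auto
    also have "t powr (- B - 1) \<le> c powr (- B - 1)" using c t' by (intro powr_mono2') (auto simp: B_def)
    finally have 1: "t powr (Re s - 1) \<le> c powr (- B - 1) + t powr B" by simp
    have 2: "norm (polylog s (of_real t)) \<le> M * exp (- (t / 2))"
      unfolding M_def using Re t' c by (intro norm_polylog_exp_decay) auto
    have 3: "norm (polylog s (of_real (x * t))) \<le> M'"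
      unfolding M'_def using Re t' c x by (intro norm_polylog_le) auto
    have "norm (Mellin_integrand x s t) = t powr (Re s - 1) * (norm (polylog s (of_real t)) * norm
        (polylog s (of_real (x * t))))"
      using t' by (simp add: Mellin_integrand_def norm_mult norm_of_real_powr)
    also have "\<dots> \<le> (c powr (- B - 1) + t powr B) * (M * exp (- (t / 2)) * M')"
      using 1 2 3 M by (intro mult_mono) auto
    also have "\<dots> = D t" using t' by (simp add: D_def algebra_simps)
    finally show ?thesis .
  qed
  thus "\<exists>e>0. \<exists>D. integrable (lborel_on {c<..}) D \<and> (\<forall>s\<in>ball s0 e. \<forall>t\<in>space (lborel_on {c<..}). norm
      (Mellin_integrand x s t) \<le> D t)"
    using D by (intro exI[of _ "1::real"] conjI exI[of _ D]) auto
qed simp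

text \<open>Compare with the Gamma-type integrand: exp (c - t) is at least 1 on (0,c].\<close>

lemma integrable_powr_0:
  assumes p: "p > -1" and c: "c > 0"
  shows "integrable (lborel_on {0<..c}) (\<lambda>t. t powr p)"
proof -
  have "integrable (lborel_on {0<..c}) (\<lambda>t. t powr p * exp (- (1 * t)))"
    by (rule integrable_lborel_on_subset[OF integrable_powr_exp[OF p]]) auto
  hence "integrable (lborel_on {0<..c}) (\<lambda>t. exp c * (t powr p * exp (- (1 * t))))" by (rule
      integrable_mult_right)
  thus ?thesis
  proof (rule Bochner_Integration.integrable_bound)
    show "AE t in lborel_on {0<..c}. norm (t powr p) \<le> norm (exp c * (t powr p * exp (- (1 * t))))"
    proof (rule AE_I2)
      fix t assume "t \<in> space (lborel_on {0<..c})"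
      hence t: "t \<le> c" by (simp add: space_restrict_space)
      have "t powr p * 1 \<le> t powr p * exp (c - t)" using t by (intro mult_left_mono) auto
      thus "norm (t powr p) \<le> norm (exp c * (t powr p * exp (- (1 * t))))"
        by (simp add: exp_diff exp_minus divide_inverse mult_ac)
    qed
  qed measurable
qed

lemma integral_powr_0:
  assumes q: "Re q > 0" and c: "c > 0"
  shows "integrable (lborel_on {0<..c}) (\<lambda>t. complex_of_real t powr (q - 1))"
    and "(\<integral>t. complex_of_real t powr (q - 1) \<partial>lborel_on {0<..c}) = of_real c powr q / q"
proof -
  let ?f = "\<lambda>t. complex_of_real t powr (q - 1)"
  show int: "integrable (lborel_on {0<..c}) ?f"
  proof (rule Bochner_Integration.integrable_bound)
    show "integrable (lborel_on {0<..c}) (\<lambda>t. t powr (Re q - 1))" using q c by (intro integrable_powr_0) auto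
    show "AE t in lborel_on {0<..c}. norm (?f t) \<le> norm (t powr (Re q - 1))"
      by (intro AE_I2) (auto simp: space_restrict_space norm_of_real_powr)
  qed measurable
  hence sint: "set_integrable lborel {0<..c} ?f" by (simp add: set_integrable_def integrable_restrict_space)
  have "(?f has_integral (of_real c powr q / q - of_real 0 powr q / q)) {0..c}"
    using q c by (intro fundamental_theorem_of_calculus_interior)
                 (auto intro!: continuous_intros derivative_eq_intros has_vector_derivative_real_field)
  hence "(?f has_integral (of_real c powr q / q)) {0..c}" by simp
  hence "(?f has_integral (of_real c powr q / q)) {0<..c}"
    by (subst (asm) has_integral_spike_set_eq[of _ "{0<..c}"]) (auto intro: negligible_subset[of "{0}"])
  hence "integral {0<..c} ?f = of_real c powr q / q" by (rule integral_unique)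
  thus "integral\<^sup>L (lborel_on {0<..c}) ?f = of_real c powr q / q"
    using set_borel_integral_eq_integral(2)[OF sint] by (simp add: set_lebesgue_integral_def
        integral_restrict_space)
qed

section \<open>Subtracting the product of the expansions below the cut\<close>

definition polylog_expansion :: "nat \<Rightarrow> complex \<Rightarrow> real \<Rightarrow> complex" where
  "polylog_expansion K s t = polylog_sing s (of_real t) + zeta_Taylor K s (of_real t)"

text \<open>Index 0 is the singular term of the expansion; index \<open>Suc k\<close> is the term in \<open>t\<^sup>k\<close>.\<close>

definition expcoeff :: "complex \<Rightarrow> nat \<Rightarrow> complex" where
  "expcoeff s i = (case i of 0 \<Rightarrow> Gamma (1 - s) | Suc k \<Rightarrow> zeta (s - of_nat k) * (- 1) ^ k / fact k)"

definition expo :: "complex \<Rightarrow> nat \<Rightarrow> complex" where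
  "expo s i = (case i of 0 \<Rightarrow> s - 1 | Suc k \<Rightarrow> of_nat k)"

lemma polylog_expansion_eq: "t > 0 \<Longrightarrow> polylog_expansion K s t = (\<Sum>i<Suc K. expcoeff s i * of_real t powr
    expo s i)"
  unfolding polylog_expansion_def polylog_sing_def zeta_Taylor_def sum.lessThan_Suc_shift
  by (auto simp: expcoeff_def expo_def powr_nat' power_minus[of "of_real t"] mult_ac intro!: sum.cong)

definition Near_integrand :: "nat \<Rightarrow> real \<Rightarrow> complex \<Rightarrow> real \<Rightarrow> complex" where
  "Near_integrand K x s t = Mellin_integrand x s t - of_real t powr (s - 1) * (polylog_expansion K s t *
      polylog_expansion K s (x * t))"

definition Mellin_near :: "nat \<Rightarrow> real \<Rightarrow> real \<Rightarrow> complex \<Rightarrow> complex" where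
  "Mellin_near K x c s = integral\<^sup>L (lborel_on {0<..c}) (Near_integrand K x s)"

text \<open>This is q for the pair of terms i and l: their product with t^(s-1) is a multiple of
  t^(q-1), whose integral over (0,c] is c^q / q.\<close>

definition Mellin_expo :: "complex \<Rightarrow> nat \<Rightarrow> nat \<Rightarrow> complex" where
  "Mellin_expo s i l = s + expo s i + expo s l"

definition Mellin_main :: "nat \<Rightarrow> real \<Rightarrow> real \<Rightarrow> complex \<Rightarrow> complex" where
  "Mellin_main K x c s = (\<Sum>i<Suc K. \<Sum>l<Suc K. expcoeff s i * expcoeff s l * of_real x powr expo s l *
      (of_real c powr Mellin_expo s i l / Mellin_expo s i l))"

lemma holomorphic_expcoeff: "(\<lambda>s. expcoeff s i) holomorphic_on {s. Re s < 1}"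
proof (cases i)
  case 0
  thus ?thesis using Re_pos_imp_notin_nonpos_Ints by (auto simp: expcoeff_def intro!: holomorphic_intros)
next
  case (Suc k)
  have "(zeta \<circ> (\<lambda>s. s - of_nat k)) holomorphic_on {s. Re s < 1}"
    by (rule holomorphic_on_compose_gen[OF _ holomorphic_zeta]) (auto intro!: holomorphic_intros)
  thus ?thesis unfolding Suc expcoeff_def by (auto simp: o_def intro!: holomorphic_intros)
qed

lemma holomorphic_expo: "(\<lambda>s. expo s i) holomorphic_on A"
  by (cases i) (auto simp: expo_def intro!: holomorphic_intros)

lemma holomorphic_Mellin_expo: "(\<lambda>s. Mellin_expo s i l) holomorphic_on A"
  unfolding Mellin_expo_def by (intro holomorphic_intros holomorphic_expo)

lemma holomorphic_polylog_expansion: "t > 0 \<Longrightarrow> (\<lambda>s. polylog_expansion K s t) holomorphic_on {s. Re s < 1}"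
  by (subst polylog_expansion_eq) (auto intro!: holomorphic_intros holomorphic_expcoeff holomorphic_expo)

lemma polylog_expansion_product:
  assumes x: "x > 0" and t: "t > 0"
  shows "of_real t powr (s - 1) * (polylog_expansion K s t * polylog_expansion K s (x * t))
    = (\<Sum>i<Suc K. \<Sum>l<Suc K. expcoeff s i * expcoeff s l * of_real x powr expo s l * of_real t powr
        (Mellin_expo s i l - 1))"
proof -
  have e: "of_real t powr (s - 1) * ((expcoeff s i * of_real t powr expo s i) * (expcoeff s l * of_real (x
      * t) powr expo s l))
      = expcoeff s i * expcoeff s l * of_real x powr expo s l * of_real t powr (Mellin_expo s i l - 1)"
          for i l
  proof -
    have "of_real (x * t) powr expo s l = of_real x powr expo s l * of_real t powr expo s l"
      using x t by (simp add: powr_times_real)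
    moreover have "of_real t powr (Mellin_expo s i l - 1) = of_real t powr (s - 1) * of_real t powr expo s
        i * of_real t powr expo s l"
      unfolding powr_add [symmetric] Mellin_expo_def by (simp add: algebra_simps)
    ultimately show ?thesis by (simp only: mult_ac)
  qed
  have "x * t > 0" using x t by simp
  hence "of_real t powr (s - 1) * (polylog_expansion K s t * polylog_expansion K s (x * t))
    = (\<Sum>i<Suc K. \<Sum>l<Suc K. of_real t powr (s - 1) * ((expcoeff s i * of_real t powr expo s i) * (expcoeff
        s l * of_real (x * t) powr expo s l)))"
    unfolding polylog_expansion_eq[OF t] polylog_expansion_eq[OF \<open>x * t > 0\<close>] by (subst sum_product) (simp
        only: sum_distrib_left)
  thus ?thesis unfolding e .
qed

text \<open>For Re s < 1 the smallest exponent is that of two singular terms, 3s - 2, which explains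
  the bound 2/3.\<close>

lemma Re_Mellin_expo_pos:
  assumes "2 / 3 < Re s" "Re s < 1"
  shows "Re (Mellin_expo s i l) > 0"
proof -
  have "Re (expo s i) \<ge> Re s - 1" for i using assms by (cases i) (auto simp: expo_def)
  from this[of i] this[of l] assms show ?thesis by (simp add: Mellin_expo_def)
qed

text \<open>On this strip the Mellin integral converges and all subtracted powers are integrable at
  0, so the integral can be taken apart term by term.\<close>

lemma Theta_decomposition:
  assumes x: "x > 0" and c: "c > 0" and s: "2 / 3 < Re s" "Re s < 1"
  shows "Gamma s * Theta_series s s s x = Mellin_tail x c s + Mellin_near K x c s + Mellin_main K x c s"
proof -
  let ?P = "lborel_on {0<..c}"
  let ?t = "\<lambda>t i l. expcoeff s i * expcoeff s l * of_real x powr expo s l * of_real t powr (Mellin_expo s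
      i l - 1)"
  have int_Mellin_integrand: "integrable ?P (Mellin_integrand x s)"
    by (rule integrable_lborel_on_subset[OF Theta_Mellin(1)[OF x s(1)]]) auto
  have int_t: "integrable ?P (\<lambda>t. ?t t i l)" for i l
    by (intro integrable_mult_right integral_powr_0 Re_Mellin_expo_pos s c)
  have "Mellin_near K x c s = (\<integral>t. Mellin_integrand x s t - (\<Sum>i<Suc K. \<Sum>l<Suc K. ?t t i l) \<partial>?P)"
    unfolding Mellin_near_def
  proof (rule Bochner_Integration.integral_cong[OF refl])
    fix t assume "t \<in> space ?P"
    hence "t > 0" by (simp add: space_restrict_space)
    from polylog_expansion_product[OF x this] show "Near_integrand K x s t = Mellin_integrand x s t -
        (\<Sum>i<Suc K. \<Sum>l<Suc K. ?t t i l)"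
      by (simp only: Near_integrand_def)
  qed
  also have "\<dots> = integral\<^sup>L ?P (Mellin_integrand x s) - (\<integral>t. (\<Sum>i<Suc K. \<Sum>l<Suc K. ?t t i l) \<partial>?P)"
    by (intro Bochner_Integration.integral_diff int_Mellin_integrand Bochner_Integration.integrable_sum int_t)
  also have "(\<integral>t. (\<Sum>i<Suc K. \<Sum>l<Suc K. ?t t i l) \<partial>?P) = (\<Sum>i<Suc K. \<Sum>l<Suc K. (\<integral>t. ?t t i l \<partial>?P))"
    by (subst Bochner_Integration.integral_sum, intro Bochner_Integration.integrable_sum int_t,
        intro sum.cong refl Bochner_Integration.integral_sum int_t)
  also have "\<dots> = Mellin_main K x c s"
    unfolding Mellin_main_def
    by (intro sum.cong refl, subst integral_mult_right_zero, subst integral_powr_0(2)[OF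
        Re_Mellin_expo_pos[OF s] c]) (rule refl)
  finally have "Mellin_near K x c s + Mellin_main K x c s = integral\<^sup>L ?P (Mellin_integrand x s)" by simp
  moreover have "Gamma s * Theta_series s s s x = integral\<^sup>L ?P (Mellin_integrand x s) + Mellin_tail x c s"
    unfolding Mellin_tail_def Theta_Mellin(2)[OF x s(1), symmetric]
    by (rule lebesgue_integral_lborel_on_split[OF Theta_Mellin(1)[OF x s(1)] c])
  ultimately show ?thesis by simp
qed

lemma compact_bound:
  fixes h :: "'a :: metric_space \<Rightarrow> real"
  assumes "compact S" "continuous_on S h"
  obtains B where "B \<ge> 0" "\<And>s. s \<in> S \<Longrightarrow> h s \<le> B"
proof -
  have "bounded (h ` S)" using assms by (intro compact_imp_bounded compact_continuous_image)
  then obtain B where "\<And>s. s \<in> S \<Longrightarrow> \<bar>h s\<bar> \<le> B" "B > 0" by (auto simp: bounded_pos)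
  thus ?thesis using that[of B] by fastforce
qed

text \<open>With polylogarithms q1 + r1 and q2 + r2, the difference of products is r1 r2 + r1 q2 +
  q1 r2. Each r is O(t^K), each q is O(t^(Re s - 1)), and the prefactor adds another Re s - 1. The
  two bounds on c keep t and x t within the range of the expansion.\<close>

lemma Near_integrand_bound:
  assumes x: "x > 0" and c: "c \<le> 1/2" "x * c \<le> 1/2" and s0: "Re s0 < 1"
  obtains e C where "e > 0" "C \<ge> 0" "\<And>s t. s \<in> ball s0 e \<Longrightarrow> t \<in> {0<..c} \<Longrightarrow>
    norm (Near_integrand K x s t) \<le> C * t powr (2 * Re s - 2 + real K)"
proof -
  obtain e1 C1 where e1: "e1 > 0" "C1 \<ge> 0" and T: "\<And>s. s \<in> ball s0 e1 \<Longrightarrow> Re s < 1"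
    "\<And>s t. s \<in> ball s0 e1 \<Longrightarrow> t \<in> {0<..1/2} \<Longrightarrow> norm (polylog_reg s (of_real t) - zeta_Taylor K s (of_real t))
        \<le> C1 * t ^ K"
    using polylog_reg_Taylor[OF s0, of K] by blast
  obtain d where d: "d > 0" "cball s0 d \<subseteq> {s. Re s < 1}"
    using open_contains_cball[of "{s. Re s < 1}"] open_halfspace_Re_lt[of 1] s0 by blast
  have cont_zeta: "continuous_on (cball s0 d) (\<lambda>s. zeta (s - of_nat k))" for k
  proof (rule continuous_on_compose2[OF holomorphic_on_imp_continuous_on[OF holomorphic_zeta]])
    show "(\<lambda>s. s - of_nat k) ` cball s0 d \<subseteq> {s. Re s < 1}" using d(2) by force
  qed (intro continuous_intros)
  have "(\<lambda>s. Gamma (1 - s)) holomorphic_on {s. Re s < 1}"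
    using Re_pos_imp_notin_nonpos_Ints by (intro holomorphic_intros) auto
  hence cont_Gamma: "continuous_on (cball s0 d) (\<lambda>s. Gamma (1 - s))"
    using holomorphic_on_imp_continuous_on continuous_on_subset d(2) by blast
  obtain B where B: "B \<ge> 0" "\<And>s. s \<in> cball s0 d \<Longrightarrow> norm (Gamma (1 - s)) + (\<Sum>k<K. norm (zeta (s - of_nat
      k))) \<le> B"
    by (rule compact_bound[of "cball s0 d" "\<lambda>s. norm (Gamma (1 - s)) + (\<Sum>k<K. norm (zeta (s - of_nat k)))"])
       (intro compact_cball continuous_intros cont_zeta cont_Gamma | blast)+
  obtain X where X: "X \<ge> 0" "\<And>s. s \<in> cball s0 d \<Longrightarrow> x powr (Re s - 1) \<le> X"
    by (rule compact_bound[of "cball s0 d" "\<lambda>s. x powr (Re s - 1)"])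
       (use x in \<open>(intro compact_cball continuous_intros | auto)+\<close>)
  define e where "e = min e1 d"
  define C where "C = C1 * C1 * x ^ K + C1 * (B * X) + B * (C1 * x ^ K)"
  have e: "e > 0" using e1 d by (simp add: e_def)
  have C: "C \<ge> 0" using e1 B X x by (simp add: C_def)
  have "norm (Near_integrand K x s t) \<le> C * t powr (2 * Re s - 2 + real K)" if s: "s \<in> ball s0 e" and t:
      "t \<in> {0<..c}" for s t
  proof -
    have s1: "s \<in> ball s0 e1" and s2: "s \<in> cball s0 d" using s by (simp_all add: e_def)
    have Re: "Re s < 1" using T(1)[OF s1] .
    have t': "t > 0" "t \<le> c" "t \<le> 1/2" using t c(1) by auto
    have xt: "x * t > 0" "x * t \<le> 1/2"
      using x t' c(2) mult_left_mono[of t c x] by (simp, linarith)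
    define p where "p = t powr (Re s - 1)"
    have p1: "u powr (Re s - 1) \<ge> 1" if "u > 0" "u \<le> 1/2" for u
    proof -
      have "1 powr (Re s - 1) \<le> u powr (Re s - 1)" using that Re by (intro powr_mono2') auto
      thus ?thesis by simp
    qed
    have QB: "norm (polylog_expansion K s u) \<le> B * u powr (Re s - 1)" if u: "u > 0" "u \<le> 1/2" for u
    proof -
      have "norm (zeta_Taylor K s (of_real u)) \<le> (\<Sum>k<K. norm (zeta (s - of_nat k)))"
        unfolding zeta_Taylor_def
      proof (rule order_trans[OF norm_sum sum_mono])
        fix k
        have "u ^ k / fact k \<le> 1 / 1"
          using u by (intro frac_le power_le_one) auto
        hence "norm (zeta (s - of_nat k)) * (u ^ k / fact k) \<le> norm (zeta (s - of_nat k)) * 1"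
          by (intro mult_left_mono) auto
        thus "norm (zeta (s - of_nat k) * (- of_real u) ^ k / fact k) \<le> norm (zeta (s - of_nat k))"
          using u by (simp add: norm_mult norm_divide norm_power)
      qed
      also have "\<dots> \<le> (\<Sum>k<K. norm (zeta (s - of_nat k))) * u powr (Re s - 1)"
        using p1[OF u] mult_left_mono[OF p1[OF u], of "\<Sum>k<K. norm (zeta (s - of_nat k))"] by (simp add:
            sum_nonneg)
      finally have "norm (polylog_expansion K s u) \<le> norm (Gamma (1 - s)) * u powr (Re s - 1) + (\<Sum>k<K.
          norm (zeta (s - of_nat k))) * u powr (Re s - 1)"
        unfolding polylog_expansion_def polylog_sing_def using u
        by (intro order_trans[OF norm_triangle_ineq] add_mono) (auto simp: norm_mult norm_of_real_powr)
      also have "\<dots> \<le> B * u powr (Re s - 1)"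
        unfolding distrib_right [symmetric] using B(2)[OF s2] by (intro mult_right_mono) auto
      finally show ?thesis .
    qed
    define r1 r2 q1 q2 where "r1 = polylog s (of_real t) - polylog_expansion K s t" and "r2 = polylog s
        (of_real (x * t)) - polylog_expansion K s (x * t)"
      and "q1 = polylog_expansion K s t" and "q2 = polylog_expansion K s (x * t)"
    have r1: "norm r1 \<le> C1 * t ^ K"
      using T(2)[OF s1, of t] t' by (simp add: r1_def polylog_expansion_def polylog_reg_def algebra_simps)
    have "norm r2 \<le> C1 * (x * t) ^ K"
      using T(2)[OF s1, of "x * t"] xt by (simp add: r2_def polylog_expansion_def polylog_reg_def
          diff_diff_add)
    hence r2: "norm r2 \<le> C1 * x ^ K * t ^ K" by (simp add: power_mult_distrib)
    have q1: "norm q1 \<le> B * p" unfolding q1_def p_def using t' by (intro QB) auto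
    have "norm q2 \<le> B * (x * t) powr (Re s - 1)" unfolding q2_def using xt by (intro QB) auto
    also have "(x * t) powr (Re s - 1) = x powr (Re s - 1) * p" using x t' by (simp add: p_def powr_mult)
    also have "B * (x powr (Re s - 1) * p) \<le> B * (X * p)"
      using B X(2)[OF s2] by (intro mult_left_mono mult_right_mono) (auto simp: p_def)
    finally have q2: "norm q2 \<le> B * X * p" by simp
    have p: "p \<ge> 1" unfolding p_def using t' by (intro p1) auto
    \<comment> \<open>This lets one error in r1 r2 be estimated like an expansion, so that all three
      products get the same bound.\<close>
    have tK: "t ^ K \<le> p"
      using power_le_one[of t K] t' p by linarith
    have eq: "Near_integrand K x s t = of_real t powr (s - 1) * (r1 * r2 + r1 * q2 + q1 * r2)"
      by (simp add: Near_integrand_def Mellin_integrand_def r1_def r2_def q1_def q2_def algebra_simps)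
    have "norm (r1 * r2 + r1 * q2 + q1 * r2) \<le> norm r1 * norm r2 + norm r1 * norm q2 + norm q1 * norm r2"
      unfolding norm_mult [symmetric] by (intro norm_triangle_le add_mono order_refl)
    also have "\<dots> \<le> (C1 * t ^ K) * (C1 * x ^ K * p) + (C1 * t ^ K) * (B * X * p) + (B * p) * (C1 * x ^ K *
        t ^ K)"
    proof (intro add_mono mult_mono r1 q1 q2 r2)
      have "C1 * x ^ K * t ^ K \<le> C1 * x ^ K * p" using tK e1 x by (intro mult_left_mono) auto
      thus "norm r2 \<le> C1 * x ^ K * p" using r2 by linarith
    qed (use e1 B X x p t' in auto)
    also have "\<dots> = C * (t ^ K * p)" by (simp add: C_def algebra_simps)
    finally have "norm (Near_integrand K x s t) \<le> p * (C * (t ^ K * p))"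
      unfolding eq norm_mult using t' p by (intro mult_mono) (auto simp: norm_of_real_powr p_def)
    also have "p * (C * (t ^ K * p)) = C * t powr (2 * Re s - 2 + real K)"
    proof -
      have "t powr (2 * Re s - 2 + real K) = t powr ((Re s - 1) + (Re s - 1) + real K)" by (simp add:
          algebra_simps)
      also have "\<dots> = p * p * t ^ K" unfolding powr_add p_def using t' by (simp add: powr_realpow)
      finally show ?thesis by (simp add: mult_ac)
    qed
    finally show ?thesis .
  qed
  thus ?thesis using that[OF e C] by blast
qed

lemma borel_measurable_polylog_expansion [measurable]:
  assumes [measurable]: "f \<in> borel_measurable M"
  shows "(\<lambda>t. polylog_expansion K s (f t)) \<in> borel_measurable M"
  unfolding polylog_expansion_def polylog_sing_def zeta_Taylor_def by measurable

lemma open_Near_domain: "open {s. Re s < 1 \<and> 2 * Re s + real K > 1}"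
  unfolding Collect_conj_eq by (intro open_Int open_Collect_less continuous_intros)

lemma holomorphic_Mellin_near:
  assumes x: "x > 0" and c: "c > 0" "c \<le> 1/2" "x * c \<le> 1/2"
  shows "Mellin_near K x c holomorphic_on {s. Re s < 1 \<and> 2 * Re s + real K > 1}"
  unfolding Mellin_near_def [abs_def]
proof (rule holomorphic_on_lebesgue_integral[OF open_Near_domain])
  fix t assume "t \<in> space (lborel_on {0<..c})"
  hence t: "t > 0" by (simp add: space_restrict_space)
  have xt: "x * t > 0" using x t by simp
  show "(\<lambda>s. Near_integrand K x s t) holomorphic_on {s. Re s < 1 \<and> 2 * Re s + real K > 1}"
    unfolding Near_integrand_def
    by (intro holomorphic_intros holomorphic_Mellin_integrand x t holomorphic_on_subset[OF
        holomorphic_polylog_expansion[OF t]]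
          holomorphic_on_subset[OF holomorphic_polylog_expansion[OF xt]]) (use t in auto)
next
  fix s
  have [measurable]: "Mellin_integrand x s \<in> borel_measurable (lborel_on {0<..c})" by (rule
      borel_measurable_Mellin_integrand[OF x]) auto
  show "Near_integrand K x s \<in> borel_measurable (lborel_on {0<..c})"
    unfolding Near_integrand_def [abs_def] by measurable
next
  fix s0 assume "s0 \<in> {s. Re s < 1 \<and> 2 * Re s + real K > 1}"
  hence s0: "Re s0 < 1" "2 * Re s0 + real K > 1" by auto
  obtain e C where e: "e > 0" "C \<ge> 0" and b: "\<And>s t. s \<in> ball s0 e \<Longrightarrow> t \<in> {0<..c} \<Longrightarrow>
    norm (Near_integrand K x s t) \<le> C * t powr (2 * Re s - 2 + real K)"
    using Near_integrand_bound[OF x c(2,3) s0(1), of K] by blast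
  \<comment> \<open>A quarter of the margin: at Re s0 - d the exponent equals 2d - 1, still above
    -1.\<close>
  define d where "d = (2 * Re s0 + real K - 1) / 4"
  have d: "d > 0" "4 * d = 2 * Re s0 + real K - 1" using s0 by (simp_all add: d_def)
  define r where "r = 2 * (Re s0 - d) - 2 + real K"
  have r: "r > -1" unfolding r_def using d by argo
  have "norm (Near_integrand K x s t) \<le> C * t powr r" if s: "s \<in> ball s0 (min e d)" and t: "t \<in> space
      (lborel_on {0<..c})" for s t
  proof -
    have t': "t \<in> {0<..c}" using t by (simp add: space_restrict_space)
    have "\<bar>Re s0 - Re s\<bar> < d" using s abs_Re_le_cmod[of "s0 - s"] by (simp add: dist_norm)
    hence "Re s0 - d < Re s" by (simp add: abs_less_iff)
    hence "r \<le> 2 * Re s - 2 + real K" by (simp add: r_def)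
    hence "t powr (2 * Re s - 2 + real K) \<le> t powr r" using t' c by (intro powr_mono') auto
    hence "C * t powr (2 * Re s - 2 + real K) \<le> C * t powr r" using e by (intro mult_left_mono)
    moreover have "norm (Near_integrand K x s t) \<le> C * t powr (2 * Re s - 2 + real K)" using s by (intro b
        t') auto
    ultimately show ?thesis by linarith
  qed
  moreover have "integrable (lborel_on {0<..c}) (\<lambda>t. C * t powr r)"
    by (intro integrable_mult_right integrable_powr_0 r c)
  moreover have "min e d > 0" using e d by simp
  ultimately show "\<exists>e>0. \<exists>D. integrable (lborel_on {0<..c}) D \<and>
     (\<forall>s\<in>ball s0 e. \<forall>t\<in>space (lborel_on {0<..c}). norm (Near_integrand K x s t) \<le> D t)" by blast
qed

section \<open>The continuation of the diagonal function to a strip\<close>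

definition Theta_cont :: "nat \<Rightarrow> real \<Rightarrow> real \<Rightarrow> complex \<Rightarrow> complex" where
  "Theta_cont K x c s = rGamma s * (Mellin_tail x c s + Mellin_near K x c s + Mellin_main K x c s)"

lemma Theta_cont_eq:
  assumes "x > 0" "c > 0" "2 / 3 < Re s" "Re s < 1"
  shows "Theta_cont K x c s = Theta_series s s s x"
proof -
  have "rGamma s * Gamma s = 1"
    using assms by (subst rGamma_inverse_Gamma) (auto simp: Gamma_eq_zero_iff Re_pos_imp_notin_nonpos_Ints)
  thus ?thesis unfolding Theta_cont_def Theta_decomposition[OF assms, symmetric] by (simp flip: mult.assoc)
qed

lemma meromorphic_Theta_cont:
  assumes x: "x > 0" and c: "c > 0" "c \<le> 1/2" "x * c \<le> 1/2"
  shows "Theta_cont K x c meromorphic_on {s. Re s < 1 \<and> 2 * Re s + real K > 1}"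
proof -
  let ?U = "{s. Re s < 1 \<and> 2 * Re s + real K > 1}"
  have mero: "f meromorphic_on ?U" if "f holomorphic_on ?U" for f
    using that by (intro analytic_on_imp_meromorphic_on) (simp add: analytic_on_open open_Near_domain)
  have expcoeff: "(\<lambda>s. expcoeff s i) meromorphic_on ?U" for i
    by (intro mero holomorphic_on_subset[OF holomorphic_expcoeff]) auto
  have "(\<lambda>s. expcoeff s i * expcoeff s l * of_real x powr expo s l * (of_real c powr Mellin_expo s i l /
      Mellin_expo s i l)) meromorphic_on ?U" for i l
    by (intro meromorphic_on_mult meromorphic_on_divide expcoeff; intro mero holomorphic_intros
        holomorphic_expo holomorphic_Mellin_expo)
       (use x c in auto)
  hence "Mellin_main K x c meromorphic_on ?U"
    unfolding Mellin_main_def [abs_def] by (intro meromorphic_on_sum)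
  moreover have "Mellin_tail x c meromorphic_on ?U"
    by (intro mero holomorphic_on_subset[OF holomorphic_Mellin_tail]) (use x c in auto)
  moreover have "Mellin_near K x c meromorphic_on ?U" by (intro mero holomorphic_Mellin_near x c)
  moreover have "rGamma meromorphic_on ?U" by (intro mero holomorphic_intros)
  ultimately show ?thesis unfolding Theta_cont_def [abs_def] by (intro meromorphic_intros)
qed

subsection \<open>Gluing meromorphic functions\<close>

text \<open>The identity theorem for meromorphic functions. Agreement is stated on punctured
  neighbourhoods because the values at poles are arbitrary.\<close>

lemma meromorphic_eq_eventually:
  assumes f: "f meromorphic_on V" and g: "g meromorphic_on V" and V: "open V" "connected V"
    and z: "z \<in> V" and ev: "\<forall>\<^sub>F s in at z. f s = g s" and w: "w \<in> V"
  shows "\<forall>\<^sub>F s in at w. f s = g s"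
proof -
  let ?D = "\<lambda>s. f s - g s"
  have mero: "?D meromorphic_on V" using f g by (intro meromorphic_intros)
  have iso: "isolated_singularity_at ?D u" if "u \<in> V" for u
    by (rule meromorphic_on_isolated_singularity[OF meromorphic_on_subset[OF mero]]) (use that in auto)
  have "\<forall>\<^sub>F s in at z. remove_sings ?D s = 0"
    using eventually_remove_sings_eq_at[OF iso[OF z]] ev by eventually_elim simp
  hence "\<exists>\<^sub>F s in at z. remove_sings ?D s = 0" by (intro eventually_frequently) auto
  hence zero: "remove_sings ?D u = 0" if "u \<in> V" for u
    using frequently_eq_meromorphic_imp_constant[OF _ remove_sings_nicely_meromorphic[OF mero] V z that]
        by blast
  have "\<forall>\<^sub>F s in at w. s \<in> V" by (rule eventually_at_in_open'[OF V(1) w])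
  with eventually_remove_sings_eq_at[OF iso[OF w]] show ?thesis
    by eventually_elim (use zero in auto)
qed

text \<open>All f n coincide far to the right, hence, up to isolated points, on common half-planes.
  After \<open>remove_sings\<close> the value at s no longer depends on the index, so any admissible
  one may be chosen.\<close>

lemma meromorphic_glue:
  fixes f :: "nat \<Rightarrow> complex \<Rightarrow> complex"
  assumes mero: "\<And>n. f n meromorphic_on {s. Re s > - real n}"
    and eq: "\<And>n s. Re s > a \<Longrightarrow> f n s = g s" and a: "a \<ge> 0"
  obtains F where "F nicely_meromorphic_on UNIV" "\<And>n w. Re w > - real n \<Longrightarrow> \<forall>\<^sub>F s in at w. F s = f n s"
proof -
  have agree: "\<forall>\<^sub>F s in at w. f m s = f n s" if w: "Re w > - real m" "Re w > - real n" for m n w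
  proof (rule meromorphic_eq_eventually)
    let ?V = "{s. Re s > - real (min m n)}"
    show "f m meromorphic_on ?V" "f n meromorphic_on ?V"
      by (auto intro!: meromorphic_on_subset[OF mero])
    show "open ?V" by (rule open_halfspace_Re_gt)
    show "connected ?V" by (intro convex_connected convex_halfspace_Re_gt)
    show "complex_of_real (a + 1) \<in> ?V" using a by auto
    have "\<forall>\<^sub>F s in at (complex_of_real (a + 1)). s \<in> {s. Re s > a}"
      by (intro eventually_at_in_open' open_halfspace_Re_gt) auto
    thus "\<forall>\<^sub>F s in at (complex_of_real (a + 1)). f m s = f n s"
      by (rule eventually_mono) (simp add: eq)
    show "w \<in> ?V" using w by (simp add: min_def)
  qed
  \<comment> \<open>An index whose half-plane contains s.\<close>
  define N where "N s = nat \<lceil>\<bar>Re s\<bar>\<rceil> + 1" for s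
  have N: "Re s > - real (N s)" for s unfolding N_def by linarith
  define F where "F s = remove_sings (f (N s)) s" for s
  have F_eq: "F s = remove_sings (f n) s" if "Re s > - real n" for n s
    unfolding F_def by (rule remove_sings_cong[OF agree[OF N that] refl])
  have F_ev: "\<forall>\<^sub>F s in at w. F s = remove_sings (f n) s" if "Re w > - real n" for n w
  proof -
    have "\<forall>\<^sub>F s in at w. s \<in> {s. Re s > - real n}"
      by (rule eventually_at_in_open'[OF open_halfspace_Re_gt]) (use that in auto)
    thus ?thesis by (rule eventually_mono) (simp add: F_eq)
  qed
  show ?thesis
  proof (rule that)
    fix n w assume w: "Re w > - real n"
    have "isolated_singularity_at (f n) w"
      by (rule meromorphic_on_isolated_singularity[OF meromorphic_on_subset[OF mero]]) (use w in auto)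
    from eventually_remove_sings_eq_at[OF this] F_ev[OF w]
    show "\<forall>\<^sub>F s in at w. F s = f n s" by eventually_elim simp
  next
    show "F nicely_meromorphic_on UNIV"
      unfolding nicely_meromorphic_on_def
    proof (intro conjI ballI)
      have nice: "remove_sings (f n) nicely_meromorphic_on {s. Re s > - real n}" for n
        by (rule remove_sings_nicely_meromorphic[OF mero])
      have "F meromorphic_on {w}" for w
      proof -
        have "remove_sings (f (N w)) meromorphic_on {w}"
          using nice[of "N w"] N[of w] by (auto simp: nicely_meromorphic_on_def intro: meromorphic_on_subset)
        thus ?thesis using F_ev[OF N[of w]] by (subst meromorphic_on_cong[OF _ refl]) auto
      qed
      thus "F meromorphic_on UNIV" by (subst meromorphic_on_meromorphic_at) blast
      fix w
      let ?G = "remove_sings (f (N w))"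
      have "is_pole ?G w \<and> ?G w = 0 \<or> ?G \<midarrow>w\<rightarrow> ?G w"
        using nice[of "N w"] N[of w] by (auto simp: nicely_meromorphic_on_def)
      moreover have "is_pole F w \<longleftrightarrow> is_pole ?G w" by (rule is_pole_cong[OF F_ev[OF N] refl])
      moreover have "(F \<longlongrightarrow> l) (at w) \<longleftrightarrow> (?G \<longlongrightarrow> l) (at w)" for l by (rule tendsto_cong[OF F_ev[OF N]])
      moreover have "F w = ?G w" by (rule F_eq[OF N])
      ultimately show "is_pole F w \<and> F w = 0 \<or> F \<midarrow>w\<rightarrow> F w" by simp
    qed
  qed
qed

text \<open>For t up to this cut both t and x t lie in (0,1/2], where the expansion is
  controlled.\<close>

definition Mellin_cut :: "real \<Rightarrow> real" where "Mellin_cut x = min (1/2) (1 / (2 * x))"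

lemma Mellin_cut_bounds:
  assumes "x > 0"
  shows "Mellin_cut x > 0" "Mellin_cut x \<le> 1/2" "x * Mellin_cut x \<le> 1/2"
proof -
  show "Mellin_cut x > 0" "Mellin_cut x \<le> 1/2" using assms by (auto simp: Mellin_cut_def)
  have "x * Mellin_cut x \<le> x * (1 / (2 * x))" using assms by (intro mult_left_mono) (auto simp:
      Mellin_cut_def)
  thus "x * Mellin_cut x \<le> 1/2" using assms by simp
qed

lemma holomorphic_tendsto:
  assumes "f holomorphic_on S" "open S" "z \<in> S"
  shows "(f \<longlongrightarrow> f z) (at z)"
  using holomorphic_on_imp_continuous_on[OF assms(1)] assms(2,3)
  by (auto simp: continuous_on_eq_continuous_at intro: isContD)

lemma Theta_diag_eventually:
  assumes x: "x > 0" and w: "Re w > - real n" "Re w < 1"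
  shows "\<forall>\<^sub>F s in at w. Theta_diag x s = Theta_cont (2 * n + 1) x (Mellin_cut x) s"
proof -
  \<comment> \<open>With K = 2n + 1 the condition 2 Re s + K > 1 reads Re s > -n. The strip of
    \<open>Theta_cont\<close> and the half-plane of the series then overlap in 2/3 < Re s < 1 and
    together cover Re s > -n.\<close>
  define f where "f n s = (if Re s > 2/3 then Theta_series s s s x else Theta_cont (2 * n + 1) x
      (Mellin_cut x) s)" for n s
  have f_eq: "f n s = Theta_cont (2 * n + 1) x (Mellin_cut x) s" if "Re s < 1" for n s
    using that Theta_cont_eq[OF x Mellin_cut_bounds(1)[OF x], of s "2 * n + 1"] by (simp add: f_def)
  have mero: "f n meromorphic_on {s. Re s > - real n}" for n
  proof -
    let ?U = "{s. Re s < 1 \<and> 2 * Re s + real (2 * n + 1) > 1}"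
    have "(\<lambda>s. Theta_series s s s x) meromorphic_on {s. Re s > 2/3}"
      using holomorphic_Theta_series[OF x]
      by (intro analytic_on_imp_meromorphic_on) (subst analytic_on_open[OF open_halfspace_Re_gt])
    hence 1: "f n meromorphic_on {s. Re s > 2/3}"
      by (subst meromorphic_on_open_cong[OF open_halfspace_Re_gt, of _ _ "\<lambda>s. Theta_series s s s x"])
          (auto simp: f_def)
    have 2: "f n meromorphic_on ?U"
      by (subst meromorphic_on_open_cong[OF open_Near_domain, of _ _ "Theta_cont (2 * n + 1) x (Mellin_cut
          x)"])
         (use f_eq meromorphic_Theta_cont[OF x Mellin_cut_bounds[OF x], of "2 * n + 1"] in auto)
    have "f n meromorphic_on ({s. Re s > 2/3} \<union> ?U)" using 1 2 by (rule meromorphic_on_Un)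
    thus ?thesis by (rule meromorphic_on_subset) auto
  qed
  obtain F where F: "F nicely_meromorphic_on UNIV" "\<And>n w. Re w > - real n \<Longrightarrow> \<forall>\<^sub>F s in at w. F s = f n s"
    by (rule meromorphic_glue[OF mero, of "2/3" "\<lambda>s. Theta_series s s s x"]) (auto simp: f_def)
  have "Theta_diag x = F"
    unfolding Theta_diag_def
  proof (rule meromorphic_continuation_unique[OF F(1)])
    show "2 islimpt {s. Re s > 2/3}"
      by (rule interior_limit_point) (simp only: interior_open[OF open_halfspace_Re_gt], simp)
    fix s assume s: "s \<in> {s. Re s > 2/3}"
    have "\<forall>\<^sub>F z in at s. z \<in> {s. Re s > 2/3}"
      by (rule eventually_at_in_open'[OF open_halfspace_Re_gt s])
    moreover have "\<forall>\<^sub>F z in at s. F z = f 0 z" using s by (intro F(2)) auto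
    ultimately have ev: "\<forall>\<^sub>F z in at s. F z = Theta_series z z z x"
      by eventually_elim (simp add: f_def)
    \<comment> \<open>Gluing gives agreement only on punctured neighbourhoods; continuity of the
      series fixes the value of F at the point itself, as uniqueness of the continuation
      requires.\<close>
    have "((\<lambda>s. Theta_series s s s x) \<longlongrightarrow> Theta_series s s s x) (at s)"
      by (rule holomorphic_tendsto[OF holomorphic_Theta_series[OF x] open_halfspace_Re_gt s])
    hence lim: "(F \<longlongrightarrow> Theta_series s s s x) (at s)" using tendsto_cong[OF ev] by blast
    hence "\<not> is_pole F s"
      using not_tendsto_and_filterlim_at_infinity[of "at s" F] by (auto simp: is_pole_def)
    hence "F \<midarrow>s\<rightarrow> F s" using F(1) by (auto simp: nicely_meromorphic_on_def)
    thus "F s = Theta_series s s s x" using lim LIM_unique by blast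
  qed
  hence "\<forall>\<^sub>F s in at w. Theta_diag x s = f n s" using F(2)[OF w(1)] by simp
  moreover have "\<forall>\<^sub>F s in at w. s \<in> {s. Re s < 1}"
    by (rule eventually_at_in_open'[OF open_halfspace_Re_lt]) (use w in auto)
  ultimately show ?thesis by eventually_elim (simp add: f_eq)
qed

subsection \<open>The limit at a non-positive integer\<close>

lemma rGamma_div_tendsto:
  "((\<lambda>s. rGamma s / (s + of_nat j)) \<longlongrightarrow> (- 1) ^ j * fact j) (at (- of_nat j :: complex))"
proof -
  have "(rGamma has_field_derivative (- 1) ^ j * fact j) (at (- of_nat j :: complex))"
    by (rule has_field_derivative_rGamma_nonpos_int)
  thus ?thesis by (simp add: has_field_derivative_iff)
qed

lemma rGamma_tendsto_0: "(rGamma \<longlongrightarrow> 0) (at (- of_nat j :: complex))"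
proof -
  have "rGamma holomorphic_on UNIV" by (intro holomorphic_intros)
  from holomorphic_tendsto[OF this open_UNIV UNIV_I, of "- of_nat j"]
  show ?thesis by simp
qed

text \<open>The coefficient of \<open>s\<close> in \<open>Mellin_expo s i l\<close>.\<close>

definition slope :: "nat \<Rightarrow> nat \<Rightarrow> complex" where
  "slope i l = 1 + (if i = 0 then 1 else 0) + (if l = 0 then 1 else 0)"

lemma slope_nonzero: "slope i l \<noteq> 0"
  by (auto simp: slope_def)

lemma Mellin_expo_slope: "Mellin_expo (- of_nat j) i l = 0 \<Longrightarrow> Mellin_expo s i l = slope i l * (s + of_nat j)"
  by (cases i; cases l) (auto simp: Mellin_expo_def expo_def slope_def algebra_simps)

text \<open>The limit contribution of a pair with q = 0 at -j: q is \<open>slope\<close> times (s +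
  j), and \<open>rGamma\<close> s / (s + j) tends to (-1)^j j!. Since c^q is then 1, the cut leaves
  no trace.\<close>

definition limterm :: "nat \<Rightarrow> real \<Rightarrow> nat \<Rightarrow> nat \<Rightarrow> complex" where
  "limterm j x i l = (if Mellin_expo (- of_nat j) i l = 0
     then expcoeff (- of_nat j) i * expcoeff (- of_nat j) l * of_real x powr expo (- of_nat j) l * ((- 1)
         ^ j * fact j / slope i l) else 0)"

lemma Mellin_main_summand_tendsto:
  assumes x: "x > 0" and c: "c > 0"
  shows "((\<lambda>s. rGamma s * (expcoeff s i * expcoeff s l * of_real x powr expo s l * (of_real c powr
      Mellin_expo s i l / Mellin_expo s i l)))
           \<longlongrightarrow> limterm j x i l) (at (- of_nat j))"
proof -
  let ?z = "- of_nat j :: complex"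
  let ?U = "{s. Re s < 1}"
  have z: "?z \<in> ?U" by simp
  define A where "A s = expcoeff s i * expcoeff s l * of_real x powr expo s l * of_real c powr Mellin_expo
      s i l" for s
  have "A holomorphic_on ?U"
    unfolding A_def using x c by (intro holomorphic_intros holomorphic_expcoeff holomorphic_expo
        holomorphic_Mellin_expo) auto
  hence A: "(A \<longlongrightarrow> A ?z) (at ?z)" by (rule holomorphic_tendsto[OF _ open_halfspace_Re_lt z])
  show ?thesis
  proof (cases "Mellin_expo ?z i l = 0")
    case True
    have eq: "rGamma s * (expcoeff s i * expcoeff s l * of_real x powr expo s l * (of_real c powr
        Mellin_expo s i l / Mellin_expo s i l))
        = A s * (rGamma s / (s + of_nat j) / slope i l)" for s
      unfolding A_def Mellin_expo_slope[OF True, of s] by (simp add: divide_inverse mult_ac)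
    have "((\<lambda>s. A s * (rGamma s / (s + of_nat j) / slope i l)) \<longlongrightarrow> A ?z * ((- 1) ^ j * fact j / slope i l))
        (at ?z)"
      by (intro tendsto_mult A tendsto_divide rGamma_div_tendsto tendsto_const slope_nonzero)
    moreover have "A ?z * ((- 1) ^ j * fact j / slope i l) = limterm j x i l"
      using c by (simp add: limterm_def A_def True)
    ultimately show ?thesis unfolding eq by simp
  next
    case False
    have "((\<lambda>s. Mellin_expo s i l) \<longlongrightarrow> Mellin_expo ?z i l) (at ?z)"
      by (rule holomorphic_tendsto[OF holomorphic_Mellin_expo open_UNIV UNIV_I])
    hence "((\<lambda>s. rGamma s * (A s / Mellin_expo s i l)) \<longlongrightarrow> 0 * (A ?z / Mellin_expo ?z i l)) (at ?z)"
      by (intro tendsto_mult tendsto_divide A rGamma_tendsto_0 False)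
    thus ?thesis using False by (simp add: limterm_def A_def)
  qed
qed

lemma Theta_cont_tendsto:
  assumes x: "x > 0" and c: "c > 0" "c \<le> 1/2" "x * c \<le> 1/2" and K: "2 * j + 1 < K"
  shows "(Theta_cont K x c \<longlongrightarrow> (\<Sum>i<Suc K. \<Sum>l<Suc K. limterm j x i l)) (at (- of_nat j))"
proof -
  let ?z = "- of_nat j :: complex"
  let ?U = "{s. Re s < 1 \<and> 2 * Re s + real K > 1}"
  \<comment> \<open>At s = -j the convergence condition 2 Re s + K > 1 is K > 2j + 1.\<close>
  have z: "?z \<in> ?U" using K by auto
  have "Mellin_tail x c holomorphic_on ?U" using x c by (intro holomorphic_on_subset[OF
      holomorphic_Mellin_tail]) auto
  hence "((\<lambda>s. rGamma s * (Mellin_tail x c s + Mellin_near K x c s)) \<longlongrightarrow> 0 * (Mellin_tail x c ?z +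
      Mellin_near K x c ?z)) (at ?z)"
    using holomorphic_Mellin_near[OF x c, of K]
    by (intro tendsto_mult tendsto_add rGamma_tendsto_0 holomorphic_tendsto[OF _ open_Near_domain z])
  moreover have "((\<lambda>s. \<Sum>i<Suc K. \<Sum>l<Suc K. rGamma s * (expcoeff s i * expcoeff s l * of_real x powr expo s
      l * (of_real c powr Mellin_expo s i l / Mellin_expo s i l)))
      \<longlongrightarrow> (\<Sum>i<Suc K. \<Sum>l<Suc K. limterm j x i l)) (at ?z)"
    by (intro tendsto_sum Mellin_main_summand_tendsto x c)
  ultimately have "((\<lambda>s. rGamma s * (Mellin_tail x c s + Mellin_near K x c s) +
      (\<Sum>i<Suc K. \<Sum>l<Suc K. rGamma s * (expcoeff s i * expcoeff s l * of_real x powr expo s l * (of_real c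
          powr Mellin_expo s i l / Mellin_expo s i l))))
      \<longlongrightarrow> 0 * (Mellin_tail x c ?z + Mellin_near K x c ?z) + (\<Sum>i<Suc K. \<Sum>l<Suc K. limterm j x i l)) (at ?z)"
    by (rule tendsto_add)
  moreover have "rGamma s * (Mellin_tail x c s + Mellin_near K x c s) +
      (\<Sum>i<Suc K. \<Sum>l<Suc K. rGamma s * (expcoeff s i * expcoeff s l * of_real x powr expo s l * (of_real c
          powr Mellin_expo s i l / Mellin_expo s i l)))
      = Theta_cont K x c s" for s
    unfolding Theta_cont_def Mellin_main_def distrib_left sum_distrib_left ..
  ultimately show ?thesis by (simp only: mult_zero_left add_0)
qed

text \<open>The coefficient shared by the two mixed products of the singular term with the power
  t^(2j+1); they differ only in the power of x. The minus sign is (-1)^(2j+1) from the Taylor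
  coefficient.\<close>

definition edge_value :: "nat \<Rightarrow> complex" where
  "edge_value j = - ((- 1) ^ j * (fact j)\<^sup>2 / (2 * fact (2 * j + 1))) * zeta (- 3 * of_nat j - 1)"

lemma limterm_0_0: "limterm j x 0 0 = 0"
proof -
  have "Mellin_expo (- of_nat j) 0 0 = - of_nat (3 * j + 2)" by (simp add: Mellin_expo_def expo_def)
  hence "Mellin_expo (- of_nat j) 0 0 \<noteq> 0" by (metis neg_equal_0_iff_equal of_nat_eq_0_iff add_is_0
      zero_neq_numeral)
  thus ?thesis by (simp add: limterm_def)
qed

lemma expcoeff_edge:
  "expcoeff (- of_nat j) 0 * expcoeff (- of_nat j) (Suc (2 * j + 1)) * ((- 1) ^ j * fact j / 2) =
      edge_value j"
proof -
  have 1: "Gamma (1 - (- of_nat j)) = (fact j :: complex)" using Gamma_fact[of j, where ?'a = complex] by simp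
  have 2: "- of_nat j - of_nat (2 * j + 1) = (- 3 * of_nat j - 1 :: complex)" by simp
  have 3: "(- 1 :: complex) ^ (2 * j + 1) = - 1" by simp
  have alg: "f * (z * (- 1) / g) * (e * f / 2) = - (e * f\<^sup>2 / (2 * g)) * z" for e f g z :: complex
    by (simp add: power2_eq_square mult_ac)
  show ?thesis unfolding expcoeff_def edge_value_def nat.case 1 2 3 by (rule alg)
qed

lemma limterm_0_Suc:
  "limterm j x 0 (Suc k) = (if k = 2 * j + 1 then edge_value j * of_real x powr of_nat (2 * j + 1) else 0)"
proof -
  have q: "Mellin_expo (- of_nat j) 0 (Suc k) = of_nat k - of_nat (2 * j + 1)" by (simp add:
      Mellin_expo_def expo_def)
  have "Mellin_expo (- of_nat j) 0 (Suc k) = 0 \<longleftrightarrow> k = 2 * j + 1"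
    unfolding q right_minus_eq of_nat_eq_iff ..
  moreover have "slope 0 (Suc k) = 2" by (simp add: slope_def)
  ultimately show ?thesis
    unfolding limterm_def using expcoeff_edge[of j] by (auto simp: expo_def mult_ac)
qed

lemma limterm_Suc_0:
  "limterm j x (Suc k) 0 = (if k = 2 * j + 1 then edge_value j * of_real x powr (- of_nat j - 1) else 0)"
proof -
  have q: "Mellin_expo (- of_nat j) (Suc k) 0 = of_nat k - of_nat (2 * j + 1)" by (simp add:
      Mellin_expo_def expo_def)
  have "Mellin_expo (- of_nat j) (Suc k) 0 = 0 \<longleftrightarrow> k = 2 * j + 1"
    unfolding q right_minus_eq of_nat_eq_iff ..
  moreover have "slope (Suc k) 0 = 2" by (simp add: slope_def)
  ultimately show ?thesis
    unfolding limterm_def using expcoeff_edge[of j] by (auto simp: expo_def mult_ac)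
qed

text \<open>Here q = k + l - j at s = -j. For l = j - k the signs combine to (-1)^(k+l+j) =
  (-1)^(2j) = 1, and j!/(k! l!) is the binomial coefficient.\<close>

lemma limterm_Suc_Suc:
  assumes x: "x > 0"
  shows "limterm j x (Suc k) (Suc l) = (if l = j - k \<and> k \<le> j then
     of_nat (j choose k) * of_real (x ^ (j - k)) * zeta (- of_nat j - of_nat k) * zeta (- 2 * of_nat j +
         of_nat k) else 0)"
proof -
  have q: "Mellin_expo (- of_nat j) (Suc k) (Suc l) = of_nat (k + l) - of_nat j" by (simp add:
      Mellin_expo_def expo_def)
  have iff: "Mellin_expo (- of_nat j) (Suc k) (Suc l) = 0 \<longleftrightarrow> l = j - k \<and> k \<le> j"
    unfolding q right_minus_eq of_nat_eq_iff by auto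
  show ?thesis
  proof (cases "l = j - k \<and> k \<le> j")
    case True
    hence l: "l = j - k" and k: "k \<le> j" by auto
    have z: "- of_nat j - of_nat l = (- 2 * of_nat j + of_nat k :: complex)"
      unfolding l using k by (simp add: of_nat_diff)
    have klj: "k + (l + j) = 2 * j" using l k by simp
    have sgn: "(- 1) ^ k * ((- 1) ^ l * (- 1) ^ j) = (1 :: complex)"
      unfolding power_add [symmetric] klj by simp
    have "limterm j x (Suc k) (Suc l) = zeta (- of_nat j - of_nat k) * (- 1) ^ k / fact k *
       (zeta (- of_nat j - of_nat l) * (- 1) ^ l / fact l) * of_real x powr of_nat l * ((- 1) ^ j * fact j)"
      unfolding limterm_def using True iff by (simp add: expcoeff_def expo_def slope_def)
    also have "of_real x powr of_nat l = complex_of_real (x ^ l)"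
      using x by (simp add: powr_nat')
    also have "zeta (- of_nat j - of_nat k) * (- 1) ^ k / fact k *
       (zeta (- of_nat j - of_nat l) * (- 1) ^ l / fact l) * of_real (x ^ l) * ((- 1) ^ j * fact j)
       = ((- 1) ^ k * ((- 1) ^ l * (- 1) ^ j)) * (fact j / (fact k * fact l)) * of_real (x ^ l)
          * zeta (- of_nat j - of_nat k) * zeta (- of_nat j - of_nat l)"
      by (simp add: divide_inverse mult_ac)
    also have "\<dots> = of_nat (j choose k) * of_real (x ^ l) * zeta (- of_nat j - of_nat k) * zeta (- 2 *
        of_nat j + of_nat k)"
      unfolding sgn z binomial_fact[OF k] by (simp add: l)
    finally show ?thesis using True by simp
  next
    case False
    thus ?thesis unfolding limterm_def iff by auto
  qed
qed

lemma sum_limterm: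
  assumes x: "x > 0" and K: "2 * j + 1 < K"
  shows "(\<Sum>i<Suc K. \<Sum>l<Suc K. limterm j x i l)
    = edge_value j * (of_real x powr of_nat (2 * j + 1) + of_real x powr (- of_nat j - 1))
      + (\<Sum>k\<le>j. of_nat (j choose k) * of_real (x ^ (j - k)) * zeta (- of_nat j - of_nat k) * zeta (- 2 *
          of_nat j + of_nat k))"
proof -
  let ?g = "\<lambda>k. of_nat (j choose k) * of_real (x ^ (j - k)) * zeta (- of_nat j - of_nat k) * zeta (- 2 *
      of_nat j + of_nat k)"
  have "(\<Sum>i<Suc K. \<Sum>l<Suc K. limterm j x i l)
     = (\<Sum>l<K. limterm j x 0 (Suc l)) + ((\<Sum>k<K. limterm j x (Suc k) 0) + (\<Sum>k<K. \<Sum>l<K. limterm j x (Suc k)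
         (Suc l)))"
    unfolding sum.lessThan_Suc_shift sum.distrib by (simp add: limterm_0_0)
  also have "(\<Sum>l<K. limterm j x 0 (Suc l)) = edge_value j * of_real x powr of_nat (2 * j + 1)"
    unfolding limterm_0_Suc using K by (subst sum.delta) auto
  also have "(\<Sum>k<K. limterm j x (Suc k) 0) = edge_value j * of_real x powr (- of_nat j - 1)"
    unfolding limterm_Suc_0 using K by (subst sum.delta) auto
  also have "(\<Sum>k<K. \<Sum>l<K. limterm j x (Suc k) (Suc l)) = (\<Sum>k<K. if k \<le> j then ?g k else 0)"
  proof (rule sum.cong[OF refl])
    fix k
    have "(\<Sum>l<K. limterm j x (Suc k) (Suc l)) = (\<Sum>l<K. if l = j - k then (if k \<le> j then ?g k else 0) else 0)"
      unfolding limterm_Suc_Suc[OF x] by (intro sum.cong) auto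
    also have "\<dots> = (if k \<le> j then ?g k else 0)" using K by (subst sum.delta) auto
    finally show "(\<Sum>l<K. limterm j x (Suc k) (Suc l)) = (if k \<le> j then ?g k else 0)" .
  qed
  also have "\<dots> = (\<Sum>k\<le>j. ?g k)"
    using K by (intro sum.mono_neutral_cong_right) auto
  finally show ?thesis by (simp add: algebra_simps)
qed

lemma Theta_diag_tendsto:
  assumes x: "x > 0"
  shows "Theta_diag x \<midarrow>(- of_nat j)\<rightarrow>
      edge_value j * (of_real x powr of_nat (2 * j + 1) + of_real x powr (- of_nat j - 1))
      + (\<Sum>k\<le>j. of_nat (j choose k) * of_real (x ^ (j - k)) * zeta (- of_nat j - of_nat k) * zeta (- 2 *
          of_nat j + of_nat k))"
proof -
  \<comment> \<open>This is 2n + 1 with n = j + 1, so that -j lies strictly to the right of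
    -n.\<close>
  let ?K = "2 * (j + 1) + 1"
  have K: "2 * j + 1 < ?K" by simp
  have "\<forall>\<^sub>F s in at (- of_nat j). Theta_diag x s = Theta_cont ?K x (Mellin_cut x) s"
    by (rule Theta_diag_eventually[OF x]) auto
  thus ?thesis
    using Theta_cont_tendsto[OF x Mellin_cut_bounds[OF x] K] tendsto_cong unfolding sum_limterm[OF x K] by
        blast
qed

theorem theorem4p1:
  fixes x :: real and j :: nat
  assumes "x > 0"
  shows "(odd j \<longrightarrow> Theta_diag x \<midarrow>(- of_nat j)\<rightarrow> 0) \<and>
    (even j \<longrightarrow> Theta_diag x \<midarrow>(- of_nat j)\<rightarrow>
           - ((fact j)\<^sup>2 / (2 * fact (2 * j + 1)))
               * of_real (x powi (2 * int j + 1) + x powi (- int j - 1))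
               * zeta (- 3 * of_nat j - 1)
           + (\<Sum>k\<le>j. of_nat (j choose k) * of_real (x ^ (j - k))
                 * zeta (- of_nat j - of_nat k) * zeta (- 2 * of_nat j + of_nat k)))"
proof (intro conjI impI)
  let ?g = "\<lambda>k. of_nat (j choose k) * of_real (x ^ (j - k)) * zeta (- of_nat j - of_nat k) * zeta (- 2 *
      of_nat j + of_nat k)"
  assume j: "odd j"
  \<comment> \<open>For odd j the number 3j + 1 is even and positive.\<close>
  have "- 3 * of_nat j - 1 = - complex_of_nat (3 * j + 1)" by simp
  moreover have "zeta (- of_nat (3 * j + 1)) = 0" using j by (intro zeta_trivial_zero) auto
  ultimately have "edge_value j = 0" by (simp only: edge_value_def mult_zero_right)
  \<comment> \<open>One zeta factor always sits at a trivial zero: the one at -(2j - k) when k is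
    even, the one at -(j + k) when k is odd.\<close>
  moreover have "?g k = 0" if "k \<le> j" for k
  proof (cases "even k")
    case True
    have e: "- 2 * of_nat j + of_nat k = - complex_of_nat (2 * j - k)" using that by (simp add: of_nat_diff)
    have "2 * j - k > 0" using that odd_pos[OF j] by linarith
    moreover have "even (2 * j - k)" using True that by simp
    ultimately have "zeta (- of_nat (2 * j - k)) = 0" by (intro zeta_trivial_zero)
    thus ?thesis by (simp only: e mult_zero_right)
  next
    case False
    have "- of_nat j - of_nat k = - complex_of_nat (j + k)" by simp
    moreover have "zeta (- of_nat (j + k)) = 0" using j False by (intro zeta_trivial_zero) (auto intro:
        odd_pos)
    ultimately show ?thesis by (simp only: mult_zero_right mult_zero_left)
  qed
  hence "(\<Sum>k\<le>j. ?g k) = 0" by (intro sum.neutral) auto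
  ultimately show "Theta_diag x \<midarrow>(- of_nat j)\<rightarrow> 0"
    using Theta_diag_tendsto[OF assms, of j] by (simp only: mult_zero_left add_0)
next
  assume j: "even j"
  have x0: "complex_of_real x \<noteq> 0" using assms by simp
  \<comment> \<open>The limit was computed with complex \<open>powr\<close>; the claim is phrased
    with integer powers of the real x.\<close>
  have "complex_of_real x powr of_nat (2 * j + 1) = of_real (x powi (2 * int j + 1))"
    using complex_powr_of_int[OF disjI1[OF x0], of "2 * int j + 1"] by (simp add: add.commute)
  moreover have "complex_of_real x powr (- of_nat j - 1) = of_real (x powi (- int j - 1))"
    using complex_powr_of_int[OF disjI1[OF x0], of "- int j - 1"] by simp
  moreover have "edge_value j = - ((fact j)\<^sup>2 / (2 * fact (2 * j + 1))) * zeta (- 3 * of_nat j - 1)"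
    using j by (simp add: edge_value_def)
  ultimately show "Theta_diag x \<midarrow>(- of_nat j)\<rightarrow>
           - ((fact j)\<^sup>2 / (2 * fact (2 * j + 1)))
               * of_real (x powi (2 * int j + 1) + x powi (- int j - 1))
               * zeta (- 3 * of_nat j - 1)
           + (\<Sum>k\<le>j. of_nat (j choose k) * of_real (x ^ (j - k))
                 * zeta (- of_nat j - of_nat k) * zeta (- 2 * of_nat j + of_nat k))"
    using Theta_diag_tendsto[OF assms, of j] by (simp only: of_real_add mult_ac)
qed

end
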